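(* Let $n\ge 3$, let $0<R\le\infty$, let $u:[0,R^2)\to\mathbb{R}$ be a smooth function such that for all $t\in[0,R^2)$ $$\text{(i)}\ \ u''(t)-u'(t)^2\le 0,\qquad \text{(ii)}\ \ -u''(t)\,t-u'(t)\le 0,$$ and let $B_{\bar R}=(\mathbb{B}_R^{n+1},\bar g)$ with $\bar g=e^{2u(|x|^2)}\langle\cdot,\cdot\rangle$. Let $0<r_0<R$ and let $B_{\bar r_0}=(\mathbb{B}_{r_0}^{n+1},\bar g)\subset B_{\bar R}$, where $\bar r_0=r_0\int_0^1 e^{u(t^2r_0^2)}\,dt$. Let $\Sigma^n\hookrightarrow B_{\bar r_0}\subset B_{\bar R}$ be a compact free boundary minimal hypersurface such that $$|A|^2\le \frac{n^2}{4\bar r_0^2}.$$ Then $\Sigma$ is a totally geodesic disk $D^n$ passing through the center of the ball.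
   Context: $\mathbb{B}_R^{n+1}$ is the Euclidean ball of radius $R$ centred at the origin of $\mathbb{R}^{n+1}$ ($\mathbb{B}_\infty^{n+1}=\mathbb{R}^{n+1}$), $\langle\cdot,\cdot\rangle$ is the Euclidean metric and $|x|$ the Euclidean norm. A point at Euclidean distance $r$ from the origin has $\bar g$-distance $\bar r=r\int_0^1 e^{u(t^2r^2)}\,dt$ from the origin, so $\bar r_0$ is the $\bar g$-radius of $B_{\bar r_0}$. Minimality, the second fundamental form $A$, its squared norm $|A|^2$ and "totally geodesic" are taken with respect to $\bar g$. $\Sigma$ is immersed; "free boundary" means that $\partial\Sigma\subset\partial B_{\bar r_0}$ and $\Sigma$ meets $\partial B_{\bar r_0}$ orthogonally along $\partial\Sigma$. *)

theory Defs
  imports "HOL-Analysis.Analysis"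
begin

text \<open>\<open>k\<close>-fold continuous differentiability; meant for open \<open>U\<close>.\<close>

primrec Ck_on :: "nat \<Rightarrow> 'a::euclidean_space set \<Rightarrow> ('a \<Rightarrow> 'b::real_normed_vector) \<Rightarrow> bool" where
  "Ck_on 0 U f \<longleftrightarrow> continuous_on U f"
| "Ck_on (Suc k) U f \<longleftrightarrow>
     (\<forall>x\<in>U. f differentiable (at x)) \<and> (\<forall>v. Ck_on k U (\<lambda>x. frechet_derivative f (at x) v))"

text \<open>On an arbitrary set (e.g. a relatively open subset of a half-space, a closed ball, or a
  half-open interval) a map is smooth if it extends locally to a smooth map on an open set.\<close>

definition smooth_on :: "'a::euclidean_space set \<Rightarrow> ('a \<Rightarrow> 'b::real_normed_vector) \<Rightarrow> bool" where
  "smooth_on S f \<longleftrightarrow>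
     (\<forall>x\<in>S. \<exists>U g. open U \<and> x \<in> U \<and> (\<forall>k. Ck_on k U g) \<and> (\<forall>y\<in>S \<inter> U. g y = f y))"

text \<open>Which coordinate is singled out to define the model half-space is immaterial.\<close>

definition bdry_coord :: "'n::finite" where
  "bdry_coord = (SOME i. True)"

definition half_space :: "(real ^ 'n::finite) set" where
  "half_space = {x. 0 \<le> x $ bdry_coord}"

definition smooth_atlas :: "'p topology \<Rightarrow> ('p set \<times> ('p \<Rightarrow> real ^ 'n::finite)) set \<Rightarrow> bool" where
  "smooth_atlas M \<A> \<longleftrightarrow>
     (\<forall>(U, \<phi>)\<in>\<A>. openin M U \<and> openin (top_of_set half_space) (\<phi> ` U)
        \<and> homeomorphic_map (subtopology M U) (top_of_set (\<phi> ` U)) \<phi>)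
     \<and> (\<Union>(U, \<phi>)\<in>\<A>. U) = topspace M
     \<and> (\<forall>(U, \<phi>)\<in>\<A>. \<forall>(V, \<psi>)\<in>\<A>. smooth_on (\<phi> ` (U \<inter> V)) (\<psi> \<circ> inv_into U \<phi>))"

definition smooth_manifold_with_boundary ::
    "'p topology \<Rightarrow> ('p set \<times> ('p \<Rightarrow> real ^ 'n::finite)) set \<Rightarrow> bool" where
  "smooth_manifold_with_boundary M \<A> \<longleftrightarrow>
     Hausdorff_space M \<and> second_countable M \<and> smooth_atlas M \<A>"

definition manifold_boundary :: "('p set \<times> ('p \<Rightarrow> real ^ 'n::finite)) set \<Rightarrow> 'p set" where
  "manifold_boundary \<A> = {p. \<exists>(U, \<phi>)\<in>\<A>. p \<in> U \<and> \<phi> p $ bdry_coord = 0}"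

definition diffeomorphic_to_closed_disk ::
    "'p topology \<Rightarrow> ('p set \<times> ('p \<Rightarrow> real ^ 'n::finite)) set \<Rightarrow> bool" where
  "diffeomorphic_to_closed_disk M \<A> \<longleftrightarrow>
     (\<exists>(\<psi> :: real ^ 'n \<Rightarrow> 'p) \<theta>. homeomorphic_maps (top_of_set (cball 0 1)) M \<psi> \<theta>
        \<and> (\<forall>(U, \<phi>)\<in>\<A>. smooth_on (cball 0 1 \<inter> \<psi> -` U) (\<phi> \<circ> \<psi>)
             \<and> smooth_on (\<phi> ` U) (\<theta> \<circ> inv_into U \<phi>)))"

text \<open>Derivatives are taken within \<open>S\<close>, so that they also make sense at boundary points of
  a relatively open subset \<open>S\<close> of the half-space (where they are still unique).\<close>

definition partial :: "(real ^ 'n::finite) set \<Rightarrow> 'n \<Rightarrow> (real ^ 'n \<Rightarrow> 'b::real_normed_vector)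
    \<Rightarrow> real ^ 'n \<Rightarrow> 'b" where
  "partial S i f x = frechet_derivative f (at x within S) (axis i 1)"

text \<open>A metric is given by the field \<open>g\<close> of its Gram matrices in the standard coordinates.\<close>

definition metric_inner :: "(real ^ 'm \<Rightarrow> real ^ 'm ^ 'm::finite) \<Rightarrow> real ^ 'm
    \<Rightarrow> real ^ 'm \<Rightarrow> real ^ 'm \<Rightarrow> real" where
  "metric_inner g x v w = v \<bullet> (g x *v w)"

definition conformal_metric :: "(real \<Rightarrow> real) \<Rightarrow> real ^ 'm \<Rightarrow> real ^ 'm ^ 'm::finite" where
  "conformal_metric u x = mat (exp (2 * u ((norm x)\<^sup>2)))"

text \<open>\<open>christoffel g x k i j\<close> is $\Gamma^k_{ij}$ of the Levi-Civita connection of \<open>g\<close>.\<close>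

definition christoffel :: "(real ^ 'm \<Rightarrow> real ^ 'm ^ 'm::finite) \<Rightarrow> real ^ 'm
    \<Rightarrow> 'm \<Rightarrow> 'm \<Rightarrow> 'm \<Rightarrow> real" where
  "christoffel g x k i j = 1/2 * (\<Sum>l\<in>UNIV. matrix_inv (g x) $ k $ l *
     (partial UNIV i (\<lambda>y. g y $ j $ l) x + partial UNIV j (\<lambda>y. g y $ i $ l) x
      - partial UNIV l (\<lambda>y. g y $ i $ j) x))"

definition normal_space :: "(real ^ 'm \<Rightarrow> real ^ 'm ^ 'm::finite) \<Rightarrow> real ^ 'm
    \<Rightarrow> (real ^ 'm) set \<Rightarrow> (real ^ 'm) set" where
  "normal_space g x T = {\<nu>. \<forall>v\<in>T. metric_inner g x \<nu> v = 0}"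

definition induced_metric :: "(real ^ 'm \<Rightarrow> real ^ 'm ^ 'm::finite) \<Rightarrow> (real ^ 'n::finite) set
    \<Rightarrow> (real ^ 'n \<Rightarrow> real ^ 'm) \<Rightarrow> real ^ 'n \<Rightarrow> real ^ 'n ^ 'n" where
  "induced_metric g S F x = (\<chi> i j. metric_inner g (F x) (partial S i F x) (partial S j F x))"

text \<open>For a parametrization \<open>F\<close> on \<open>S\<close>: the ambient covariant derivative of \<open>\<partial>\<^sub>j F\<close> in direction \<open>\<partial>\<^sub>i F\<close>.\<close>

definition ambient_deriv :: "(real ^ 'm \<Rightarrow> real ^ 'm ^ 'm::finite) \<Rightarrow> (real ^ 'n::finite) set
    \<Rightarrow> (real ^ 'n \<Rightarrow> real ^ 'm) \<Rightarrow> real ^ 'n \<Rightarrow> 'n \<Rightarrow> 'n \<Rightarrow> real ^ 'm" where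
  "ambient_deriv g S F x i j = partial S i (partial S j F) x
     + (\<chi> k. \<Sum>a\<in>UNIV. \<Sum>b\<in>UNIV. christoffel g (F x) k a b * partial S i F x $ a * partial S j F x $ b)"

text \<open>The vector-valued second fundamental form: the normal component of the above.  No choice
  of unit normal, hence no orientability, is needed.\<close>

definition second_fund_form :: "(real ^ 'm \<Rightarrow> real ^ 'm ^ 'm::finite) \<Rightarrow> (real ^ 'n::finite) set
    \<Rightarrow> (real ^ 'n \<Rightarrow> real ^ 'm) \<Rightarrow> real ^ 'n \<Rightarrow> 'n \<Rightarrow> 'n \<Rightarrow> real ^ 'm" where
  "second_fund_form g S F x i j = ambient_deriv g S F x i j
     - (\<Sum>k\<in>UNIV. \<Sum>l\<in>UNIV. (matrix_inv (induced_metric g S F x) $ k $ l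
          * metric_inner g (F x) (ambient_deriv g S F x i j) (partial S k F x)) *\<^sub>R partial S l F x)"

definition mean_curvature_vector :: "(real ^ 'm \<Rightarrow> real ^ 'm ^ 'm::finite) \<Rightarrow> (real ^ 'n::finite) set
    \<Rightarrow> (real ^ 'n \<Rightarrow> real ^ 'm) \<Rightarrow> real ^ 'n \<Rightarrow> real ^ 'm" where
  "mean_curvature_vector g S F x =
     (\<Sum>i\<in>UNIV. \<Sum>j\<in>UNIV. matrix_inv (induced_metric g S F x) $ i $ j *\<^sub>R second_fund_form g S F x i j)"

definition sff_norm_sq :: "(real ^ 'm \<Rightarrow> real ^ 'm ^ 'm::finite) \<Rightarrow> (real ^ 'n::finite) set
    \<Rightarrow> (real ^ 'n \<Rightarrow> real ^ 'm) \<Rightarrow> real ^ 'n \<Rightarrow> real" where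
  "sff_norm_sq g S F x =
     (let h = matrix_inv (induced_metric g S F x) in
      \<Sum>i\<in>UNIV. \<Sum>j\<in>UNIV. \<Sum>k\<in>UNIV. \<Sum>l\<in>UNIV. h $ i $ k * h $ j $ l
        * metric_inner g (F x) (second_fund_form g S F x i j) (second_fund_form g S F x k l))"

definition param_tangent_space :: "(real ^ 'n::finite) set \<Rightarrow> (real ^ 'n \<Rightarrow> real ^ 'm::finite)
    \<Rightarrow> real ^ 'n \<Rightarrow> (real ^ 'm) set" where
  "param_tangent_space S F x = range (frechet_derivative F (at x within S))"

abbreviation in_chart :: "('p \<Rightarrow> real ^ 'm::finite) \<Rightarrow> 'p set \<Rightarrow> ('p \<Rightarrow> real ^ 'n::finite)
    \<Rightarrow> real ^ 'n \<Rightarrow> real ^ 'm" where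
  "in_chart f U \<phi> \<equiv> f \<circ> inv_into U \<phi>"

definition smooth_immersion :: "('p set \<times> ('p \<Rightarrow> real ^ 'n::finite)) set
    \<Rightarrow> ('p \<Rightarrow> real ^ 'm::finite) \<Rightarrow> bool" where
  "smooth_immersion \<A> f \<longleftrightarrow> (\<forall>(U, \<phi>)\<in>\<A>. smooth_on (\<phi> ` U) (in_chart f U \<phi>)
     \<and> (\<forall>x\<in>\<phi> ` U. inj (frechet_derivative (in_chart f U \<phi>) (at x within \<phi> ` U))))"

definition immersed_hypersurface :: "'p topology \<Rightarrow> ('p set \<times> ('p \<Rightarrow> real ^ 'n::finite)) set
    \<Rightarrow> ('p \<Rightarrow> real ^ 'm::finite) \<Rightarrow> bool" where
  "immersed_hypersurface M \<A> f \<longleftrightarrow> CARD('m) = CARD('n) + 1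
     \<and> smooth_manifold_with_boundary M \<A> \<and> smooth_immersion \<A> f"

definition minimal_immersion :: "(real ^ 'm \<Rightarrow> real ^ 'm ^ 'm::finite)
    \<Rightarrow> ('p set \<times> ('p \<Rightarrow> real ^ 'n::finite)) set \<Rightarrow> ('p \<Rightarrow> real ^ 'm) \<Rightarrow> bool" where
  "minimal_immersion g \<A> f \<longleftrightarrow>
     (\<forall>(U, \<phi>)\<in>\<A>. \<forall>x\<in>\<phi> ` U. mean_curvature_vector g (\<phi> ` U) (in_chart f U \<phi>) x = 0)"

definition totally_geodesic_immersion :: "(real ^ 'm \<Rightarrow> real ^ 'm ^ 'm::finite)
    \<Rightarrow> ('p set \<times> ('p \<Rightarrow> real ^ 'n::finite)) set \<Rightarrow> ('p \<Rightarrow> real ^ 'm) \<Rightarrow> bool" where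
  "totally_geodesic_immersion g \<A> f \<longleftrightarrow>
     (\<forall>(U, \<phi>)\<in>\<A>. \<forall>x\<in>\<phi> ` U. \<forall>i j. second_fund_form g (\<phi> ` U) (in_chart f U \<phi>) x i j = 0)"

definition sff_norm_sq_le :: "(real ^ 'm \<Rightarrow> real ^ 'm ^ 'm::finite)
    \<Rightarrow> ('p set \<times> ('p \<Rightarrow> real ^ 'n::finite)) set \<Rightarrow> ('p \<Rightarrow> real ^ 'm) \<Rightarrow> real \<Rightarrow> bool" where
  "sff_norm_sq_le g \<A> f c \<longleftrightarrow>
     (\<forall>(U, \<phi>)\<in>\<A>. \<forall>x\<in>\<phi> ` U. sff_norm_sq g (\<phi> ` U) (in_chart f U \<phi>) x \<le> c)"

text \<open>The boundary lies on the sphere of Euclidean radius \<open>r\<close>, and along it the \<open>g\<close>-normals of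
  the hypersurface are \<open>g\<close>-orthogonal to the \<open>g\<close>-normals of that sphere, whose tangent space at
  \<open>y\<close> is \<open>{v. y \<bullet> v = 0}\<close>.\<close>

definition free_boundary :: "(real ^ 'm \<Rightarrow> real ^ 'm ^ 'm::finite) \<Rightarrow> real
    \<Rightarrow> ('p set \<times> ('p \<Rightarrow> real ^ 'n::finite)) set \<Rightarrow> ('p \<Rightarrow> real ^ 'm) \<Rightarrow> bool" where
  "free_boundary g r \<A> f \<longleftrightarrow>
     (\<forall>p\<in>manifold_boundary \<A>. f p \<in> sphere 0 r)
     \<and> (\<forall>(U, \<phi>)\<in>\<A>. \<forall>p\<in>U \<inter> manifold_boundary \<A>.
          \<forall>\<nu>\<in>normal_space g (f p) (param_tangent_space (\<phi> ` U) (in_chart f U \<phi>) (\<phi> p)).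
          \<forall>N\<in>normal_space g (f p) {v. f p \<bullet> v = 0}. metric_inner g (f p) \<nu> N = 0)"

end

theory Submission
  imports Defs
begin

text \<open>
  Let \<open>W\<close> be the Euclidean support function of the hypersurface, i.e. the normal component of the position
  vector, let \<open>s\<close> be the conformal distance to the origin, and let \<open>c = n / (2 s\<^sub>0\<^sup>2)\<close>, where \<open>s\<^sub>0\<close> is the
  conformal radius of the ball.  The radial field is conformal, so \<open>W\<close> solves a linear elliptic equation;
  condition (i) gives its zeroth order term a sign up to \<open>|A|\<^sup>2 \<le> n\<^sup>2 / (4 s\<^sub>0\<^sup>2)\<close>, and by (ii) the function
  \<open>exp (- c s\<^sup>2 / 2)\<close> is a strict supersolution.  Hence \<open>ln |W| + u + c s\<^sup>2 / 2\<close> has no maximum in the interior,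
  while \<open>W = 0\<close> on the free boundary: \<open>W\<close> vanishes identically and the position vector is tangent.

  The normal is then constant in the radial direction.  An even function of the normal minus a small
  multiple of \<open>|x|\<^sup>2\<close> can therefore have its maximum only at one of the finitely many points mapped to the
  origin, so the normal takes finitely many values up to sign and, by connectedness, only one.  Thus the
  hypersurface lies in a hyperplane through the origin and is mapped to an \<open>n\<close>-ball of it by a local
  diffeomorphism, also along the boundary.  Pushing points radially to the centre shows that this map is
  bijective.
\<close>

section \<open>Calculus of \<open>k\<close> times continuously differentiable maps\<close>

text \<open>All computations are Euclidean: the metric is conformally flat, so it has the normals
  and angles of flat space, and minimality becomes the equation H = 2 n u' W for the Euclidean mean
  curvature. The support function with respect to the conformal metric is e^u W, which is why
  \<open>u\<close> is added to ln |W|.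

  The constant c balances two effects. The weight c s^2 / 2 contributes at least n c through its
  Hessian and loses at most c^2 s0^2 through its gradient. The difference n c - c^2 s0^2 is largest
  for c = n / (2 s0^2), and its maximum n^2 / (4 s0^2) is exactly the assumed bound. The loss also
  carries the share of the tangential part in the squared norm of the position vector, which is less
  than 1 where W is nonzero; so the inequality at the maximum point is strict even when the bound is
  attained.

  Two obstacles shape the rest. There is no global unit normal a priori, so only even functions of a
  normal are used. And derivatives at boundary points are one-sided, so each chart is extended
  beyond the boundary and what is known on the half-space is transferred to the extension.\<close>

lemma frechet_derivative_cong_open:
  assumes "open U" "x \<in> U" "\<And>y. y \<in> U \<Longrightarrow> f y = g y"
  shows "frechet_derivative f (at x) = frechet_derivative g (at x)"
proof -
  have "(f has_derivative D) (at x) \<longleftrightarrow> (g has_derivative D) (at x)" for D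
    using has_derivative_transform_within_open[OF _ assms(1,2), of f D UNIV g]
      has_derivative_transform_within_open[OF _ assms(1,2), of g D UNIV f] assms(3) by auto
  then show ?thesis by (simp add: frechet_derivative_def)
qed

lemma differentiable_cong_open:
  assumes "open U" "x \<in> U" "\<And>y. y \<in> U \<Longrightarrow> f y = g y" "f differentiable (at x)"
  shows "g differentiable (at x)"
  using assms has_derivative_transform_within_open[OF _ assms(1,2), of f _ UNIV g]
  unfolding differentiable_def by blast

lemma Ck_on_cong:
  assumes "open U" "\<And>y. y \<in> U \<Longrightarrow> f y = g y" "Ck_on k U f"
  shows "Ck_on k U g"
  using assms(2,3)
proof (induction k arbitrary: f g)
  case 0
  then show ?case using continuous_on_cong[of U U f g] by simp
next
  case (Suc k)
  have "Ck_on k U (\<lambda>x. frechet_derivative g (at x) v)" for v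
  proof (rule Suc.IH[of "\<lambda>x. frechet_derivative f (at x) v"])
    show "Ck_on k U (\<lambda>x. frechet_derivative f (at x) v)" using Suc.prems(2) by simp
  qed (simp add: frechet_derivative_cong_open[OF assms(1) _ Suc.prems(1)])
  then show ?case
    using Suc.prems(2) differentiable_cong_open[OF assms(1) _ Suc.prems(1)] by simp
qed

lemma Ck_on_subset: "Ck_on k U f \<Longrightarrow> V \<subseteq> U \<Longrightarrow> Ck_on k V f"
  by (induction k arbitrary: f) (auto intro: continuous_on_subset)

lemma Ck_on_Suc_imp_continuous: "Ck_on (Suc k) U f \<Longrightarrow> continuous_on U f"
  by (auto intro!: continuous_at_imp_continuous_on differentiable_imp_continuous_within)

lemma Ck_on_imp_continuous: "Ck_on k U f \<Longrightarrow> continuous_on U f"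
  using Ck_on_Suc_imp_continuous by (cases k) (simp, blast)

lemma Ck_on_SucD: "Ck_on (Suc k) U f \<Longrightarrow> Ck_on k U f"
proof (induction k arbitrary: f)
  case 0
  then show ?case using Ck_on_Suc_imp_continuous[of 0 U f] by simp
next
  case (Suc k)
  then show ?case using Suc.IH[of "\<lambda>x. frechet_derivative f (at x) _"] by simp
qed

lemma Ck_on_Suc_deriv:
  "Ck_on (Suc k) U f \<Longrightarrow> Ck_on k U (\<lambda>x. frechet_derivative f (at x) v)"
  by simp

lemma Ck_on_differentiable: "Ck_on (Suc k) U f \<Longrightarrow> x \<in> U \<Longrightarrow> f differentiable (at x)"
  by simp

lemma Ck_on_has_derivative:
  "Ck_on (Suc k) U f \<Longrightarrow> x \<in> U \<Longrightarrow> (f has_derivative frechet_derivative f (at x)) (at x)"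
  using frechet_derivative_works by auto

text \<open>Any explicit formula \<open>D\<close> for the derivative will do, so the rules below
  need not handle the choice operator in \<open>frechet_derivative\<close>.\<close>

lemma Ck_on_SucI:
  assumes "open U" "\<And>x. x \<in> U \<Longrightarrow> (f has_derivative D x) (at x)"
    "\<And>v. Ck_on k U (\<lambda>x. D x v)"
  shows "Ck_on (Suc k) U f"
proof -
  have "frechet_derivative f (at x) = D x" if "x \<in> U" for x
    using assms(2)[OF that] frechet_derivative_at by metis
  then have "Ck_on k U (\<lambda>x. frechet_derivative f (at x) v)" for v
    using Ck_on_cong[OF assms(1) _ assms(3)[of v], of "\<lambda>x. frechet_derivative f (at x) v"] by simp
  then show ?thesis using assms(2) by (auto simp: differentiable_def)
qed

lemma Ck_on_const: "open U \<Longrightarrow> Ck_on k U (\<lambda>x. c)"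
  by (induction k arbitrary: c) (auto simp: frechet_derivative_const)

lemma Ck_on_bounded_linear:
  assumes "bounded_linear L" "open U" "Ck_on k U f"
  shows "Ck_on k U (\<lambda>x. L (f x))"
  using assms(3)
proof (induction k arbitrary: f)
  case 0
  then show ?case using assms by (simp add: bounded_linear.continuous_on)
next
  case (Suc k)
  show ?case
  proof (rule Ck_on_SucI[OF assms(2)])
    show "((\<lambda>x. L (f x)) has_derivative (\<lambda>v. L (frechet_derivative f (at x) v))) (at x)" if "x \<in> U" for x
      using bounded_linear.has_derivative[OF assms(1) Ck_on_has_derivative[OF Suc.prems that]] .
    show "Ck_on k U (\<lambda>x. L (frechet_derivative f (at x) v))" for v
      using Suc by simp
  qed
qed

lemma Ck_on_id: "open U \<Longrightarrow> Ck_on k U (\<lambda>x. x)"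
  by (cases k) (auto simp: Ck_on_const)

lemma Ck_on_add:
  assumes "open U" "Ck_on k U f" "Ck_on k U g"
  shows "Ck_on k U (\<lambda>x. f x + g x)"
  using assms(2,3)
proof (induction k arbitrary: f g)
  case 0
  then show ?case by (simp add: continuous_on_add)
next
  case (Suc k)
  show ?case
  proof (rule Ck_on_SucI[OF assms(1)])
    show "((\<lambda>x. f x + g x) has_derivative (\<lambda>v. frechet_derivative f (at x) v + frechet_derivative g (at x) v)) (at x)"
      if "x \<in> U" for x
      by (intro has_derivative_add Ck_on_has_derivative[OF Suc.prems(1) that] Ck_on_has_derivative[OF Suc.prems(2) that])
    show "Ck_on k U (\<lambda>x. frechet_derivative f (at x) v + frechet_derivative g (at x) v)" for v
      using Suc by simp
  qed
qed

text \<open>One product rule covers multiplication, scaling and the inner product. In the induction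
  step each factor also occurs undifferentiated, hence the appeals to
  \<open>Ck_on_SucD\<close>.\<close>

lemma Ck_on_bilinear:
  assumes B: "bounded_bilinear B" and "open U" "Ck_on k U f" "Ck_on k U g"
  shows "Ck_on k U (\<lambda>x. B (f x) (g x))"
  using assms(3,4)
proof (induction k arbitrary: f g)
  case 0
  then show ?case by (simp add: bounded_bilinear.continuous_on[OF B])
next
  case (Suc k)
  show ?case
  proof (rule Ck_on_SucI[OF assms(2)])
    show "((\<lambda>x. B (f x) (g x)) has_derivative
        (\<lambda>v. B (f x) (frechet_derivative g (at x) v) + B (frechet_derivative f (at x) v) (g x))) (at x)"
      if "x \<in> U" for x
      by (intro bounded_bilinear.FDERIV[OF B] Ck_on_has_derivative[OF Suc.prems(1) that]
        Ck_on_has_derivative[OF Suc.prems(2) that])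
    show "Ck_on k U (\<lambda>x. B (f x) (frechet_derivative g (at x) v) + B (frechet_derivative f (at x) v) (g x))" for v
      by (intro Ck_on_add[OF assms(2)] Suc.IH[OF Ck_on_SucD[OF Suc.prems(1)] Ck_on_Suc_deriv[OF Suc.prems(2)]]
        Suc.IH[OF Ck_on_Suc_deriv[OF Suc.prems(1)] Ck_on_SucD[OF Suc.prems(2)]])
  qed
qed

lemmas Ck_on_mult = Ck_on_bilinear[OF bounded_bilinear_mult]
lemmas Ck_on_scaleR = Ck_on_bilinear[OF bounded_bilinear_scaleR]
lemmas Ck_on_inner = Ck_on_bilinear[OF bounded_bilinear_inner]

lemma Ck_on_minus: "open U \<Longrightarrow> Ck_on k U f \<Longrightarrow> Ck_on k U (\<lambda>x. - f x)"
  by (rule Ck_on_bounded_linear[OF bounded_linear_minus[OF bounded_linear_ident]])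

lemma Ck_on_diff: "open U \<Longrightarrow> Ck_on k U f \<Longrightarrow> Ck_on k U g \<Longrightarrow> Ck_on k U (\<lambda>x. f x - g x)"
  using Ck_on_add[OF _ _ Ck_on_minus, of U k f g] by simp

lemma Ck_on_sum:
  assumes "open U" "\<And>i. i \<in> I \<Longrightarrow> Ck_on k U (f i)"
  shows "Ck_on k U (\<lambda>x. \<Sum>i\<in>I. f i x)"
  using assms(2)
  by (induction I rule: infinite_finite_induct) (auto simp: Ck_on_const[OF assms(1)] Ck_on_add[OF assms(1)])

lemma Ck_on_prod:
  fixes f :: "'i \<Rightarrow> 'a::euclidean_space \<Rightarrow> 'b::real_normed_field"
  assumes "open U" "\<And>i. i \<in> I \<Longrightarrow> Ck_on k U (f i)"
  shows "Ck_on k U (\<lambda>x. \<Prod>i\<in>I. f i x)"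
  using assms(2)
  by (induction I rule: infinite_finite_induct) (auto simp: Ck_on_const[OF assms(1)] Ck_on_mult[OF assms(1)])

lemma Ck_on_inverse:
  fixes f :: "'a::euclidean_space \<Rightarrow> real"
  assumes "open U" "Ck_on k U f" "\<And>x. x \<in> U \<Longrightarrow> f x \<noteq> 0"
  shows "Ck_on k U (\<lambda>x. inverse (f x))"
  using assms(2)
proof (induction k)
  case 0
  then show ?case using assms(3) by (simp add: continuous_on_inverse)
next
  case (Suc k)
  note C = Suc.IH[OF Ck_on_SucD[OF Suc.prems]]
  show ?case
  proof (rule Ck_on_SucI[OF assms(1)])
    show "((\<lambda>x. inverse (f x)) has_derivative (\<lambda>v. - (inverse (f x) * frechet_derivative f (at x) v * inverse (f x)))) (at x)"
      if "x \<in> U" for x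
      by (rule Deriv.has_derivative_inverse[OF assms(3)[OF that] Ck_on_has_derivative[OF Suc.prems that]])
    show "Ck_on k U (\<lambda>x. - (inverse (f x) * frechet_derivative f (at x) v * inverse (f x)))" for v
      by (intro Ck_on_minus Ck_on_mult C assms(1) Ck_on_Suc_deriv[OF Suc.prems])
  qed
qed

lemma Ck_on_component: "open U \<Longrightarrow> Ck_on k U f \<Longrightarrow> Ck_on k U (\<lambda>x. f x $ i)"
  by (rule Ck_on_bounded_linear[OF bounded_linear_vec_nth])

lemma Ck_on_vec:
  fixes f :: "'a::euclidean_space \<Rightarrow> 'b::euclidean_space ^ 'n::finite"
  assumes "open U" "\<And>i. Ck_on k U (\<lambda>x. f x $ i)"
  shows "Ck_on k U f"
proof -
  have eq: "(\<Sum>i\<in>UNIV. axis i (f x $ i)) = f x" for x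
    by (simp add: vec_eq_iff axis_def if_distrib cong: if_cong)
  have "bounded_linear (axis i :: 'b \<Rightarrow> 'b ^ 'n)" for i
    by (rule linear_conv_bounded_linear[THEN iffD1], rule linearI)
       (auto simp: axis_def vec_eq_iff)
  then have "Ck_on k U (\<lambda>x. \<Sum>i\<in>UNIV. axis i (f x $ i))"
    by (intro Ck_on_sum assms(1) Ck_on_bounded_linear[OF _ assms])
  then show ?thesis by (simp add: eq)
qed

lemma Ck_on_det:
  fixes A :: "'a::euclidean_space \<Rightarrow> real ^ 'n ^ 'n::finite"
  assumes "open U" "\<And>i j. Ck_on k U (\<lambda>x. A x $ i $ j)"
  shows "Ck_on k U (\<lambda>x. det (A x))"
  unfolding det_def
  by (intro Ck_on_sum Ck_on_mult Ck_on_const Ck_on_prod assms)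

lemma matrix_inv_det_nz:
  fixes A :: "real ^ 'n ^ 'n::finite"
  assumes "det A \<noteq> 0"
  shows "A ** matrix_inv A = mat 1" "matrix_inv A ** A = mat 1"
proof -
  have "\<exists>B. A ** B = mat 1 \<and> B ** A = mat 1"
    using assms invertible_det_nz[of A] unfolding invertible_def by blast
  then have "A ** matrix_inv A = mat 1 \<and> matrix_inv A ** A = mat 1"
    unfolding matrix_inv_def by (rule someI_ex)
  then show "A ** matrix_inv A = mat 1" "matrix_inv A ** A = mat 1" by auto
qed

text \<open>Column \<open>l\<close> of the inverse solves a linear system, and Cramer's rule writes
  its entries as quotients of determinants. The inverse is therefore as smooth as the matrix
  wherever the determinant does not vanish.\<close>

lemma matrix_inv_cramer:
  fixes A :: "real ^ 'n ^ 'n::finite"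
  assumes "det A \<noteq> 0"
  shows "matrix_inv A $ k $ l = det (\<chi> i j. if j = k then axis l 1 $ i else A $ i $ j) * inverse (det A)"
proof -
  have inv: "A ** matrix_inv A = mat 1"
    by (rule matrix_inv_det_nz[OF assms])
  have "A *v (matrix_inv A *v axis l 1) = axis l 1"
    by (simp add: matrix_vector_mul_assoc inv)
  then have "matrix_inv A *v axis l 1 = (\<chi> k. det (\<chi> i j. if j = k then axis l 1 $ i else A $ i $ j) / det A)"
    using cramer[OF assms] by blast
  then have "(matrix_inv A *v axis l 1) $ k = det (\<chi> i j. if j = k then axis l 1 $ i else A $ i $ j) / det A"
    by simp
  then show ?thesis by (simp add: matrix_vector_mult_basis column_def divide_inverse)
qed

lemma Ck_on_matrix_inv:
  fixes A :: "'a::euclidean_space \<Rightarrow> real ^ 'n ^ 'n::finite"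
  assumes "open U" "\<And>i j. Ck_on k U (\<lambda>x. A x $ i $ j)" "\<And>x. x \<in> U \<Longrightarrow> det (A x) \<noteq> 0"
  shows "Ck_on k U (\<lambda>x. matrix_inv (A x) $ i $ j)"
proof (rule Ck_on_cong[OF assms(1)])
  show "Ck_on k U (\<lambda>x. det (\<chi> i' j'. if j' = i then axis j 1 $ i' else A x $ i' $ j') * inverse (det (A x)))"
  proof (intro Ck_on_mult Ck_on_det Ck_on_inverse assms)
    show "Ck_on k U (\<lambda>x. (\<chi> i' j'. if j' = i then axis j 1 $ i' else A x $ i' $ j') $ i' $ j')" for i' j'
      by (cases "j' = i") (auto simp: assms Ck_on_const)
  qed
qed (simp add: matrix_inv_cramer assms(3))

lemma linear_sum_Basis:
  fixes f :: "'a::euclidean_space \<Rightarrow> 'b::real_vector"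
  assumes "linear f"
  shows "f v = (\<Sum>b\<in>Basis. (v \<bullet> b) *\<^sub>R f b)"
  using linear_sum[OF assms, of "\<lambda>b. (v \<bullet> b) *\<^sub>R b" Basis]
  by (simp add: euclidean_representation linear_cmul[OF assms])

lemma Ck_on_compose:
  fixes f :: "'a::euclidean_space \<Rightarrow> 'b::euclidean_space" and g :: "'b \<Rightarrow> 'c::real_normed_vector"
  assumes "open U" "Ck_on k U f" "Ck_on k V g" "f ` U \<subseteq> V"
  shows "Ck_on k U (\<lambda>x. g (f x))"
  using assms(2,3)
proof (induction k arbitrary: g)
  case 0
  then show ?case using assms(4) continuous_on_compose2[of V g U f] by simp
next
  case (Suc k)
  show ?case
  proof (rule Ck_on_SucI[OF assms(1)])
    fix x assume x: "x \<in> U"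
    then have lin: "linear (frechet_derivative g (at (f x)))"
      using Ck_on_has_derivative[OF Suc.prems(2)] has_derivative_linear assms(4) by blast
    have "((\<lambda>x. g (f x)) has_derivative (\<lambda>v. frechet_derivative g (at (f x)) (frechet_derivative f (at x) v))) (at x)"
      using has_derivative_compose[OF Ck_on_has_derivative[OF Suc.prems(1) x], of g]
        Ck_on_has_derivative[OF Suc.prems(2), of "f x"] assms(4) x by blast
    \<comment> \<open>In the chain rule the direction fed to the derivative of \<open>g\<close>
      moves with \<open>x\<close>, whereas \<open>Ck_on\<close> controls derivatives in fixed
      directions; expanding in a basis fixes the directions.\<close>
    then show "((\<lambda>x. g (f x)) has_derivative (\<lambda>v. \<Sum>b\<in>Basis. (frechet_derivative f (at x) v \<bullet> b) *\<^sub>R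
        frechet_derivative g (at (f x)) b)) (at x)"
      by (simp add: linear_sum_Basis[OF lin, symmetric])
  next
    show "Ck_on k U (\<lambda>x. \<Sum>b\<in>Basis. (frechet_derivative f (at x) v \<bullet> b) *\<^sub>R frechet_derivative g (at (f x)) b)" for v
      by (intro Ck_on_sum Ck_on_scaleR Ck_on_inner Ck_on_const assms(1) Ck_on_Suc_deriv[OF Suc.prems(1)]
        Suc.IH[OF Ck_on_SucD[OF Suc.prems(1)] Ck_on_Suc_deriv[OF Suc.prems(2)]])
  qed
qed

section \<open>Symmetry of mixed second derivatives\<close>

lemma second_difference_mean_value:
  fixes f :: "'a::euclidean_space \<Rightarrow> real"
  assumes C: "Ck_on (Suc (Suc 0)) U f" and h: "0 < h"
    and U: "\<And>s t. \<lbrakk>0 \<le> s; s \<le> h; 0 \<le> t; t \<le> h\<rbrakk> \<Longrightarrow> x + s *\<^sub>R v + t *\<^sub>R w \<in> U"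
  shows "\<exists>s t. 0 \<le> s \<and> s \<le> h \<and> 0 \<le> t \<and> t \<le> h \<and>
    f (x + h *\<^sub>R v + h *\<^sub>R w) - f (x + h *\<^sub>R v) - f (x + h *\<^sub>R w) + f x
      = h * (h * frechet_derivative (\<lambda>y. frechet_derivative f (at y) v) (at (x + s *\<^sub>R v + t *\<^sub>R w)) w)"
proof -
  let ?D = "\<lambda>y. frechet_derivative f (at y) v"
  have line: "((\<lambda>s. F (a + s *\<^sub>R b)) has_real_derivative F' b) (at s)"
    if "(F has_derivative F') (at (a + s *\<^sub>R b))" for F :: "'a \<Rightarrow> real" and F' a b s
  proof -
    have "((\<lambda>s. a + s *\<^sub>R b) has_derivative (\<lambda>t. t *\<^sub>R b)) (at s)"
      by (auto intro!: derivative_eq_intros)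
    from has_derivative_compose[OF this that]
    have "((\<lambda>s. F (a + s *\<^sub>R b)) has_derivative (\<lambda>t. F' (t *\<^sub>R b))) (at s)" .
    moreover have "(\<lambda>t. F' (t *\<^sub>R b)) = (*) (F' b)"
      using has_derivative_linear[OF that] by (auto simp: linear_cmul)
    ultimately show ?thesis by (simp add: has_field_derivative_def)
  qed
  have d1: "((\<lambda>s. f (x + s *\<^sub>R v + h *\<^sub>R w) - f (x + s *\<^sub>R v)) has_real_derivative
      ?D (x + s *\<^sub>R v + h *\<^sub>R w) - ?D (x + s *\<^sub>R v)) (at s)" if "0 \<le> s" "s \<le> h" for s
  proof (rule DERIV_diff)
    have "((\<lambda>s. f ((x + h *\<^sub>R w) + s *\<^sub>R v)) has_real_derivative ?D (x + h *\<^sub>R w + s *\<^sub>R v)) (at s)"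
      using line[OF Ck_on_has_derivative[OF C], of "x + h *\<^sub>R w" s v] U[of s h] that h
      by (simp add: algebra_simps)
    then show "((\<lambda>s. f (x + s *\<^sub>R v + h *\<^sub>R w)) has_real_derivative ?D (x + s *\<^sub>R v + h *\<^sub>R w)) (at s)"
      by (simp add: algebra_simps)
    show "((\<lambda>s. f (x + s *\<^sub>R v)) has_real_derivative ?D (x + s *\<^sub>R v)) (at s)"
      using line[OF Ck_on_has_derivative[OF C], of x s v] U[of s 0] that h by simp
  qed
  obtain s where s: "0 < s" "s < h" and e1:
    "(f (x + h *\<^sub>R v + h *\<^sub>R w) - f (x + h *\<^sub>R v)) - (f (x + 0 *\<^sub>R v + h *\<^sub>R w) - f (x + 0 *\<^sub>R v))
      = (h - 0) * (?D (x + s *\<^sub>R v + h *\<^sub>R w) - ?D (x + s *\<^sub>R v))"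
    using MVT2[OF h d1] by blast
  have d2: "((\<lambda>t. ?D ((x + s *\<^sub>R v) + t *\<^sub>R w)) has_real_derivative
      frechet_derivative ?D (at (x + s *\<^sub>R v + t *\<^sub>R w)) w) (at t)" if "0 \<le> t" "t \<le> h" for t
    using line[OF Ck_on_has_derivative[OF Ck_on_Suc_deriv[OF C, of v]], of "x + s *\<^sub>R v" t w]
      U[of s t] that s by simp
  obtain t where t: "0 < t" "t < h" and e2:
    "?D ((x + s *\<^sub>R v) + h *\<^sub>R w) - ?D ((x + s *\<^sub>R v) + 0 *\<^sub>R w)
      = (h - 0) * frechet_derivative ?D (at (x + s *\<^sub>R v + t *\<^sub>R w)) w"
    using MVT2[OF h d2] by blast
  show ?thesis
    by (intro exI[of _ s] exI[of _ t]) (use s t e1 e2 in simp)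
qed

text \<open>Schwarz's theorem. The second difference over a small parallelogram is symmetric in
  \<open>v\<close> and \<open>w\<close>; by the mean value theorem it is h^2 times either mixed
  derivative at some nearby point, and continuity carries the equality to \<open>x\<close>.\<close>

lemma frechet_derivative_commute_real:
  fixes f :: "'a::euclidean_space \<Rightarrow> real"
  assumes U: "open U" "x \<in> U" and C: "Ck_on (Suc (Suc 0)) U f"
  shows "frechet_derivative (\<lambda>y. frechet_derivative f (at y) v) (at x) w
       = frechet_derivative (\<lambda>y. frechet_derivative f (at y) w) (at x) v"
proof (rule ccontr)
  let ?A = "\<lambda>v w y. frechet_derivative (\<lambda>y. frechet_derivative f (at y) v) (at y) w"
  assume ne: "?A v w x \<noteq> ?A w v x"
  define e where "e = \<bar>?A v w x - ?A w v x\<bar> / 2"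
  have e: "e > 0" using ne by (simp add: e_def)
  have near: "\<exists>d>0. \<forall>y. dist y x < d \<longrightarrow> y \<in> U \<and> \<bar>?A v w y - ?A v w x\<bar> < e" for v w
  proof -
    have "continuous_on U (?A v w)" using C by simp
    then have "isCont (?A v w) x" using U continuous_on_eq_continuous_at by blast
    then obtain d where d: "d > 0" "\<forall>y. dist y x < d \<longrightarrow> dist (?A v w y) (?A v w x) < e"
      using e by (auto simp: continuous_at_eps_delta)
    obtain d' where "d' > 0" "ball x d' \<subseteq> U" using U open_contains_ball by blast
    with d show ?thesis
      by (intro exI[of _ "min d d'"]) (auto simp: dist_real_def dist_commute subset_iff)
  qed
  obtain d1 where d1: "d1 > 0" "\<And>y. dist y x < d1 \<Longrightarrow> y \<in> U \<and> \<bar>?A v w y - ?A v w x\<bar> < e"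
    using near by blast
  obtain d2 where d2: "d2 > 0" "\<And>y. dist y x < d2 \<Longrightarrow> y \<in> U \<and> \<bar>?A w v y - ?A w v x\<bar> < e"
    using near by blast
  define d where "d = min d1 d2"
  define h where "h = d / (norm v + norm w + 1)"
  have pos: "norm v + norm w + 1 > 0" by (simp add: add_nonneg_pos)
  have h: "h > 0" using d1(1) d2(1) pos by (simp add: h_def d_def)
  have small: "dist (x + s *\<^sub>R v + t *\<^sub>R w) x < d" if "0 \<le> s" "s \<le> h" "0 \<le> t" "t \<le> h" for s t
  proof -
    have "dist (x + s *\<^sub>R v + t *\<^sub>R w) x \<le> s * norm v + t * norm w"
      using norm_triangle_ineq[of "s *\<^sub>R v" "t *\<^sub>R w"] that by (simp add: dist_norm add.assoc)
    also have "\<dots> \<le> h * norm v + h * norm w"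
      using that by (intro add_mono mult_right_mono) auto
    also have "\<dots> < h * (norm v + norm w + 1)" using h by (simp add: algebra_simps)
    also have "\<dots> = d" using pos by (simp add: h_def)
    finally show ?thesis .
  qed
  have in1: "x + s *\<^sub>R v + t *\<^sub>R w \<in> U" if "0 \<le> s" "s \<le> h" "0 \<le> t" "t \<le> h" for s t
    using small[OF that] d1(2) by (simp add: d_def)
  have in2: "x + s *\<^sub>R w + t *\<^sub>R v \<in> U" if "0 \<le> s" "s \<le> h" "0 \<le> t" "t \<le> h" for s t
    using in1[of t s] that by (simp add: algebra_simps)
  obtain s t where st: "0 \<le> s" "s \<le> h" "0 \<le> t" "t \<le> h" and e1:
    "f (x + h *\<^sub>R v + h *\<^sub>R w) - f (x + h *\<^sub>R v) - f (x + h *\<^sub>R w) + f x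
      = h * (h * ?A v w (x + s *\<^sub>R v + t *\<^sub>R w))"
    using second_difference_mean_value[OF C h in1] by blast
  obtain s' t' where st': "0 \<le> s'" "s' \<le> h" "0 \<le> t'" "t' \<le> h" and e2:
    "f (x + h *\<^sub>R w + h *\<^sub>R v) - f (x + h *\<^sub>R w) - f (x + h *\<^sub>R v) + f x
      = h * (h * ?A w v (x + s' *\<^sub>R w + t' *\<^sub>R v))"
    using second_difference_mean_value[OF C h in2] by blast
  have "h * (h * ?A v w (x + s *\<^sub>R v + t *\<^sub>R w)) = h * (h * ?A w v (x + s' *\<^sub>R w + t' *\<^sub>R v))"
    using e1 e2 by (simp add: algebra_simps)
  then have eq: "?A v w (x + s *\<^sub>R v + t *\<^sub>R w) = ?A w v (x + s' *\<^sub>R w + t' *\<^sub>R v)" using h by simp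
  have n1: "\<bar>?A v w (x + s *\<^sub>R v + t *\<^sub>R w) - ?A v w x\<bar> < e"
    using small[OF st] d1(2) by (simp add: d_def)
  have "dist (x + s' *\<^sub>R w + t' *\<^sub>R v) x < d"
    using small[OF st'(3,4,1,2)] by (simp add: algebra_simps)
  then have n2: "\<bar>?A w v (x + s' *\<^sub>R w + t' *\<^sub>R v) - ?A w v x\<bar> < e"
    using d2(2) by (simp add: d_def)
  have "a \<noteq> d" if "\<bar>a - b\<bar> < \<bar>b - c\<bar> / 2" "\<bar>d - c\<bar> < \<bar>b - c\<bar> / 2" for a b c d :: real
    using that by (auto simp: abs_if split: if_splits)
  from this[OF n1[unfolded e_def] n2[unfolded e_def]] eq show False by simp
qed

lemma frechet_derivative_inner_right:
  assumes "f differentiable (at x)"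
  shows "frechet_derivative (\<lambda>y. f y \<bullet> b) (at x) v = frechet_derivative f (at x) v \<bullet> b"
proof -
  have "((\<lambda>y. f y \<bullet> b) has_derivative (\<lambda>v. frechet_derivative f (at x) v \<bullet> b)) (at x)"
    using assms frechet_derivative_works has_derivative_inner_left by blast
  then show ?thesis by (simp add: frechet_derivative_at[symmetric])
qed

lemma frechet_derivative_commute:
  fixes f :: "'a::euclidean_space \<Rightarrow> 'b::euclidean_space"
  assumes U: "open U" "x \<in> U" and C: "Ck_on (Suc (Suc 0)) U f"
  shows "frechet_derivative (\<lambda>y. frechet_derivative f (at y) v) (at x) w
       = frechet_derivative (\<lambda>y. frechet_derivative f (at y) w) (at x) v"
proof (rule euclidean_eqI)
  fix b :: 'b assume "b \<in> Basis"
  have Cb: "Ck_on (Suc (Suc 0)) U (\<lambda>y. f y \<bullet> b)"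
    by (intro Ck_on_inner Ck_on_const C U)
  have eq: "frechet_derivative (\<lambda>y. frechet_derivative f (at y) v) (at x) w \<bullet> b
      = frechet_derivative (\<lambda>y. frechet_derivative (\<lambda>y. f y \<bullet> b) (at y) v) (at x) w" for v w
  proof -
    have "frechet_derivative (\<lambda>y. frechet_derivative (\<lambda>y. f y \<bullet> b) (at y) v) (at x)
        = frechet_derivative (\<lambda>y. frechet_derivative f (at y) v \<bullet> b) (at x)"
      by (rule frechet_derivative_cong_open[OF U])
         (simp add: frechet_derivative_inner_right Ck_on_differentiable[OF C])
    then show ?thesis
      using Ck_on_differentiable[OF Ck_on_Suc_deriv[OF C] U(2)]
      by (simp add: frechet_derivative_inner_right)
  qed
  show "frechet_derivative (\<lambda>y. frechet_derivative f (at y) v) (at x) w \<bullet> b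
       = frechet_derivative (\<lambda>y. frechet_derivative f (at y) w) (at x) v \<bullet> b"
    unfolding eq by (rule frechet_derivative_commute_real[OF U Cb])
qed

text \<open>The derivative of the inverse map is the inverse matrix taken at \<open>g y\<close>, so
  k-fold differentiability of \<open>g\<close> passes to its derivative: regularity is bootstrapped
  by induction on \<open>k\<close>.\<close>

lemma Ck_on_inverse_map:
  fixes f g :: "real ^ 'n::finite \<Rightarrow> real ^ 'n"
  assumes U: "open U" and V: "open V" and hom: "homeomorphism U V f g"
    and C: "\<And>k. Ck_on k U f"
    and inj: "\<And>x. x \<in> U \<Longrightarrow> inj (frechet_derivative f (at x))"
  shows "Ck_on k V g"
proof -
  define J where "J x = matrix (frechet_derivative f (at x))" for x
  have lin: "linear (frechet_derivative f (at x))" if "x \<in> U" for x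
    using Ck_on_has_derivative[OF C that] has_derivative_linear by blast
  have Jv: "J x *v v = frechet_derivative f (at x) v" if "x \<in> U" for x v
    using fun_cong[OF matrix_vector_mul(2)[OF lin[OF that]]] unfolding J_def by simp
  have det: "det (J x) \<noteq> 0" if "x \<in> U" for x
    using inj[OF that] det_nz_iff_inj[OF lin[OF that]] by (simp add: J_def)
  have JC: "Ck_on k U (\<lambda>x. matrix_inv (J x) $ i $ j)" for k i j
    by (intro Ck_on_matrix_inv U)
       (auto simp: det, simp add: J_def matrix_def, intro Ck_on_component U Ck_on_Suc_deriv C)
  have gU: "g y \<in> U" "f (g y) = y" if "y \<in> V" for y
    using hom that by (auto simp: homeomorphism_def)
  have gd: "(g has_derivative (\<lambda>v. matrix_inv (J (g y)) *v v)) (at y)" if y: "y \<in> V" for y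
  proof -
    have "(g has_derivative (\<lambda>v. matrix_inv (J (g y)) *v v)) (at (f (g y)))"
    proof (rule has_derivative_inverse_strong[OF U gU(1)[OF y]])
      show "continuous_on U f" "\<And>x. x \<in> U \<Longrightarrow> g (f x) = x"
        using hom by (auto simp: homeomorphism_def)
      show "(f has_derivative frechet_derivative f (at (g y))) (at (g y))"
        by (rule Ck_on_has_derivative[OF C gU(1)[OF y]])
      show "frechet_derivative f (at (g y)) \<circ> (*v) (matrix_inv (J (g y))) = id"
        using matrix_inv_det_nz[OF det[OF gU(1)[OF y]]]
        by (auto simp: fun_eq_iff Jv[OF gU(1)[OF y], symmetric] matrix_vector_mul_assoc)
    qed
    then show ?thesis by (simp add: gU[OF y])
  qed
  show ?thesis
  proof (induction k)
    case 0
    then show ?case using hom by (simp add: homeomorphism_def)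
  next
    case (Suc k)
    show ?case
    proof (rule Ck_on_SucI[OF V gd])
      have ent: "Ck_on k V (\<lambda>y. matrix_inv (J (g y)) $ i $ j)" for i j
        by (rule Ck_on_compose[OF V Suc JC]) (use gU in auto)
      show "Ck_on k V (\<lambda>y. matrix_inv (J (g y)) *v v)" for v
        by (rule Ck_on_vec[OF V]) (simp add: matrix_vector_mult_def, intro Ck_on_sum Ck_on_mult Ck_on_const ent V)
    qed
  qed
qed

section \<open>Partial derivatives\<close>

abbreviation pd :: "'n::finite \<Rightarrow> (real ^ 'n \<Rightarrow> 'b::real_normed_vector) \<Rightarrow> real ^ 'n \<Rightarrow> 'b" where
  "pd \<equiv> partial UNIV"

lemma pd_eq: "(f has_derivative D) (at x) \<Longrightarrow> pd i f x = D (axis i 1)"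
  using frechet_derivative_at[of f D x] by (simp add: partial_def)

lemma pd_frechet: "pd i f x = frechet_derivative f (at x) (axis i 1)"
  by (simp add: partial_def)

lemma pd_cong_open:
  assumes "open U" "x \<in> U" "\<And>y. y \<in> U \<Longrightarrow> f y = g y"
  shows "pd i f x = pd i g x"
  using frechet_derivative_cong_open[OF assms] by (simp add: pd_frechet)

lemma Ck_on_pd: "Ck_on (Suc k) U f \<Longrightarrow> Ck_on k U (pd i f)"
  using Ck_on_Suc_deriv[of k U f "axis i 1"] by (simp add: pd_frechet [abs_def])

lemma pd_const: "pd i (\<lambda>x. c) x = 0"
  by (rule pd_eq[OF has_derivative_const])

lemma pd_add:
  assumes "f differentiable (at x)" "g differentiable (at x)"
  shows "pd i (\<lambda>y. f y + g y) x = pd i f x + pd i g x"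
  using pd_eq[OF has_derivative_add[OF assms[unfolded frechet_derivative_works]]] by (simp add: pd_frechet)

lemma pd_minus:
  assumes "f differentiable (at x)"
  shows "pd i (\<lambda>y. - f y) x = - pd i f x"
  using pd_eq[OF has_derivative_minus[OF assms[unfolded frechet_derivative_works]]] by (simp add: pd_frechet)

lemma pd_sum:
  assumes "\<And>j. j \<in> J \<Longrightarrow> f j differentiable (at x)"
  shows "pd i (\<lambda>y. \<Sum>j\<in>J. f j y) x = (\<Sum>j\<in>J. pd i (f j) x)"
proof -
  have "((\<lambda>y. \<Sum>j\<in>J. f j y) has_derivative (\<lambda>v. \<Sum>j\<in>J. frechet_derivative (f j) (at x) v)) (at x)"
    by (rule has_derivative_sum) (use assms in \<open>simp add: frechet_derivative_works\<close>)
  from pd_eq[OF this] show ?thesis by (simp add: pd_frechet)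
qed

lemma pd_bilinear:
  assumes "bounded_bilinear B" "f differentiable (at x)" "g differentiable (at x)"
  shows "pd i (\<lambda>y. B (f y) (g y)) x = B (f x) (pd i g x) + B (pd i f x) (g x)"
  using pd_eq[OF bounded_bilinear.FDERIV[OF assms(1) assms(2,3)[unfolded frechet_derivative_works]]]
  by (simp add: pd_frechet)

lemmas pd_mult = pd_bilinear[OF bounded_bilinear_mult]
lemmas pd_inner = pd_bilinear[OF bounded_bilinear_inner]

lemma differentiable_bilinear:
  assumes "bounded_bilinear B" "f differentiable (at x)" "g differentiable (at x)"
  shows "(\<lambda>y. B (f y) (g y)) differentiable (at x)"
  using bounded_bilinear.FDERIV[OF assms(1) assms(2,3)[unfolded frechet_derivative_works]]
  unfolding differentiable_def by blast

lemmas differentiable_inner' = differentiable_bilinear[OF bounded_bilinear_inner]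

lemma pd_chain:
  fixes \<phi> :: "real \<Rightarrow> real"
  assumes "(\<phi> has_real_derivative d) (at (f x))" "f differentiable (at x)"
  shows "pd i (\<lambda>y. \<phi> (f y)) x = d * pd i f x"
  using pd_eq[OF has_derivative_compose[OF assms(2)[unfolded frechet_derivative_works],
      OF assms(1)[unfolded has_field_derivative_def]]]
  by (simp add: pd_frechet)

lemma differentiable_chain:
  fixes \<phi> :: "real \<Rightarrow> real"
  assumes "(\<phi> has_real_derivative d) (at (f x))" "f differentiable (at x)"
  shows "(\<lambda>y. \<phi> (f y)) differentiable (at x)"
  using has_derivative_compose[OF assms(2)[unfolded frechet_derivative_works],
      OF assms(1)[unfolded has_field_derivative_def]]
  unfolding differentiable_def by blast

lemma pd_commute:
  fixes f :: "real ^ 'n::finite \<Rightarrow> 'b::euclidean_space"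
  assumes "open U" "x \<in> U" "Ck_on (Suc (Suc 0)) U f"
  shows "pd i (pd j f) x = pd j (pd i f) x"
  using frechet_derivative_commute[OF assms] by (simp add: pd_frechet[abs_def])

lemma has_derivative_pd_line:
  fixes f :: "real ^ 'n::finite \<Rightarrow> real"
  assumes "f differentiable (at (x + s *\<^sub>R axis i 1))"
  shows "((\<lambda>s. f (x + s *\<^sub>R axis i 1)) has_real_derivative pd i f (x + s *\<^sub>R axis i 1)) (at s)"
proof -
  let ?D = "frechet_derivative f (at (x + s *\<^sub>R axis i 1))"
  have "((\<lambda>s. x + s *\<^sub>R axis i 1) has_derivative (\<lambda>t. t *\<^sub>R axis i 1)) (at s)"
    by (auto intro!: derivative_eq_intros)
  from has_derivative_compose[OF this assms[unfolded frechet_derivative_works]]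
  have "((\<lambda>s. f (x + s *\<^sub>R axis i 1)) has_derivative (\<lambda>t. ?D (t *\<^sub>R axis i 1))) (at s)" .
  moreover have "(\<lambda>t. ?D (t *\<^sub>R axis i 1)) = (*) (?D (axis i 1))"
    using has_derivative_linear[OF assms[unfolded frechet_derivative_works]] by (auto simp: linear_cmul)
  ultimately show ?thesis by (simp add: has_field_derivative_def pd_frechet)
qed

text \<open>The second derivative is available at 0 only. If \<open>c\<close> were positive,
  \<open>f'\<close> would be positive just to the right of 0, and the mean value theorem would
  produce a value above the maximum.\<close>

lemma local_max_second_derivative_real:
  fixes f f' :: "real \<Rightarrow> real"
  assumes d: "0 < d" and f: "\<And>s. \<bar>s\<bar> < d \<Longrightarrow> (f has_real_derivative f' s) (at s)"
    and f': "(f' has_real_derivative c) (at 0)" and mx: "\<And>s. \<bar>s\<bar> < d \<Longrightarrow> f s \<le> f 0"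
  shows "f' 0 = 0 \<and> c \<le> 0"
proof -
  have z: "f' 0 = 0"
    using DERIV_local_max[OF f[of 0] d] mx d by auto
  have "\<not> c > 0"
  proof
    assume "c > 0"
    from DERIV_pos_inc_right[OF f' this] obtain e where e: "e > 0" "\<And>h. 0 < h \<Longrightarrow> h < e \<Longrightarrow> f' 0 < f' (0 + h)"
      by blast
    define h where "h = min d e / 2"
    have h: "0 < h" "h < d" "h < e" using d e by (auto simp: h_def)
    have "\<exists>z. 0 < z \<and> z < h \<and> f h - f 0 = (h - 0) * f' z"
      by (rule MVT2[OF h(1)]) (use f h in auto)
    then obtain z where "0 < z" "z < h" "f h - f 0 = h * f' z" by auto
    then have "f h - f 0 > 0" using e(2)[of z] h z by simp
    then show False using mx[of h] h by simp
  qed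
  with z show ?thesis by simp
qed

text \<open>Restriction to coordinate lines is enough: the maximum principle below sums pure second
  derivatives in coordinates that are orthonormal at the point.\<close>

lemma local_max_second_derivative:
  fixes f :: "real ^ 'n::finite \<Rightarrow> real"
  assumes U: "open U" "x \<in> U" and f: "\<And>y. y \<in> U \<Longrightarrow> f differentiable (at y)"
    and f': "pd i f differentiable (at x)" and mx: "\<And>y. y \<in> U \<Longrightarrow> f y \<le> f x"
  shows "pd i f x = 0" "pd i (pd i f) x \<le> 0"
proof -
  obtain d where d: "d > 0" "ball x d \<subseteq> U" using U open_contains_ball by blast
  have inU: "x + s *\<^sub>R axis i 1 \<in> U" if "\<bar>s\<bar> < d" for s
    using d that by (auto simp: subset_iff dist_norm norm_axis_1)
  have "pd i f (x + 0 *\<^sub>R axis i 1) = 0 \<and> pd i (pd i f) (x + 0 *\<^sub>R axis i 1) \<le> 0"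
    by (rule local_max_second_derivative_real[OF d(1), of "\<lambda>s. f (x + s *\<^sub>R axis i 1)"
          "\<lambda>s. pd i f (x + s *\<^sub>R axis i 1)"])
       (use inU mx f has_derivative_pd_line[of "pd i f" x 0 i] f' in \<open>auto intro!: has_derivative_pd_line\<close>)
  then show "pd i f x = 0" "pd i (pd i f) x \<le> 0" by auto
qed

section \<open>Local geometry of a parametrized hypersurface\<close>

text \<open>The first fundamental form of the Euclidean metric; that of the conformal metric is a
  multiple of it.\<close>

definition gram :: "(real ^ 'n::finite \<Rightarrow> real ^ 'm::finite) \<Rightarrow> real ^ 'n \<Rightarrow> real ^ 'n ^ 'n" where
  "gram G y = (\<chi> i j. pd i G y \<bullet> pd j G y)"

lemma linear_axis_expand:
  fixes L :: "real ^ 'n::finite \<Rightarrow> 'b::real_vector"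
  assumes "linear L"
  shows "L v = (\<Sum>i\<in>UNIV. v $ i *\<^sub>R L (axis i 1))"
proof -
  have "(\<Sum>i\<in>UNIV. v $ i *\<^sub>R axis i 1) = v"
    using basis_expansion[of v] by (simp add: scalar_mult_eq_scaleR)
  then show ?thesis by (metis (no_types, lifting) assms linear_cmul linear_sum sum.cong)
qed

text \<open>The quadratic form of the Gram matrix is the squared length of the image vector.
  Injectivity thereby becomes the nonvanishing of a continuous function, an open condition.\<close>

lemma gram_det_nz_iff_inj:
  fixes G :: "real ^ 'n::finite \<Rightarrow> real ^ 'm::finite"
  assumes lin: "linear (frechet_derivative G (at y))"
  shows "det (gram G y) \<noteq> 0 \<longleftrightarrow> inj (frechet_derivative G (at y))"
proof -
  let ?D = "frechet_derivative G (at y)"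
  have expand: "?D v = (\<Sum>i\<in>UNIV. v $ i *\<^sub>R pd i G y)" for v
    unfolding pd_frechet by (rule linear_axis_expand[OF lin])
  have "?D v = 0 \<longleftrightarrow> gram G y *v v = 0" for v
  proof
    have "(gram G y *v v) $ i = pd i G y \<bullet> ?D v" for i
      by (simp add: expand gram_def inner_sum_right matrix_vector_mult_def mult.commute)
    then show "?D v = 0 \<Longrightarrow> gram G y *v v = 0" by (simp add: vec_eq_iff[of "gram G y *v v"])
    have "?D v \<bullet> ?D v = v \<bullet> (gram G y *v v)"
      by (simp add: expand gram_def inner_sum_left inner_sum_right matrix_vector_mult_def
          inner_vec_def[of v] sum_distrib_left algebra_simps) (simp add: inner_commute)
    then show "gram G y *v v = 0 \<Longrightarrow> ?D v = 0" by simp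
  qed
  then have "inj ?D \<longleftrightarrow> inj ((*v) (gram G y))"
    using lin by (simp add: linear_injective_0)
  then show ?thesis using det_nz_iff_inj[of "(*v) (gram G y)"] by simp
qed

text \<open>The domain is open even when the patch comes from a boundary chart: \<open>G\<close> is
  then a smooth extension beyond the boundary, and all derivatives are two-sided.\<close>

locale patch =
  fixes U :: "(real ^ 'n::finite) set" and G :: "real ^ 'n \<Rightarrow> real ^ 'm::finite"
  assumes card: "CARD('m) = CARD('n) + 1"
    and op: "open U" and C: "\<And>k. Ck_on k U G"
    and inj: "\<And>y. y \<in> U \<Longrightarrow> inj (frechet_derivative G (at y))"
begin

lemma lin: "y \<in> U \<Longrightarrow> linear (frechet_derivative G (at y))"
  using Ck_on_has_derivative[OF C] has_derivative_linear by blast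

lemma deriv_expand:
  assumes "y \<in> U"
  shows "frechet_derivative G (at y) v = (\<Sum>i\<in>UNIV. v $ i *\<^sub>R pd i G y)"
proof -
  have "frechet_derivative G (at y) (\<Sum>i\<in>UNIV. v $ i *\<^sub>R axis i 1) = (\<Sum>i\<in>UNIV. v $ i *\<^sub>R pd i G y)"
    by (simp add: linear_sum[OF lin[OF assms]] linear_cmul[OF lin[OF assms]] pd_frechet)
  moreover have "(\<Sum>i\<in>UNIV. v $ i *\<^sub>R axis i 1) = v"
    using basis_expansion[of v] by (simp add: scalar_mult_eq_scaleR)
  ultimately show ?thesis by simp
qed

lemma gram_det: "y \<in> U \<Longrightarrow> det (gram G y) \<noteq> 0"
  using gram_det_nz_iff_inj[OF lin] inj by blast

definition "ginv y = matrix_inv (gram G y)"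

lemma C_pd: "Ck_on k U (pd i G)"
  using Ck_on_pd[OF C] .

lemma C_pd2: "Ck_on k U (pd i (pd j G))"
  using Ck_on_pd[OF C_pd] .

lemma C_gram: "Ck_on k U (\<lambda>y. gram G y $ i $ j)"
  by (simp add: gram_def) (intro Ck_on_inner C_pd op)

lemma C_ginv: "Ck_on k U (\<lambda>y. ginv y $ i $ j)"
  unfolding ginv_def by (intro Ck_on_matrix_inv op C_gram gram_det)

lemma ginv_gram:
  assumes "y \<in> U"
  shows "(\<Sum>k\<in>UNIV. ginv y $ i $ k * gram G y $ k $ j) = (if i = j then 1 else 0)"
    "(\<Sum>k\<in>UNIV. gram G y $ i $ k * ginv y $ k $ j) = (if i = j then 1 else 0)"
  using matrix_inv_det_nz[OF gram_det[OF assms]]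
  by (simp_all add: ginv_def matrix_matrix_mult_def vec_eq_iff mat_def)

lemma dot_tangent:
  assumes "y \<in> U"
  shows "(\<Sum>k\<in>UNIV. \<Sum>l\<in>UNIV. (ginv y $ k $ l * (v \<bullet> pd k G y)) *\<^sub>R pd l G y) \<bullet> pd j G y = v \<bullet> pd j G y"
proof -
  have "(\<Sum>k\<in>UNIV. \<Sum>l\<in>UNIV. (ginv y $ k $ l * (v \<bullet> pd k G y)) *\<^sub>R pd l G y) \<bullet> pd j G y
    = (\<Sum>k\<in>UNIV. (v \<bullet> pd k G y) * (\<Sum>l\<in>UNIV. ginv y $ k $ l * gram G y $ l $ j))"
    by (simp add: inner_sum_left gram_def sum_distrib_left algebra_simps)
  also have "\<dots> = v \<bullet> pd j G y"
    by (simp add: ginv_gram[OF assms] if_distrib cong: if_cong)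
  finally show ?thesis .
qed

lemma range_deriv: "y \<in> U \<Longrightarrow> range (frechet_derivative G (at y)) = span (range (\<lambda>i. pd i G y))"
proof
  assume y: "y \<in> U"
  show "range (frechet_derivative G (at y)) \<subseteq> span (range (\<lambda>i. pd i G y))"
    by (clarsimp simp: deriv_expand[OF y]) (intro span_sum span_scale span_base rangeI)
  show "span (range (\<lambda>i. pd i G y)) \<subseteq> range (frechet_derivative G (at y))"
    by (rule span_minimal) (auto simp: pd_frechet linear_subspace_image[OF lin[OF y]])
qed

lemma dim_range: "y \<in> U \<Longrightarrow> dim (range (frechet_derivative G (at y))) = CARD('n)"
  using dim_image_eq[OF lin inj_on_subset[OF inj], of y UNIV] by simp

lemma normal_exists:
  assumes "y \<in> U"
  shows "\<exists>\<nu>. norm \<nu> = 1 \<and> (\<forall>i. \<nu> \<bullet> pd i G y = 0)"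
proof -
  have "dim (span (range (\<lambda>i. pd i G y))) < DIM(real ^ 'm)"
    using dim_range[OF assms] range_deriv[OF assms] card by simp
  then obtain a where a: "a \<noteq> 0" "\<And>x. x \<in> span (range (\<lambda>i. pd i G y)) \<Longrightarrow> orthogonal a x"
    using orthogonal_to_subspace_exists[of "range (\<lambda>i. pd i G y)"] by (auto simp: dim_span)
  show ?thesis
    by (rule exI[of _ "a /\<^sub>R norm a"]) (use a in \<open>auto simp: orthogonal_def span_base\<close>)
qed

text \<open>Dimension count: \<open>\<nu>\<close> together with the n-dimensional tangent space
  spans the whole space of dimension n + 1, so only 0 is orthogonal to both.\<close>

lemma zero_if_orthogonal:
  assumes y: "y \<in> U" and \<nu>: "norm \<nu> = 1" "\<And>i. \<nu> \<bullet> pd i G y = 0"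
    and v: "v \<bullet> \<nu> = 0" "\<And>i. v \<bullet> pd i G y = 0"
  shows "v = 0"
proof (rule ccontr)
  assume "v \<noteq> 0"
  let ?T = "span (range (\<lambda>i. pd i G y))"
  have orth: "\<And>w x. (\<And>i. w \<bullet> pd i G y = 0) \<Longrightarrow> x \<in> ?T \<Longrightarrow> w \<bullet> x = 0"
    using orthogonal_to_span unfolding orthogonal_def by (metis (no_types, lifting) rangeE)
  have "\<nu> \<noteq> 0" using \<nu> by auto
  have d1: "dim (insert \<nu> ?T) = CARD('n) + 1"
  proof -
    have "\<nu> \<notin> span ?T" using orth[OF \<nu>(2), of \<nu>] \<open>\<nu> \<noteq> 0\<close> by (auto simp: span_span)
    then show ?thesis using dim_range[OF y] range_deriv[OF y] by (simp add: dim_insert)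
  qed
  then have "dim (insert \<nu> ?T) = DIM(real ^ 'm)" using card by simp
  then have full: "span (insert \<nu> ?T) = UNIV" by (metis dim_eq_full)
  have "orthogonal v x" if "x \<in> insert \<nu> ?T" for x
    using that v orth[OF v(2)] by (auto simp: orthogonal_def)
  then have "orthogonal v v" using orthogonal_to_span[of v "insert \<nu> ?T" v] full by simp
  then show False using \<open>v \<noteq> 0\<close> by (simp add: orthogonal_def)
qed

text \<open>The double sum is the Euclidean projection onto the tangent space, the inverse Gram
  matrix correcting for the basis not being orthonormal.\<close>

lemma decompose:
  assumes y: "y \<in> U" and \<nu>: "norm \<nu> = 1" "\<And>i. \<nu> \<bullet> pd i G y = 0"
  shows "v = (\<Sum>k\<in>UNIV. \<Sum>l\<in>UNIV. (ginv y $ k $ l * (v \<bullet> pd k G y)) *\<^sub>R pd l G y) + (v \<bullet> \<nu>) *\<^sub>R \<nu>"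
proof -
  let ?T = "\<Sum>k\<in>UNIV. \<Sum>l\<in>UNIV. (ginv y $ k $ l * (v \<bullet> pd k G y)) *\<^sub>R pd l G y"
  have "v - ?T - (v \<bullet> \<nu>) *\<^sub>R \<nu> = 0"
  proof (rule zero_if_orthogonal[OF y \<nu>])
    have "\<nu> \<bullet> ?T = 0" by (simp add: inner_sum_right \<nu>(2))
    then have "?T \<bullet> \<nu> = 0" by (simp only: inner_commute)
    moreover have "\<nu> \<bullet> \<nu> = 1" using \<nu>(1) by (simp add: dot_square_norm)
    ultimately show "(v - ?T - (v \<bullet> \<nu>) *\<^sub>R \<nu>) \<bullet> \<nu> = 0" by (simp add: inner_diff_left)
    show "(v - ?T - (v \<bullet> \<nu>) *\<^sub>R \<nu>) \<bullet> pd i G y = 0" for i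
      by (simp add: inner_diff_left dot_tangent[OF y] \<nu>(2))
  qed
  then show ?thesis by (simp add: algebra_simps)
qed

lemma unit_normal_unique:
  assumes y: "y \<in> U" and \<nu>: "norm \<nu> = 1" "\<And>i. \<nu> \<bullet> pd i G y = 0"
    and \<mu>: "norm \<mu> = 1" "\<And>i. \<mu> \<bullet> pd i G y = 0"
  shows "\<mu> = \<nu> \<or> \<mu> = - \<nu>"
proof -
  have eq: "\<mu> = (\<mu> \<bullet> \<nu>) *\<^sub>R \<nu>" using decompose[OF y \<nu>, of \<mu>] \<mu>(2) by simp
  then have "1 = \<bar>\<mu> \<bullet> \<nu>\<bar>" using \<nu>(1) \<mu>(1) by (metis mult.right_neutral norm_scaleR)
  then have "\<mu> \<bullet> \<nu> = 1 \<or> \<mu> \<bullet> \<nu> = -1" by linarith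
  then show ?thesis using eq by (metis scaleR_one scaleR_minus1_left)
qed

text \<open>Projecting a fixed normal vector onto the nearby normal lines yields a smooth normal field.\<close>

lemma normal_field_exists:
  assumes x: "x \<in> U"
  obtains V \<nu> where "open V" "x \<in> V" "V \<subseteq> U"
    "\<And>y. y \<in> V \<Longrightarrow> norm (\<nu> y) = 1" "\<And>y i. y \<in> V \<Longrightarrow> \<nu> y \<bullet> pd i G y = 0"
    "\<And>y. y \<in> V \<Longrightarrow> \<nu> differentiable (at y)"
proof -
  obtain a where a: "norm a = 1" "\<And>i. a \<bullet> pd i G x = 0" using normal_exists[OF x] by blast
  define Z where "Z y = a - (\<Sum>k\<in>UNIV. \<Sum>l\<in>UNIV. (ginv y $ k $ l * (a \<bullet> pd k G y)) *\<^sub>R pd l G y)" for y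
  have CZ: "Ck_on k U Z" for k
    unfolding Z_def by (intro Ck_on_diff Ck_on_const Ck_on_sum Ck_on_scaleR Ck_on_mult Ck_on_inner C_pd C_ginv op)
  have Zn: "Z y \<bullet> pd i G y = 0" if "y \<in> U" for y i
    by (simp add: Z_def inner_diff_left dot_tangent[OF that])
  have Zx: "Z x = a" by (simp add: Z_def a)
  have "open (U \<inter> Z -` (- {0}))"
    by (rule continuous_open_preimage[OF Ck_on_imp_continuous[OF CZ] op]) auto
  moreover have "x \<in> U \<inter> Z -` (- {0})" using x Zx a by auto
  moreover have "(\<lambda>y. Z y /\<^sub>R norm (Z y)) differentiable (at y)" if "y \<in> U \<inter> Z -` (- {0})" for y
  proof -
    have dZ: "Z differentiable (at y)" using Ck_on_differentiable[OF CZ] that by blast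
    moreover have "norm differentiable (at (Z y))" using differentiable_norm_at that by auto
    ultimately have "(\<lambda>y. norm (Z y)) differentiable (at y)"
      using differentiable_chain_at[of Z y norm] by (simp add: o_def)
    then show ?thesis
      using dZ that by (intro differentiable_scaleR differentiable_inverse) auto
  qed
  ultimately show ?thesis
    by (intro that[of "U \<inter> Z -` (- {0})" "\<lambda>y. Z y /\<^sub>R norm (Z y)"]) (auto simp: Zn)
qed

end

locale patch_normal = patch U G
  for U :: "(real ^ 'n::finite) set" and G :: "real ^ 'n \<Rightarrow> real ^ 'm::finite" +
  fixes \<nu> :: "real ^ 'n \<Rightarrow> real ^ 'm"
  assumes unit: "\<And>y. y \<in> U \<Longrightarrow> norm (\<nu> y) = 1"
    and normal: "\<And>y i. y \<in> U \<Longrightarrow> \<nu> y \<bullet> pd i G y = 0"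
    and d_normal: "\<And>y. y \<in> U \<Longrightarrow> \<nu> differentiable (at y)"
begin

text \<open>\<open>h\<close> is the Euclidean second fundamental form, \<open>W\<close> the support
  function, \<open>X\<close> lists the coordinates of the tangential part of the position vector,
  and \<open>\<Gamma>\<close> consists of the Christoffel symbols of the first kind of the induced
  Euclidean metric.\<close>

definition "h i j y = pd i (pd j G) y \<bullet> \<nu> y"
definition "W y = G y \<bullet> \<nu> y"
definition "X j y = (\<Sum>k\<in>UNIV. ginv y $ j $ k * (G y \<bullet> pd k G y))"
definition "\<Gamma> i j k y = pd i (pd j G) y \<bullet> pd k G y"

lemma dG: "y \<in> U \<Longrightarrow> G differentiable (at y)"
  by (rule Ck_on_differentiable[OF C])
lemma dpd: "y \<in> U \<Longrightarrow> pd i G differentiable (at y)"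
  by (rule Ck_on_differentiable[OF C_pd])
lemma dpd2: "y \<in> U \<Longrightarrow> pd i (pd j G) differentiable (at y)"
  by (rule Ck_on_differentiable[OF C_pd2])
lemma dginv: "y \<in> U \<Longrightarrow> (\<lambda>y. ginv y $ i $ j) differentiable (at y)"
  by (rule Ck_on_differentiable[OF C_ginv])
lemma dh: "y \<in> U \<Longrightarrow> h i j differentiable (at y)"
  unfolding h_def[abs_def] by (intro differentiable_inner' dpd2 d_normal)
lemma dW: "y \<in> U \<Longrightarrow> W differentiable (at y)"
  unfolding W_def[abs_def] by (intro differentiable_inner' dG d_normal)
lemma dX: "y \<in> U \<Longrightarrow> X j differentiable (at y)"
  unfolding X_def[abs_def]
  by (auto intro!: differentiable_sum differentiable_mult differentiable_inner' dG dginv dpd)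

lemma normal': "y \<in> U \<Longrightarrow> pd i G y \<bullet> \<nu> y = 0"
  using normal by (simp add: inner_commute)

lemma h_sym: "y \<in> U \<Longrightarrow> h i j y = h j i y"
  using pd_commute[OF op _ C, of y i j] by (simp add: h_def)

lemma \<Gamma>_sym: "y \<in> U \<Longrightarrow> \<Gamma> i j k y = \<Gamma> j i k y"
  using pd_commute[OF op _ C, of y i j] by (simp add: \<Gamma>_def)

lemma normal_deriv_tangent:
  assumes "y \<in> U"
  shows "pd i \<nu> y \<bullet> pd j G y = - h i j y"
proof -
  have "pd i (\<lambda>y. \<nu> y \<bullet> pd j G y) y = pd i (\<lambda>y. 0) y"
    by (rule pd_cong_open[OF op assms normal])
  then show ?thesis
    by (simp add: pd_inner[OF d_normal dpd] assms pd_const h_def inner_commute)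
qed

lemma normal_deriv_normal:
  assumes "y \<in> U"
  shows "pd i \<nu> y \<bullet> \<nu> y = 0"
proof -
  have "pd i (\<lambda>y. \<nu> y \<bullet> \<nu> y) y = pd i (\<lambda>y. 1) y"
    by (rule pd_cong_open[OF op assms]) (simp add: dot_square_norm unit)
  then show ?thesis
    by (simp add: pd_inner[OF d_normal d_normal] assms pd_const inner_commute)
qed

lemma ginv_sym:
  assumes y: "y \<in> U"
  shows "ginv y $ i $ j = ginv y $ j $ i"
proof -
  have T: "transpose (gram G y) = gram G y"
    by (simp add: transpose_def gram_def vec_eq_iff inner_commute)
  have "transpose (ginv y) ** gram G y = mat 1"
    using matrix_inv_det_nz(1)[OF gram_det[OF y]] T
    by (metis ginv_def matrix_transpose_mul transpose_mat)
  then have "transpose (ginv y) = ginv y"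
    using matrix_inv_det_nz(1)[OF gram_det[OF y]]
    by (metis ginv_def matrix_mul_assoc matrix_mul_lid matrix_mul_rid)
  then show ?thesis by (metis (no_types, lifting) transpose_def vec_lambda_beta)
qed

lemma position_decompose:
  assumes "y \<in> U"
  shows "G y = (\<Sum>j\<in>UNIV. X j y *\<^sub>R pd j G y) + W y *\<^sub>R \<nu> y"
proof -
  have "(\<Sum>k\<in>UNIV. \<Sum>l\<in>UNIV. (ginv y $ k $ l * (G y \<bullet> pd k G y)) *\<^sub>R pd l G y)
      = (\<Sum>j\<in>UNIV. X j y *\<^sub>R pd j G y)"
    by (subst sum.swap) (simp add: X_def scaleR_sum_left ginv_sym[OF assms])
  then show ?thesis
    using decompose[OF assms unit[OF assms] normal[OF assms], of "G y"] by (simp add: W_def)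
qed

text \<open>The derivative of \<open>G\<close> is tangent and pairs to 0 with \<open>\<nu>\<close>;
  what remains is the derivative of the normal against the tangential part of the position vector,
  given by Weingarten's formula.\<close>

lemma pd_W:
  assumes "y \<in> U"
  shows "pd i W y = - (\<Sum>k\<in>UNIV. h i k y * X k y)"
proof -
  have "pd i W y = G y \<bullet> pd i \<nu> y"
    using pd_inner[OF dG d_normal, OF assms assms] by (simp add: W_def[abs_def] normal'[OF assms])
  also have "\<dots> = pd i \<nu> y \<bullet> ((\<Sum>j\<in>UNIV. X j y *\<^sub>R pd j G y) + W y *\<^sub>R \<nu> y)"
    using position_decompose[OF assms] by (metis inner_commute)
  also have "\<dots> = - (\<Sum>k\<in>UNIV. h i k y * X k y)"
    by (simp add: inner_add_right inner_sum_right normal_deriv_tangent[OF assms]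
         normal_deriv_normal[OF assms] sum_negf mult.commute)
  finally show ?thesis .
qed

lemma X_gram:
  assumes "y \<in> U"
  shows "(\<Sum>j\<in>UNIV. X j y * (pd j G y \<bullet> pd k G y)) = G y \<bullet> pd k G y"
  using arg_cong[OF position_decompose[OF assms], of "\<lambda>v. v \<bullet> pd k G y"]
  by (simp add: inner_add_left inner_sum_left normal[OF assms])

text \<open>Differentiating the identity \<open>X_gram\<close> avoids the derivative of the inverse
  Gram matrix. Orthonormality is assumed at \<open>x\<close> alone, so Christoffel symbols
  survive.\<close>

lemma pd_X:
  assumes x: "x \<in> U" and orth: "\<And>i j. pd i G x \<bullet> pd j G x = (if i = j then 1 else 0)"
  shows "pd i (X k) x = (if i = k then 1 else 0) + W x * h i k x - (\<Sum>j\<in>UNIV. X j x * \<Gamma> i j k x)"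
proof -
  have "pd i (\<lambda>y. \<Sum>j\<in>UNIV. X j y * (pd j G y \<bullet> pd k G y)) x = pd i (\<lambda>y. G y \<bullet> pd k G y) x"
    by (rule pd_cong_open[OF op x X_gram])
  moreover have "pd i (\<lambda>y. \<Sum>j\<in>UNIV. X j y * (pd j G y \<bullet> pd k G y)) x
    = (\<Sum>j\<in>UNIV. pd i (\<lambda>y. X j y * (pd j G y \<bullet> pd k G y)) x)"
    by (intro pd_sum differentiable_mult differentiable_inner' dX dpd x)
  moreover have "pd i (\<lambda>y. X j y * (pd j G y \<bullet> pd k G y)) x
    = X j x * \<Gamma> i k j x + X j x * \<Gamma> i j k x + (if j = k then pd i (X j) x else 0)" for j
    by (subst pd_mult) (auto intro!: differentiable_inner' dX dpd x
      simp: pd_inner dpd x orth \<Gamma>_def inner_commute algebra_simps)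
  moreover have "pd i (\<lambda>y. G y \<bullet> pd k G y) x = G x \<bullet> pd i (pd k G) x + (if i = k then 1 else 0)"
    by (simp add: pd_inner dG dpd x orth)
  moreover have "G x \<bullet> pd i (pd k G) x = (\<Sum>j\<in>UNIV. X j x * \<Gamma> i k j x) + W x * h i k x"
    by (subst position_decompose[OF x])
       (simp add: inner_add_left inner_sum_left \<Gamma>_def h_def inner_commute[of "pd i (pd k G) x"])
  ultimately show ?thesis
    by (simp add: sum.distrib)
qed

lemma pd_h:
  assumes x: "x \<in> U" and orth: "\<And>i j. pd i G x \<bullet> pd j G x = (if i = j then 1 else 0)"
  shows "pd l (h i k) x = pd l (pd i (pd k G)) x \<bullet> \<nu> x - (\<Sum>m\<in>UNIV. h l m x * \<Gamma> i k m x)"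
proof -
  have g: "gram G x = mat 1" by (simp add: gram_def mat_def orth vec_eq_iff)
  have gi: "ginv x = mat 1"
    using matrix_inv_det_nz(1)[OF gram_det[OF x]] by (simp add: ginv_def g)
  have "pd l \<nu> x = - (\<Sum>m\<in>UNIV. h l m x *\<^sub>R pd m G x)"
    using decompose[OF x unit[OF x] normal[OF x], of "pd l \<nu> x"]
    by (simp add: gi mat_def normal_deriv_tangent[OF x] normal_deriv_normal[OF x] if_distrib
        if_distribR sum_negf cong: if_cong)
  then show ?thesis
    by (simp add: h_def[of i k, abs_def] pd_inner[OF dpd2[OF x] d_normal[OF x]] inner_sum_right \<Gamma>_def)
qed

lemma pd_trace_h:
  assumes x: "x \<in> U" and orth: "\<And>i j. pd i G x \<bullet> pd j G x = (if i = j then 1 else 0)"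
  shows "pd l (\<lambda>y. \<Sum>i\<in>UNIV. \<Sum>j\<in>UNIV. ginv y $ i $ j * h i j y) x
    = (\<Sum>i\<in>UNIV. pd l (h i i) x) - 2 * (\<Sum>i\<in>UNIV. \<Sum>j\<in>UNIV. \<Gamma> l i j x * h i j x)"
proof -
  have g: "gram G x = mat 1" by (simp add: gram_def mat_def orth vec_eq_iff)
  have "ginv x = mat 1"
    using matrix_inv_det_nz(1)[OF gram_det[OF x]] by (simp add: ginv_def g)
  then have gi: "ginv x $ i $ j = (if i = j then 1 else 0)" for i j
    by (simp add: mat_def)
  \<comment> \<open>The derivative of the inverse Gram matrix, read off by differentiating its
    product with the Gram matrix.\<close>
  have dgi: "pd l (\<lambda>y. ginv y $ i $ k) x = - (\<Gamma> l i k x + \<Gamma> l k i x)" for i k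
  proof -
    have "pd l (\<lambda>y. \<Sum>j\<in>UNIV. ginv y $ i $ j * (pd j G y \<bullet> pd k G y)) x
        = pd l (\<lambda>y. if i = k then 1 else 0) x"
      by (rule pd_cong_open[OF op x]) (use ginv_gram(1) in \<open>simp add: gram_def\<close>)
    moreover have "pd l (\<lambda>y. \<Sum>j\<in>UNIV. ginv y $ i $ j * (pd j G y \<bullet> pd k G y)) x
        = (\<Sum>j\<in>UNIV. pd l (\<lambda>y. ginv y $ i $ j * (pd j G y \<bullet> pd k G y)) x)"
      by (intro pd_sum differentiable_mult differentiable_inner' dginv dpd x)
    moreover have "pd l (\<lambda>y. ginv y $ i $ j * (pd j G y \<bullet> pd k G y)) x
        = (if j = i then \<Gamma> l k i x + \<Gamma> l i k x else 0) + (if j = k then pd l (\<lambda>y. ginv y $ i $ j) x else 0)" for j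
      by (subst pd_mult) (auto intro!: differentiable_inner' dginv dpd x
        simp: pd_inner dpd x orth \<Gamma>_def inner_commute gi)
    ultimately show ?thesis
      by (simp add: sum.distrib pd_const)
  qed
  have "pd l (\<lambda>y. \<Sum>i\<in>UNIV. \<Sum>j\<in>UNIV. ginv y $ i $ j * h i j y) x
      = (\<Sum>i\<in>UNIV. \<Sum>j\<in>UNIV. pd l (\<lambda>y. ginv y $ i $ j * h i j y) x)"
    by (simp add: pd_sum differentiable_sum differentiable_mult dginv dh x)
  also have "\<dots> = (\<Sum>i\<in>UNIV. \<Sum>j\<in>UNIV. (if i = j then pd l (h i j) x else 0)
       - (\<Gamma> l i j x * h i j x + \<Gamma> l j i x * h i j x))"
    by (intro sum.cong refl) (simp add: pd_mult dginv dh x gi dgi algebra_simps)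
  also have "\<dots> = (\<Sum>i\<in>UNIV. pd l (h i i) x) - ((\<Sum>i\<in>UNIV. \<Sum>j\<in>UNIV. \<Gamma> l i j x * h i j x)
      + (\<Sum>i\<in>UNIV. \<Sum>j\<in>UNIV. \<Gamma> l j i x * h i j x))"
    by (simp add: sum_subtractf sum.distrib)
  also have "(\<Sum>i\<in>UNIV. \<Sum>j\<in>UNIV. \<Gamma> l j i x * h i j x) = (\<Sum>i\<in>UNIV. \<Sum>j\<in>UNIV. \<Gamma> l i j x * h i j x)"
    by (subst sum.swap) (simp add: h_sym[OF x])
  finally show ?thesis by simp
qed

text \<open>\<open>\<nu>\<close> is assumed differentiable only once. The right-hand side of
  \<open>pd_W\<close> contains it undifferentiated, inside \<open>h\<close>, so it can be
  differentiated again.\<close>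

lemma dpdW: "y \<in> U \<Longrightarrow> pd i W differentiable (at y)"
  by (rule differentiable_cong_open[OF op, of y "\<lambda>y. - (\<Sum>k\<in>UNIV. h i k y * X k y)"])
     (auto simp: pd_W intro!: differentiable_minus differentiable_sum differentiable_mult dh dX)

text \<open>By the symmetry of the third derivatives of \<open>G\<close> (Codazzi), these enter the Laplacian of \<open>W\<close> only
  through the derivative of the mean curvature.\<close>

lemma laplacian_support:
  assumes x: "x \<in> U" and orth: "\<And>i j. pd i G x \<bullet> pd j G x = (if i = j then 1 else 0)"
  shows "(\<Sum>i\<in>UNIV. pd i (pd i W) x) - (\<Sum>i\<in>UNIV. \<Sum>l\<in>UNIV. \<Gamma> i i l x * pd l W x)
    = - (\<Sum>k\<in>UNIV. X k x * pd k (\<lambda>y. \<Sum>i\<in>UNIV. \<Sum>j\<in>UNIV. ginv y $ i $ j * h i j y) x)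
      - (\<Sum>i\<in>UNIV. h i i x) - W x * (\<Sum>i\<in>UNIV. \<Sum>j\<in>UNIV. (h i j x)\<^sup>2)"
proof -
  \<comment> \<open>\<open>?S\<close> and \<open>?Q\<close> collect Christoffel terms and
    \<open>?P\<close> the third derivatives of \<open>G\<close>. They need not vanish; the
    derivative of the mean curvature contains them in the same combination
    \<open>?P - ?Q - 2 * ?S\<close>.\<close>
  let ?A = "\<lambda>k i. pd k (pd i (pd i G)) x \<bullet> \<nu> x"
  let ?S = "\<Sum>k\<in>UNIV. \<Sum>i\<in>UNIV. \<Sum>m\<in>UNIV. X k x * (\<Gamma> k i m x * h i m x)"
  let ?P = "\<Sum>k\<in>UNIV. \<Sum>i\<in>UNIV. X k x * ?A k i"
  let ?Q = "\<Sum>k\<in>UNIV. \<Sum>i\<in>UNIV. \<Sum>m\<in>UNIV. X k x * (h k m x * \<Gamma> i i m x)"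
  have third: "pd i (pd i (pd k G)) x = pd k (pd i (pd i G)) x" for i k
  proof -
    have "pd i (pd i (pd k G)) x = pd i (pd k (pd i G)) x"
      by (rule pd_cong_open[OF op x]) (rule pd_commute[OF op _ C])
    also have "\<dots> = pd k (pd i (pd i G)) x" by (rule pd_commute[OF op x C_pd])
    finally show ?thesis .
  qed
  have W2: "pd i (pd i W) x = - (\<Sum>k\<in>UNIV. h i k x * pd i (X k) x + pd i (h i k) x * X k x)" for i
  proof -
    have "pd i (pd i W) x = pd i (\<lambda>y. - (\<Sum>k\<in>UNIV. h i k y * X k y)) x"
      by (rule pd_cong_open[OF op x pd_W])
    also have "\<dots> = - (\<Sum>k\<in>UNIV. pd i (\<lambda>y. h i k y * X k y) x)"
      by (simp add: pd_minus pd_sum differentiable_sum differentiable_mult dh dX x)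
    finally show ?thesis by (simp add: pd_mult dh dX x)
  qed
  have hX: "(\<Sum>i\<in>UNIV. \<Sum>k\<in>UNIV. h i k x * pd i (X k) x)
      = (\<Sum>i\<in>UNIV. h i i x) + W x * (\<Sum>i\<in>UNIV. \<Sum>k\<in>UNIV. (h i k x)\<^sup>2) - ?S"
  proof -
    have "(\<Sum>i\<in>UNIV. \<Sum>k\<in>UNIV. h i k x * pd i (X k) x)
      = (\<Sum>i\<in>UNIV. \<Sum>k\<in>UNIV. (if i = k then h i k x else 0) + W x * (h i k x)\<^sup>2
          - (\<Sum>j\<in>UNIV. X j x * (\<Gamma> j i k x * h i k x)))"
      by (intro sum.cong refl)
         (simp add: pd_X[OF x orth] algebra_simps power2_eq_square sum_distrib_left \<Gamma>_sym[OF x])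
    also have "\<dots> = (\<Sum>i\<in>UNIV. h i i x) + W x * (\<Sum>i\<in>UNIV. \<Sum>k\<in>UNIV. (h i k x)\<^sup>2)
        - (\<Sum>i\<in>UNIV. \<Sum>k\<in>UNIV. \<Sum>j\<in>UNIV. X j x * (\<Gamma> j i k x * h i k x))"
      by (simp add: sum_subtractf sum.distrib sum_distrib_left)
    also have "(\<Sum>i\<in>UNIV. \<Sum>k\<in>UNIV. \<Sum>j\<in>UNIV. X j x * (\<Gamma> j i k x * h i k x))
       = (\<Sum>i\<in>UNIV. \<Sum>j\<in>UNIV. \<Sum>k\<in>UNIV. X j x * (\<Gamma> j i k x * h i k x))"
      by (intro sum.cong refl sum.swap)
    also have "\<dots> = ?S" by (rule sum.swap)
    finally show ?thesis .
  qed
  have Xh: "(\<Sum>i\<in>UNIV. \<Sum>k\<in>UNIV. pd i (h i k) x * X k x) = ?P - ?S"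
  proof -
    have "(\<Sum>i\<in>UNIV. \<Sum>k\<in>UNIV. pd i (h i k) x * X k x)
       = (\<Sum>i\<in>UNIV. \<Sum>k\<in>UNIV. X k x * ?A k i - (\<Sum>m\<in>UNIV. X k x * (\<Gamma> k i m x * h i m x)))"
    proof (intro sum.cong refl)
      fix i k
      show "pd i (h i k) x * X k x = X k x * ?A k i - (\<Sum>m\<in>UNIV. X k x * (\<Gamma> k i m x * h i m x))"
        unfolding pd_h[OF x orth, of i i k] third[of i k]
        by (simp add: left_diff_distrib right_diff_distrib sum_distrib_left sum_distrib_right \<Gamma>_sym[OF x, of k i] mult_ac)
    qed
    also have "\<dots> = (\<Sum>k\<in>UNIV. \<Sum>i\<in>UNIV. X k x * ?A k i - (\<Sum>m\<in>UNIV. X k x * (\<Gamma> k i m x * h i m x)))"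
      by (rule sum.swap)
    finally show ?thesis by (simp add: sum_subtractf)
  qed
  have E: "(\<Sum>k\<in>UNIV. X k x * pd k (\<lambda>y. \<Sum>i\<in>UNIV. \<Sum>j\<in>UNIV. ginv y $ i $ j * h i j y) x)
      = ?P - ?Q - 2 * ?S"
  proof -
    have two: "X k x * (2 * c) = 2 * (X k x * c)" for k c by simp
    have "pd k (\<lambda>y. \<Sum>i\<in>UNIV. \<Sum>j\<in>UNIV. ginv y $ i $ j * h i j y) x
      = (\<Sum>i\<in>UNIV. ?A k i) - (\<Sum>i\<in>UNIV. \<Sum>m\<in>UNIV. h k m x * \<Gamma> i i m x)
        - 2 * (\<Sum>i\<in>UNIV. \<Sum>m\<in>UNIV. \<Gamma> k i m x * h i m x)" for k
      unfolding pd_trace_h[OF x orth] pd_h[OF x orth] sum_subtractf by (rule refl)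
    then show ?thesis
      by (simp add: right_diff_distrib sum_subtractf two) (simp add: sum_distrib_left)
  qed
  have "(\<Sum>i\<in>UNIV. \<Sum>l\<in>UNIV. \<Gamma> i i l x * pd l W x) = - (\<Sum>i\<in>UNIV. \<Sum>l\<in>UNIV. \<Sum>k\<in>UNIV. X k x * (h k l x * \<Gamma> i i l x))"
    by (simp add: pd_W[OF x] sum_distrib_left sum_negf mult_ac h_sym[OF x])
  also have "(\<Sum>i\<in>UNIV. \<Sum>l\<in>UNIV. \<Sum>k\<in>UNIV. X k x * (h k l x * \<Gamma> i i l x))
     = (\<Sum>i\<in>UNIV. \<Sum>k\<in>UNIV. \<Sum>l\<in>UNIV. X k x * (h k l x * \<Gamma> i i l x))"
    by (intro sum.cong refl sum.swap)
  also have "\<dots> = ?Q" by (rule sum.swap)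
  finally have G: "(\<Sum>i\<in>UNIV. \<Sum>l\<in>UNIV. \<Gamma> i i l x * pd l W x) = - ?Q" .
  have "(\<Sum>i\<in>UNIV. pd i (pd i W) x) = - ((\<Sum>i\<in>UNIV. \<Sum>k\<in>UNIV. h i k x * pd i (X k) x)
      + (\<Sum>i\<in>UNIV. \<Sum>k\<in>UNIV. pd i (h i k) x * X k x))"
    by (simp add: W2 sum.distrib sum_negf sum_subtractf)
  then show ?thesis unfolding hX Xh E G by linarith
qed

end

section \<open>Maximum principle for the support function\<close>

text \<open>Below, \<open>t\<close> and \<open>\<tau>\<close> are the squared norms of the position vector and of its tangential part, \<open>w\<close> its
  normal component, \<open>up\<close> and \<open>upp\<close> are the derivatives of \<open>u\<close> at \<open>t\<close>, \<open>E\<close> is \<open>e\<^sup>u\<close>, \<open>S\<close> the conformal distance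
  to the origin, and \<open>\<omega>1\<close>, \<open>\<omega>2\<close> are the derivatives of \<open>c S\<^sup>2 / 2\<close> with respect to \<open>t\<close>.  The Euclidean norm
  \<open>b2\<close> is \<open>E\<^sup>2\<close> times the squared norm of the second fundamental form of the conformal metric.\<close>

lemma support_contradiction:
  fixes n t w \<tau> up upp \<omega>1 \<omega>2 c S E r rb b2 :: real
  assumes n: "1 \<le> n" and \<tau>: "0 \<le> \<tau>" and w: "w \<noteq> 0" and t: "\<tau> + w\<^sup>2 = t" and r: "0 < r" "r\<^sup>2 = t"
    and i: "upp - up\<^sup>2 \<le> 0" and E: "0 < E" and S: "0 \<le> S" "S \<le> rb" and rb: "0 < rb"
    and S\<psi>: "r * E \<le> S * (1 + 2 * t * up)"
    and c: "c = n / (2 * rb\<^sup>2)" and \<omega>1: "\<omega>1 = c * S * E / (2 * r)"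
    and \<omega>2: "\<omega>2 = c * E\<^sup>2 / (4 * t) + \<omega>1 * (up - 1 / (2 * t))"
    and b2: "b2 \<le> n\<^sup>2 / (4 * rb\<^sup>2) * E\<^sup>2"
    and ineq: "4 * (n - 1) * \<tau> * (up\<^sup>2 - upp) + 4 * n * up * \<omega>1 * t + 2 * n * \<omega>1 - 8 * up * \<omega>1 * \<tau>
      + 4 * \<omega>2 * \<tau> - 4 * \<omega>1\<^sup>2 * \<tau> - b2 \<le> 0"
  shows False
proof -
  \<comment> \<open>The share of the tangential part in the squared norm of the position vector.
    That it is less than 1, because \<open>w\<close> is nonzero, is the source of the strict
    inequality at the end.\<close>
  define \<rho> where "\<rho> = \<tau> / t"
  define \<Lambda> where "\<Lambda> = n\<^sup>2 / (4 * rb\<^sup>2)"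
  have tpos: "t > 0" using r by (metis zero_less_power)
  have c0: "c > 0" using n rb by (simp add: c)
  have w2: "w\<^sup>2 > 0" using w by simp
  have \<rho>: "0 \<le> \<rho>" "\<rho> < 1"
  proof -
    have "\<tau> < t" using t w2 by linarith
    then show "0 \<le> \<rho>" "\<rho> < 1" using \<tau> tpos by (simp_all add: \<rho>_def)
  qed
  have \<tau>\<rho>: "\<tau> = \<rho> * t" using tpos by (simp add: \<rho>_def)
  have \<Lambda>0: "\<Lambda> > 0" using n rb by (simp add: \<Lambda>_def)
  have cn: "c * n = 2 * \<Lambda>" by (simp add: c \<Lambda>_def power2_eq_square)
  \<comment> \<open>This bounds the squared gradient of the weight; \<open>c\<close> is such that
    the bound is exactly half of \<open>c * n\<close>.\<close>
  have "c\<^sup>2 * S\<^sup>2 \<le> c\<^sup>2 * rb\<^sup>2"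
    using S by (intro mult_left_mono power_mono) auto
  also have "\<dots> = \<Lambda>" using rb by (simp add: c \<Lambda>_def power2_eq_square)
  finally have cS: "c\<^sup>2 * S\<^sup>2 \<le> \<Lambda>" .
  have r2: "r * r = t" using r by (simp add: power2_eq_square)
  have \<omega>sq: "4 * \<omega>1\<^sup>2 * t = c\<^sup>2 * S\<^sup>2 * E\<^sup>2"
    using r tpos by (simp add: \<omega>1 power_mult_distrib power_divide)
  have \<omega>2t: "4 * \<omega>2 * t = c * E\<^sup>2 + 4 * \<omega>1 * up * t - 2 * \<omega>1"
    using tpos by (simp add: \<omega>2 field_simps)
  \<comment> \<open>Divided by \<open>E\<^sup>2\<close>, the left side is the Hessian of c S^2 / 2
    for the conformal metric in directions orthogonal to the radial one; in the radial direction the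
    Hessian is c. The convexity \<open>S\<psi>\<close> makes c a lower bound in all
    directions.\<close>
  have \<omega>\<psi>: "2 * \<omega>1 * (1 + 2 * t * up) \<ge> c * E\<^sup>2"
  proof -
    have "c * E\<^sup>2 = (c * E / r) * (r * E)" using r by (simp add: power2_eq_square)
    also have "\<dots> \<le> (c * E / r) * (S * (1 + 2 * t * up))"
      using S\<psi> c0 E r by (intro mult_left_mono) auto
    also have "\<dots> = 2 * \<omega>1 * (1 + 2 * t * up)" using r by (simp add: \<omega>1)
    finally show ?thesis .
  qed
  have "4 * n * up * \<omega>1 * t + 2 * n * \<omega>1 - 8 * up * \<omega>1 * \<tau> + 4 * \<omega>2 * \<tau> - 4 * \<omega>1\<^sup>2 * \<tau>
      = 2 * \<omega>1 * (1 + 2 * t * up) * n - 8 * up * \<omega>1 * t * \<rho> + \<rho> * (4 * \<omega>2 * t) - \<rho> * (4 * \<omega>1\<^sup>2 * t)"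
    by (simp add: \<tau>\<rho> algebra_simps)
  also have "\<dots> = 2 * \<omega>1 * (1 + 2 * t * up) * (n - \<rho>) + \<rho> * (c * E\<^sup>2) - \<rho> * (c\<^sup>2 * S\<^sup>2 * E\<^sup>2)"
    unfolding \<omega>sq \<omega>2t by (simp add: algebra_simps)
  also have "\<dots> \<ge> c * E\<^sup>2 * (n - \<rho>) + \<rho> * (c * E\<^sup>2) - \<rho> * (\<Lambda> * E\<^sup>2)"
  proof -
    have "c * E\<^sup>2 * (n - \<rho>) \<le> 2 * \<omega>1 * (1 + 2 * t * up) * (n - \<rho>)"
      using \<omega>\<psi> n \<rho> by (intro mult_right_mono) auto
    moreover have "\<rho> * (c\<^sup>2 * S\<^sup>2 * E\<^sup>2) \<le> \<rho> * (\<Lambda> * E\<^sup>2)"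
      using cS \<rho> by (intro mult_left_mono mult_right_mono) auto
    ultimately show ?thesis by linarith
  qed
  also have "c * E\<^sup>2 * (n - \<rho>) + \<rho> * (c * E\<^sup>2) - \<rho> * (\<Lambda> * E\<^sup>2) = (c * n) * E\<^sup>2 - \<rho> * (\<Lambda> * E\<^sup>2)"
    by (simp add: algebra_simps)
  also have "\<dots> = (2 - \<rho>) * (\<Lambda> * E\<^sup>2)" by (simp add: cn algebra_simps)
  finally have T: "(2 - \<rho>) * (\<Lambda> * E\<^sup>2) \<le> 4 * n * up * \<omega>1 * t + 2 * n * \<omega>1 - 8 * up * \<omega>1 * \<tau> + 4 * \<omega>2 * \<tau> - 4 * \<omega>1\<^sup>2 * \<tau>" .
  have "1 * (\<Lambda> * E\<^sup>2) < (2 - \<rho>) * (\<Lambda> * E\<^sup>2)"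
    using \<rho> \<Lambda>0 E by (intro mult_strict_right_mono) auto
  moreover have "4 * (n - 1) * \<tau> * (up\<^sup>2 - upp) \<ge> 0" using n \<tau> i by simp
  ultimately show False using T ineq b2 unfolding \<Lambda>_def by linarith
qed

context patch_normal
begin

lemma orth_facts:
  assumes x: "x \<in> U" and orth: "\<And>i j. pd i G x \<bullet> pd j G x = (if i = j then 1 else 0)"
  shows "ginv x = mat 1" "X i x = G x \<bullet> pd i G x" "(\<Sum>i\<in>UNIV. (X i x)\<^sup>2) + (W x)\<^sup>2 = G x \<bullet> G x"
proof -
  have g: "gram G x = mat 1" by (simp add: gram_def mat_def orth vec_eq_iff)
  show gi: "ginv x = mat 1"
    using matrix_inv_det_nz(1)[OF gram_det[OF x]] by (simp add: ginv_def g)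
  show Xe: "X i x = G x \<bullet> pd i G x" for i
    by (simp add: X_def gi mat_def if_distrib[of "\<lambda>z. z * _"] cong: if_cong)
  have "G x \<bullet> G x = G x \<bullet> ((\<Sum>j\<in>UNIV. X j x *\<^sub>R pd j G x) + W x *\<^sub>R \<nu> x)"
    using position_decompose[OF x] by simp
  also have "\<dots> = (\<Sum>i\<in>UNIV. (X i x)\<^sup>2) + (W x)\<^sup>2"
    by (simp add: inner_add_right inner_sum_right Xe power2_eq_square W_def)
  finally show "(\<Sum>i\<in>UNIV. (X i x)\<^sup>2) + (W x)\<^sup>2 = G x \<bullet> G x" by simp
qed

lemma trace_G2:
  assumes x: "x \<in> U"
  shows "G x \<bullet> pd i (pd i G) x = (\<Sum>l\<in>UNIV. \<Gamma> i i l x * X l x) + W x * h i i x"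
proof -
  have "G x \<bullet> pd i (pd i G) x = ((\<Sum>j\<in>UNIV. X j x *\<^sub>R pd j G x) + W x *\<^sub>R \<nu> x) \<bullet> pd i (pd i G) x"
    using position_decompose[OF x] by simp
  also have "\<dots> = (\<Sum>l\<in>UNIV. \<Gamma> i i l x * X l x) + W x * h i i x"
    by (simp add: inner_add_left inner_sum_left \<Gamma>_def h_def) (simp add: inner_commute mult.commute)
  finally show ?thesis .
qed

text \<open>The weight is kept abstract as a function of the squared norm. At the maximum the
  gradient of the logarithm plus the weight vanishes, which makes the derivatives of
  \<open>W\<close> multiples of \<open>X\<close>. As \<open>minimal\<close> prescribes the Euclidean
  mean curvature and hence its derivative, \<open>laplacian_support\<close> then yields an
  inequality free of derivatives of \<open>W\<close>.\<close>

lemma log_support_max: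
  fixes \<Phi> \<Phi>1 up :: "real \<Rightarrow> real"
  assumes x: "x \<in> U" and orth: "\<And>i j. pd i G x \<bullet> pd j G x = (if i = j then 1 else 0)"
    and pos: "\<And>y. y \<in> U \<Longrightarrow> 0 < W y"
    and \<Phi>: "\<And>y. y \<in> U \<Longrightarrow> (\<Phi> has_real_derivative \<Phi>1 (G y \<bullet> G y)) (at (G y \<bullet> G y))"
    and \<Phi>1: "(\<Phi>1 has_real_derivative \<Phi>2) (at (G x \<bullet> G x))"
    and up: "(up has_real_derivative upp) (at (G x \<bullet> G x))"
    and minimal: "\<And>y. y \<in> U \<Longrightarrow> (\<Sum>i\<in>UNIV. \<Sum>j\<in>UNIV. ginv y $ i $ j * h i j y)
        = 2 * real CARD('n) * (up (G y \<bullet> G y) * W y)"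
    and mx: "\<And>y. y \<in> U \<Longrightarrow> ln (W y) + \<Phi> (G y \<bullet> G y) \<le> ln (W x) + \<Phi> (G x \<bullet> G x)"
  defines "t \<equiv> G x \<bullet> G x" and "\<tau> \<equiv> (\<Sum>i\<in>UNIV. (X i x)\<^sup>2)" and "n \<equiv> real CARD('n)"
  shows "- 4 * n * upp * \<tau> + 4 * n * up t * \<Phi>1 t * \<tau> - 2 * n * up t - (\<Sum>i\<in>UNIV. \<Sum>j\<in>UNIV. (h i j x)\<^sup>2)
     - 4 * \<tau> * (\<Phi>1 t)\<^sup>2 + 4 * \<tau> * \<Phi>2 + \<Phi>1 t * (2 * n + 4 * n * up t * (W x)\<^sup>2) \<le> 0"
proof -
  define T where "T y = G y \<bullet> G y" for y
  define L where "L y = ln (W y) + \<Phi> (T y)" for y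
  let ?w = "W x"
  have w: "?w > 0" by (rule pos[OF x])
  have dT: "T differentiable (at y)" if "y \<in> U" for y
    unfolding T_def[abs_def] by (intro differentiable_inner' dG that)
  have T1: "pd i T y = 2 * (G y \<bullet> pd i G y)" if "y \<in> U" for i y
    unfolding T_def[abs_def] by (simp add: pd_inner dG that inner_commute)
  have dT1: "pd i T differentiable (at x)" for i
    by (rule differentiable_cong_open[OF op x, of "\<lambda>y. 2 * (G y \<bullet> pd i G y)"])
       (auto simp: T1 intro!: differentiable_mult differentiable_inner' dG dpd x)
  have T2: "pd i (pd i T) x = 2 * (1 + (\<Sum>l\<in>UNIV. \<Gamma> i i l x * X l x) + W x * h i i x)" for i
  proof -
    have "pd i (pd i T) x = pd i (\<lambda>y. 2 * (G y \<bullet> pd i G y)) x" by (rule pd_cong_open[OF op x T1])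
    also have "\<dots> = 2 * (1 + G x \<bullet> pd i (pd i G) x)"
      by (subst pd_mult)
         (auto simp: pd_inner dG dpd x orth pd_const intro!: differentiable_inner' dG dpd x)
    finally show ?thesis by (simp add: trace_G2[OF x])
  qed
  have dL: "L differentiable (at y)" if "y \<in> U" for y
    unfolding L_def[abs_def]
    using differentiable_chain[OF DERIV_ln[OF pos[OF that]] dW[OF that]]
      differentiable_chain[of \<Phi> _ T, OF \<Phi>[OF that, folded T_def] dT[OF that]]
    by (rule differentiable_add)
  have L1: "pd i L y = inverse (W y) * pd i W y + \<Phi>1 (T y) * pd i T y" if "y \<in> U" for i y
    unfolding L_def[abs_def]
    using differentiable_chain[OF DERIV_ln[OF pos[OF that]] dW[OF that]]
      differentiable_chain[of \<Phi> _ T, OF \<Phi>[OF that, folded T_def] dT[OF that]]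
    by (simp add: pd_add pd_chain[OF DERIV_ln[OF pos[OF that]] dW[OF that]]
        pd_chain[of \<Phi> _ T, OF \<Phi>[OF that, folded T_def] dT[OF that]])
  have invd: "(inverse has_real_derivative - (inverse ?w ^ Suc (Suc 0))) (at ?w)"
    using DERIV_inverse[of ?w UNIV] w by simp
  have dinv: "(\<lambda>y. inverse (W y)) differentiable (at x)"
    by (rule differentiable_chain[OF invd dW[OF x]])
  have d\<Phi>1: "(\<lambda>y. \<Phi>1 (T y)) differentiable (at x)"
    by (rule differentiable_chain[of \<Phi>1 _ T, OF \<Phi>1[folded T_def] dT[OF x]])
  have dL1: "pd i L differentiable (at x)" for i
    by (rule differentiable_cong_open[OF op x, of "\<lambda>y. inverse (W y) * pd i W y + \<Phi>1 (T y) * pd i T y"])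
       (auto simp: L1 intro!: differentiable_add differentiable_mult dinv dpdW x d\<Phi>1 dT1)
  have L2: "pd i (pd i L) x = inverse ?w * pd i (pd i W) x - (inverse ?w * pd i W x)\<^sup>2
      + \<Phi>1 t * pd i (pd i T) x + \<Phi>2 * (pd i T x)\<^sup>2" for i
  proof -
    have "pd i (pd i L) x = pd i (\<lambda>y. inverse (W y) * pd i W y + \<Phi>1 (T y) * pd i T y) x"
      by (rule pd_cong_open[OF op x L1])
    also have "\<dots> = pd i (\<lambda>y. inverse (W y) * pd i W y) x + pd i (\<lambda>y. \<Phi>1 (T y) * pd i T y) x"
      by (rule pd_add) (intro differentiable_mult dinv dpdW x d\<Phi>1 dT1)+
    also have "\<dots> = inverse ?w * pd i (pd i W) x + (- (inverse ?w ^ Suc (Suc 0)) * pd i W x) * pd i W x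
        + (\<Phi>1 (T x) * pd i (pd i T) x + \<Phi>2 * pd i T x * pd i T x)"
      by (simp only: pd_mult[OF dinv dpdW[OF x]] pd_mult[OF d\<Phi>1 dT1]
          pd_chain[OF invd dW[OF x]] pd_chain[of \<Phi>1 _ T, OF \<Phi>1[folded T_def] dT[OF x]])
    finally show ?thesis by (simp add: power2_eq_square t_def T_def algebra_simps)
  qed
  note test = local_max_second_derivative[OF op x dL dL1]
  have crit: "pd i L x = 0" and le: "pd i (pd i L) x \<le> 0" for i
    using test[of i] mx by (auto simp: L_def T_def)
  have Ti: "pd i T x = 2 * X i x" for i by (simp add: T1[OF x] orth_facts(2)[OF x orth])
  have Wi: "pd i W x = - 2 * ?w * \<Phi>1 t * X i x" for i
  proof -
    have "inverse ?w * pd i W x + \<Phi>1 t * (2 * X i x) = 0"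
      using crit[of i] by (simp add: L1[OF x] Ti t_def T_def)
    then have "?w * (inverse ?w * pd i W x + \<Phi>1 t * (2 * X i x)) = 0" by simp
    moreover have "?w * (inverse ?w * pd i W x) = pd i W x" using w by simp
    ultimately show ?thesis by (simp add: algebra_simps)
  qed
  let ?H = "\<Sum>i\<in>UNIV. h i i x" and ?N = "\<Sum>i\<in>UNIV. \<Sum>j\<in>UNIV. (h i j x)\<^sup>2"
  let ?GX = "\<Sum>i\<in>UNIV. \<Sum>l\<in>UNIV. \<Gamma> i i l x * X l x"
  have H: "?H = 2 * n * (up t * ?w)"
    using minimal[OF x] by (simp add: orth_facts(1)[OF x orth] mat_def if_distrib[of "\<lambda>z. z * _"] n_def t_def cong: if_cong)
  have E: "pd k (\<lambda>y. \<Sum>i\<in>UNIV. \<Sum>j\<in>UNIV. ginv y $ i $ j * h i j y) x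
      = 2 * n * (up t * (- 2 * ?w * \<Phi>1 t * X k x) + upp * (2 * X k x) * ?w)" for k
  proof -
    have "pd k (\<lambda>y. \<Sum>i\<in>UNIV. \<Sum>j\<in>UNIV. ginv y $ i $ j * h i j y) x
      = pd k (\<lambda>y. 2 * n * (up (T y) * W y)) x"
      by (rule pd_cong_open[OF op x]) (simp add: minimal n_def T_def)
    moreover have dup: "(\<lambda>y. up (T y)) differentiable (at x)"
      by (rule differentiable_chain[of up _ T, OF up[folded T_def] dT[OF x]])
    moreover have "pd k (\<lambda>y. up (T y)) x = upp * (2 * X k x)"
      by (simp only: pd_chain[of up _ T, OF up[folded T_def] dT[OF x]] Ti)
    ultimately show ?thesis
      using dW[OF x] by (simp add: pd_mult differentiable_mult pd_const Wi T_def t_def)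
  qed
  have XE: "(\<Sum>k\<in>UNIV. X k x * pd k (\<lambda>y. \<Sum>i\<in>UNIV. \<Sum>j\<in>UNIV. ginv y $ i $ j * h i j y) x)
      = \<tau> * (2 * n * ?w * (2 * upp - 2 * up t * \<Phi>1 t))"
    unfolding E \<tau>_def sum_distrib_right by (intro sum.cong refl) (simp add: power2_eq_square algebra_simps)
  have GW: "(\<Sum>i\<in>UNIV. \<Sum>l\<in>UNIV. \<Gamma> i i l x * pd l W x) = - (2 * ?w * \<Phi>1 t * ?GX)"
    unfolding Wi sum_distrib_left sum_negf[symmetric] by (intro sum.cong refl) (simp add: algebra_simps)
  have lap: "(\<Sum>i\<in>UNIV. pd i (pd i W) x) = - (2 * ?w * \<Phi>1 t * ?GX)
      - \<tau> * (2 * n * ?w * (2 * upp - 2 * up t * \<Phi>1 t)) - ?H - ?w * ?N"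
    using laplacian_support[OF x orth] unfolding XE GW by simp
  have sq: "(\<Sum>i\<in>UNIV. (inverse ?w * pd i W x)\<^sup>2) = 4 * \<tau> * (\<Phi>1 t)\<^sup>2"
    unfolding \<tau>_def sum_distrib_left sum_distrib_right
    by (intro sum.cong refl) (use w in \<open>simp add: Wi power2_eq_square\<close>)
  have tr: "(\<Sum>i\<in>UNIV. pd i (pd i T) x) = 2 * (n + ?GX + ?w * ?H)"
    unfolding T2 by (simp add: sum.distrib sum_distrib_left[symmetric] n_def)
  \<comment> \<open>Summing plain second derivatives instead of taking the Laplacian changes the
    result by a first order term, which is 0 at a critical point; accordingly \<open>?GX\<close>
    cancels between \<open>lap\<close> and \<open>tr\<close>.\<close>
  have "(\<Sum>i\<in>UNIV. pd i (pd i L) x) \<le> 0" by (rule sum_nonpos) (rule le)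
  moreover have "(\<Sum>i\<in>UNIV. pd i (pd i L) x) = inverse ?w * (\<Sum>i\<in>UNIV. pd i (pd i W) x)
      - (\<Sum>i\<in>UNIV. (inverse ?w * pd i W x)\<^sup>2) + \<Phi>1 t * (\<Sum>i\<in>UNIV. pd i (pd i T) x) + \<Phi>2 * (4 * \<tau>)"
    unfolding L2 by (simp add: sum.distrib sum_subtractf sum_distrib_left \<tau>_def Ti power_mult_distrib)
  ultimately have "inverse ?w * (- (2 * ?w * \<Phi>1 t * ?GX)
      - \<tau> * (2 * n * ?w * (2 * upp - 2 * up t * \<Phi>1 t)) - ?H - ?w * ?N)
      - 4 * \<tau> * (\<Phi>1 t)\<^sup>2 + \<Phi>1 t * (2 * (n + ?GX + ?w * ?H)) + \<Phi>2 * (4 * \<tau>) \<le> 0"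
    unfolding lap sq tr by simp
  also have "inverse ?w * (- (2 * ?w * \<Phi>1 t * ?GX)
      - \<tau> * (2 * n * ?w * (2 * upp - 2 * up t * \<Phi>1 t)) - ?H - ?w * ?N)
      = - (2 * \<Phi>1 t * ?GX) - \<tau> * (2 * n * (2 * upp - 2 * up t * \<Phi>1 t)) - 2 * n * up t - ?N"
    using w by (simp add: H right_diff_distrib field_simps)
  finally show ?thesis unfolding H by (simp add: algebra_simps power2_eq_square)
qed

end

section \<open>Bilinear forms under linear changes of coordinates\<close>

lemma trace_mul_sum:
  fixes P Q :: "real ^ 'n ^ 'n::finite"
  assumes "\<And>i j. Q $ i $ j = Q $ j $ i"
  shows "(\<Sum>i\<in>UNIV. \<Sum>j\<in>UNIV. P $ i $ j * Q $ i $ j) = trace (P ** Q)"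
  unfolding trace_def matrix_matrix_mult_def by (simp add: assms[of _ j for j])

text \<open>Written as the trace of a square, the contraction that defines the squared norm of a
  bilinear form inherits its invariance from the cyclicity of the trace.\<close>

lemma trace_mul_sum4:
  fixes P Q :: "real ^ 'n ^ 'n::finite"
  assumes P: "\<And>i j. P $ i $ j = P $ j $ i" and Q: "\<And>i j. Q $ i $ j = Q $ j $ i"
  shows "(\<Sum>i\<in>UNIV. \<Sum>j\<in>UNIV. \<Sum>k\<in>UNIV. \<Sum>l\<in>UNIV. P $ i $ k * P $ j $ l * (Q $ i $ j * Q $ k $ l))
    = trace ((P ** Q) ** (P ** Q))"
proof -
  have "trace ((P ** Q) ** (P ** Q)) = (\<Sum>k\<in>UNIV. \<Sum>j\<in>UNIV. (\<Sum>i\<in>UNIV. P $ k $ i * Q $ i $ j) * (\<Sum>l\<in>UNIV. P $ j $ l * Q $ l $ k))"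
    by (simp add: trace_def matrix_matrix_mult_def)
  also have "\<dots> = (\<Sum>k\<in>UNIV. \<Sum>j\<in>UNIV. \<Sum>i\<in>UNIV. \<Sum>l\<in>UNIV. P $ i $ k * P $ j $ l * (Q $ i $ j * Q $ k $ l))"
    unfolding sum_product
  proof (intro sum.cong refl)
    fix k j i l
    show "P $ k $ i * Q $ i $ j * (P $ j $ l * Q $ l $ k) = P $ i $ k * P $ j $ l * (Q $ i $ j * Q $ k $ l)"
      using P[of k i] Q[of l k] by simp
  qed
  also have "\<dots> = (\<Sum>k\<in>UNIV. \<Sum>i\<in>UNIV. \<Sum>j\<in>UNIV. \<Sum>l\<in>UNIV. P $ i $ k * P $ j $ l * (Q $ i $ j * Q $ k $ l))"
    by (intro sum.cong refl sum.swap)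
  also have "\<dots> = (\<Sum>i\<in>UNIV. \<Sum>k\<in>UNIV. \<Sum>j\<in>UNIV. \<Sum>l\<in>UNIV. P $ i $ k * P $ j $ l * (Q $ i $ j * Q $ k $ l))"
    by (rule sum.swap)
  also have "\<dots> = (\<Sum>i\<in>UNIV. \<Sum>j\<in>UNIV. \<Sum>k\<in>UNIV. \<Sum>l\<in>UNIV. P $ i $ k * P $ j $ l * (Q $ i $ j * Q $ k $ l))"
    by (intro sum.cong refl sum.swap)
  finally show ?thesis ..
qed

lemma matrix_inv_congruence:
  fixes A g :: "real ^ 'n ^ 'n::finite"
  assumes A: "det A \<noteq> 0" and g: "det g \<noteq> 0"
  shows "matrix_inv (transpose A ** g ** A) = matrix_inv A ** matrix_inv g ** transpose (matrix_inv A)"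
proof -
  let ?P = "transpose A ** g ** A" and ?Q = "matrix_inv A ** matrix_inv g ** transpose (matrix_inv A)"
  have AA: "transpose (matrix_inv A) ** transpose A = mat 1"
    using matrix_inv_det_nz(1)[OF A] by (metis matrix_transpose_mul transpose_mat)
  have "?Q ** ?P = matrix_inv A ** matrix_inv g ** (transpose (matrix_inv A) ** transpose A) ** g ** A"
    by (simp only: matrix_mul_assoc)
  also have "\<dots> = matrix_inv A ** (matrix_inv g ** g) ** A"
    unfolding AA by (simp only: matrix_mul_assoc matrix_mul_rid)
  also have "\<dots> = mat 1"
    by (simp add: matrix_inv_det_nz[OF g] matrix_inv_det_nz[OF A])
  finally have QP: "?Q ** ?P = mat 1" .
  have "det ?P \<noteq> 0" using A g by (simp add: det_mul det_transpose)
  then have "?P ** matrix_inv ?P = mat 1" by (rule matrix_inv_det_nz)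
  then show ?thesis using QP by (metis matrix_mul_assoc matrix_mul_lid matrix_mul_rid)
qed

text \<open>Here \<open>g\<close> stands for an inverse metric and \<open>B\<close> for a bilinear
  form. Their product is an endomorphism, which the new coordinates conjugate by
  \<open>A\<close>.\<close>

lemma trace_congruence:
  fixes A g B :: "real ^ 'n ^ 'n::finite"
  assumes A: "det A \<noteq> 0"
  defines "P \<equiv> matrix_inv A ** g ** transpose (matrix_inv A)" and "Q \<equiv> transpose A ** B ** A"
  shows "trace (P ** Q) = trace (g ** B)" "trace ((P ** Q) ** (P ** Q)) = trace ((g ** B) ** (g ** B))"
proof -
  have AA: "transpose (matrix_inv A) ** transpose A = mat 1"
    using matrix_inv_det_nz(1)[OF A] by (metis matrix_transpose_mul transpose_mat)
  have "P ** Q = matrix_inv A ** g ** (transpose (matrix_inv A) ** transpose A) ** B ** A"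
    by (simp only: matrix_mul_assoc P_def Q_def)
  then have PQ: "P ** Q = matrix_inv A ** (g ** B) ** A"
    unfolding AA by (simp only: matrix_mul_assoc matrix_mul_rid)
  have conj: "trace (matrix_inv A ** K ** A) = trace K" for K
    by (metis trace_mul_sym matrix_mul_assoc matrix_inv_det_nz(1)[OF A] matrix_mul_lid)
  show "trace (P ** Q) = trace (g ** B)" by (simp add: PQ conj)
  have "(P ** Q) ** (P ** Q) = matrix_inv A ** (g ** B) ** (A ** matrix_inv A) ** (g ** B) ** A"
    unfolding PQ by (simp only: matrix_mul_assoc)
  also have "\<dots> = matrix_inv A ** ((g ** B) ** (g ** B)) ** A"
    unfolding matrix_inv_det_nz(1)[OF A] by (simp only: matrix_mul_assoc matrix_mul_rid)
  finally show "trace ((P ** Q) ** (P ** Q)) = trace ((g ** B) ** (g ** B))" by (simp add: conj)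
qed

lemma congruence_entry:
  fixes A B :: "real ^ 'n ^ 'n::finite"
  shows "(transpose A ** B ** A) $ i $ j = (\<Sum>k\<in>UNIV. \<Sum>l\<in>UNIV. A $ k $ i * A $ l $ j * B $ k $ l)"
proof -
  have "(transpose A ** B ** A) $ i $ j = (\<Sum>l\<in>UNIV. \<Sum>k\<in>UNIV. A $ k $ i * A $ l $ j * B $ k $ l)"
    by (simp add: matrix_matrix_mult_def transpose_def sum_distrib_left sum_distrib_right mult_ac)
  also have "\<dots> = (\<Sum>k\<in>UNIV. \<Sum>l\<in>UNIV. A $ k $ i * A $ l $ j * B $ k $ l)" by (rule sum.swap)
  finally show ?thesis .
qed

lemma pd_affine:
  fixes F :: "real ^ 'n::finite \<Rightarrow> 'b::real_normed_vector" and A :: "real ^ 'n ^ 'n"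
  assumes "F differentiable (at (x + A *v z))"
  shows "pd i (\<lambda>z. F (x + A *v z)) z = (\<Sum>k\<in>UNIV. A $ k $ i *\<^sub>R pd k F (x + A *v z))"
proof -
  let ?D = "frechet_derivative F (at (x + A *v z))"
  have lin: "linear ?D" using assms frechet_derivative_works has_derivative_linear by blast
  have "((\<lambda>z. x + A *v z) has_derivative (*v) A) (at z)"
    by (auto intro!: derivative_eq_intros bounded_linear_imp_has_derivative)
  from has_derivative_compose[OF this assms[unfolded frechet_derivative_works]]
  have "pd i (\<lambda>z. F (x + A *v z)) z = ?D (A *v axis i 1)" by (rule pd_eq)
  also have "A *v axis i 1 = (\<Sum>k\<in>UNIV. A $ k $ i *\<^sub>R axis k 1)"
    using basis_expansion[of "A *v axis i 1"]
    by (simp add: matrix_vector_mult_basis column_def scalar_mult_eq_scaleR)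
  also have "?D \<dots> = (\<Sum>k\<in>UNIV. A $ k $ i *\<^sub>R ?D (axis k 1))"
    by (simp add: linear_sum[OF lin] linear_cmul[OF lin])
  finally show ?thesis by (simp add: pd_frechet)
qed

lemma Ck_on_affine:
  fixes F :: "real ^ 'n::finite \<Rightarrow> 'b::real_normed_vector" and A :: "real ^ 'n ^ 'n"
  assumes "open U" "Ck_on k U F"
  shows "Ck_on k ((\<lambda>z. x + A *v z) -` U) (\<lambda>z. F (x + A *v z))"
proof (rule Ck_on_compose[OF _ _ assms(2)])
  have "continuous_on UNIV (\<lambda>z. x + A *v z)" by (intro continuous_intros matrix_vector_mult_linear_continuous_on)
  then show op: "open ((\<lambda>z. x + A *v z) -` U)" by (rule open_vimage[OF assms(1)])
  show "Ck_on k ((\<lambda>z. x + A *v z) -` U) (\<lambda>z. x + A *v z)"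
    by (intro Ck_on_add Ck_on_const op Ck_on_bounded_linear[of "(*v) A"] Ck_on_id) auto
qed auto

context patch
begin

text \<open>The columns of \<open>A\<close> are preimages, under the differential of
  \<open>G\<close>, of an orthonormal basis of the tangent space.\<close>

lemma orthonormal_coordinates:
  assumes x: "x \<in> U"
  shows "\<exists>A :: real ^ 'n ^ 'n. transpose A ** gram G x ** A = mat 1"
proof -
  let ?D = "frechet_derivative G (at x)"
  have sub: "subspace (range ?D)" using linear_subspace_image[OF lin[OF x] subspace_UNIV] .
  obtain B where B: "B \<subseteq> range ?D" "pairwise orthogonal B" "\<And>b. b \<in> B \<Longrightarrow> norm b = 1"
    "independent B" "card B = dim (range ?D)"
    using orthonormal_basis_subspace[OF sub] by metis
  have cB: "card B = card (UNIV :: 'n set)" using B(5) dim_range[OF x] by simp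
  have "finite B" using B(4) independent_imp_finite by blast
  then obtain \<beta> :: "'n \<Rightarrow> real ^ 'm" where \<beta>: "bij_betw \<beta> UNIV B"
    using cB finite_same_card_bij[of "UNIV :: 'n set" B] by auto
  have on: "\<beta> i \<bullet> \<beta> j = (if i = j then 1 else 0)" for i j
  proof (cases "i = j")
    case True
    have "norm (\<beta> j) = 1" using B(3) \<beta> by (simp add: bij_betwE)
    then show ?thesis using True by (simp add: dot_square_norm)
  next
    case False
    then have "\<beta> i \<noteq> \<beta> j" using \<beta> by (metis UNIV_I bij_betw_imp_inj_on inj_on_contraD)
    then show ?thesis using False B(2) \<beta> by (simp add: pairwise_def orthogonal_def bij_betwE)
  qed
  have "\<forall>i. \<exists>a. ?D a = \<beta> i" using B(1) \<beta> by (metis UNIV_I bij_betwE image_iff subset_iff)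
  then obtain a where a: "\<And>i. ?D (a i) = \<beta> i" by metis
  define A where "A = (\<chi> k i. a i $ k)"
  have "(transpose A ** gram G x ** A) $ i $ j = ?D (a i) \<bullet> ?D (a j)" for i j
    unfolding congruence_entry deriv_expand[OF x]
    by (subst sum.swap) (simp add: A_def gram_def inner_sum_left inner_sum_right sum_distrib_left mult_ac)
  then have "transpose A ** gram G x ** A = mat 1"
    by (simp add: vec_eq_iff a on mat_def)
  then show ?thesis by blast
qed

end

context patch_normal
begin

text \<open>For \<open>up = u'\<close> these are the normal components of the second fundamental form of the conformal metric
  \<open>e\<^bsup>2u\<^esup>\<langle>\<cdot>,\<cdot>\<rangle>\<close>.\<close>

definition "bmat up y = (\<chi> i j. h i j y - 2 * up (G y \<bullet> G y) * W y * gram G y $ i $ j)"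

lemma gram_sym: "gram G y $ i $ j = gram G y $ j $ i"
  by (simp add: gram_def inner_commute)

lemma bmat_sym: "y \<in> U \<Longrightarrow> bmat up y $ i $ j = bmat up y $ j $ i"
  using gram_sym[of y i j] h_sym[of y i j] by (simp add: bmat_def)

lemma trace_bmat:
  assumes y: "y \<in> U"
  shows "(\<Sum>i\<in>UNIV. \<Sum>j\<in>UNIV. ginv y $ i $ j * bmat up y $ i $ j)
    = (\<Sum>i\<in>UNIV. \<Sum>j\<in>UNIV. ginv y $ i $ j * h i j y) - 2 * real CARD('n) * (up (G y \<bullet> G y) * W y)"
proof -
  have "(\<Sum>i\<in>UNIV. \<Sum>j\<in>UNIV. ginv y $ i $ j * gram G y $ i $ j) = real CARD('n)"
  proof -
    have "(\<Sum>i\<in>UNIV. \<Sum>j\<in>UNIV. ginv y $ i $ j * gram G y $ i $ j)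
      = (\<Sum>i\<in>UNIV. \<Sum>j\<in>UNIV. ginv y $ i $ j * gram G y $ j $ i)"
      by (intro sum.cong refl) (simp only: gram_sym)
    then show ?thesis by (simp add: ginv_gram(1)[OF y])
  qed
  moreover have "(\<Sum>i\<in>UNIV. \<Sum>j\<in>UNIV. ginv y $ i $ j * bmat up y $ i $ j)
    = (\<Sum>i\<in>UNIV. \<Sum>j\<in>UNIV. ginv y $ i $ j * h i j y) - 2 * up (G y \<bullet> G y) * W y * (\<Sum>i\<in>UNIV. \<Sum>j\<in>UNIV. ginv y $ i $ j * gram G y $ i $ j)"
    by (simp add: bmat_def right_diff_distrib sum_subtractf sum_distrib_left mult_ac)
  ultimately show ?thesis by simp
qed

lemma affine_patch:
  fixes A :: "real ^ 'n ^ 'n"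
  assumes A: "det A \<noteq> 0"
  shows "patch_normal ((\<lambda>z. x + A *v z) -` U) (\<lambda>z. G (x + A *v z)) (\<lambda>z. \<nu> (x + A *v z))"
proof
  let ?\<phi> = "\<lambda>z. x + A *v z"
  have phid: "(?\<phi> has_derivative (*v) A) (at z)" for z
    by (auto intro!: derivative_eq_intros bounded_linear_imp_has_derivative)
  show "CARD('m) = CARD('n) + 1" by (rule card)
  have "continuous_on UNIV ?\<phi>" by (intro continuous_intros matrix_vector_mult_linear_continuous_on)
  then show "open (?\<phi> -` U)" by (rule open_vimage[OF op])
  show "Ck_on k (?\<phi> -` U) (\<lambda>z. G (?\<phi> z))" for k by (rule Ck_on_affine[OF op C])
  fix z assume z: "z \<in> ?\<phi> -` U"
  have "frechet_derivative (\<lambda>z. G (?\<phi> z)) (at z) = (\<lambda>v. frechet_derivative G (at (?\<phi> z)) (A *v v))"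
    by (rule frechet_derivative_at[OF has_derivative_compose[OF phid Ck_on_has_derivative[OF C]], symmetric])
       (use z in auto)
  moreover have "inj ((*v) A)" using A det_nz_iff_inj[of "(*v) A"] by simp
  ultimately show "inj (frechet_derivative (\<lambda>z. G (?\<phi> z)) (at z))"
    using inj_compose[OF inj[of "?\<phi> z"]] z by (simp add: o_def)
  show "norm (\<nu> (?\<phi> z)) = 1" using unit z by simp
  show "\<nu> (?\<phi> z) \<bullet> pd i (\<lambda>z. G (?\<phi> z)) z = 0" for i
    using z by (simp add: pd_affine dG inner_sum_right normal)
  show "(\<lambda>z. \<nu> (?\<phi> z)) differentiable at z"
    using has_derivative_compose[OF phid, of \<nu> _ z] d_normal[of "?\<phi> z"] z
    unfolding differentiable_def by auto
qed

text \<open>An affine substitution creates no first order terms in the second derivatives of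
  \<open>G\<close>, so \<open>h\<close> and \<open>bmat\<close> transform by the same congruence as
  the Gram matrix.\<close>

lemma affine_transform:
  fixes A :: "real ^ 'n ^ 'n"
  assumes A: "det A \<noteq> 0" and z: "x + A *v z \<in> U"
  defines "G' \<equiv> \<lambda>z. G (x + A *v z)" and "\<nu>' \<equiv> \<lambda>z. \<nu> (x + A *v z)"
  shows "gram G' z = transpose A ** gram G (x + A *v z) ** A"
    "patch_normal.W G' \<nu>' z = W (x + A *v z)"
    "(\<chi> i j. patch_normal.h G' \<nu>' i j z) = transpose A ** (\<chi> i j. h i j (x + A *v z)) ** A"
    "patch_normal.bmat G' \<nu>' up z = transpose A ** bmat up (x + A *v z) ** A"
proof -
  let ?\<phi> = "\<lambda>z. x + A *v z"
  interpret P: patch_normal "?\<phi> -` U" G' \<nu>'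
    unfolding G'_def \<nu>'_def by (rule affine_patch[OF A])
  have G1: "pd i G' z = (\<Sum>k\<in>UNIV. A $ k $ i *\<^sub>R pd k G (?\<phi> z))" if "?\<phi> z \<in> U" for i z
    unfolding G'_def by (rule pd_affine[OF dG[OF that]])
  show g: "gram G' z = transpose A ** gram G (?\<phi> z) ** A"
  proof -
    have "gram G' z $ i $ j = (transpose A ** gram G (?\<phi> z) ** A) $ i $ j" for i j
      unfolding congruence_entry
      by (subst sum.swap) (simp add: gram_def G1[OF z] inner_sum_left inner_sum_right sum_distrib_left mult_ac)
    then show ?thesis by (simp add: vec_eq_iff)
  qed
  show w: "P.W z = W (?\<phi> z)" unfolding P.W_def W_def by (simp add: G'_def \<nu>'_def)
  have G2: "pd i (pd j G') z = (\<Sum>l\<in>UNIV. \<Sum>k\<in>UNIV. (A $ l $ j * A $ k $ i) *\<^sub>R pd k (pd l G) (?\<phi> z))" for i j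
  proof -
    have "pd i (pd j G') z = pd i (\<lambda>z. \<Sum>k\<in>UNIV. A $ k $ j *\<^sub>R pd k G (?\<phi> z)) z"
      by (rule pd_cong_open[OF P.op _ G1]) (use z in auto)
    also have "\<dots> = (\<Sum>l\<in>UNIV. A $ l $ j *\<^sub>R pd i (\<lambda>z. pd l G (?\<phi> z)) z)"
    proof -
      have d: "(\<lambda>z. pd l G (?\<phi> z)) differentiable at z" for l
        using Ck_on_differentiable[OF Ck_on_affine[OF op C_pd]] z by auto
      have "pd i (\<lambda>z. A $ l $ j *\<^sub>R pd l G (?\<phi> z)) z = A $ l $ j *\<^sub>R pd i (\<lambda>z. pd l G (?\<phi> z)) z" for l
        using pd_bilinear[OF bounded_bilinear_scaleR differentiable_const d] by (simp add: pd_const)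
      moreover have "(\<lambda>z. A $ l $ j *\<^sub>R pd l G (?\<phi> z)) differentiable at z" for l
        by (rule differentiable_bilinear[OF bounded_bilinear_scaleR differentiable_const d])
      ultimately show ?thesis by (simp add: pd_sum)
    qed
    also have "\<dots> = (\<Sum>l\<in>UNIV. \<Sum>k\<in>UNIV. (A $ l $ j * A $ k $ i) *\<^sub>R pd k (pd l G) (?\<phi> z))"
      by (simp add: pd_affine[OF dpd[OF z]] scaleR_sum_right)
    finally show ?thesis .
  qed
  have h1: "P.h i j z = (transpose A ** (\<chi> i j. h i j (?\<phi> z)) ** A) $ i $ j" for i j
    unfolding P.h_def G2 congruence_entry
    by (subst sum.swap) (simp add: inner_sum_left h_def \<nu>'_def mult_ac)
  then show "(\<chi> i j. P.h i j z) = transpose A ** (\<chi> i j. h i j (?\<phi> z)) ** A"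
    by (simp add: vec_eq_iff)
  show "P.bmat up z = transpose A ** bmat up (?\<phi> z) ** A"
  proof -
    have GG: "G' z = G (?\<phi> z)" by (simp add: G'_def)
    have "P.bmat up z $ i $ j = (transpose A ** bmat up (?\<phi> z) ** A) $ i $ j" for i j
      unfolding P.bmat_def vec_lambda_beta h1 w g GG congruence_entry
      by (simp add: bmat_def right_diff_distrib sum_subtractf sum_distrib_left mult_ac)
    then show ?thesis by (simp add: vec_eq_iff)
  qed
qed

text \<open>The trace condition and the norm bound are invariant under linear changes of coordinates, so the
  coordinates may be taken orthonormal at the maximum point.\<close>

lemma no_weighted_support_max:
  fixes u up \<omega> \<omega>1 :: "real \<Rightarrow> real"
  assumes x: "x \<in> U"
    and pos: "\<And>y. y \<in> U \<Longrightarrow> 0 < W y"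
    and u: "\<And>y. y \<in> U \<Longrightarrow> (u has_real_derivative up (G y \<bullet> G y)) (at (G y \<bullet> G y))"
    and \<omega>: "\<And>y. y \<in> U \<Longrightarrow> (\<omega> has_real_derivative \<omega>1 (G y \<bullet> G y)) (at (G y \<bullet> G y))"
    and up: "(up has_real_derivative upp) (at (G x \<bullet> G x))"
    and \<omega>1: "(\<omega>1 has_real_derivative \<omega>2) (at (G x \<bullet> G x))"
    and minimal: "\<And>y. y \<in> U \<Longrightarrow> (\<Sum>i\<in>UNIV. \<Sum>j\<in>UNIV. ginv y $ i $ j * bmat up y $ i $ j) = 0"
    and mx: "\<And>y. y \<in> U \<Longrightarrow> ln (W y) + (u (G y \<bullet> G y) + \<omega> (G y \<bullet> G y))
        \<le> ln (W x) + (u (G x \<bullet> G x) + \<omega> (G x \<bullet> G x))"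
  defines "t \<equiv> G x \<bullet> G x" and "n \<equiv> real CARD('n)"
  assumes r: "0 < r" "r\<^sup>2 = t"
    and i: "upp - (up t)\<^sup>2 \<le> 0" and E: "0 < E" and S: "0 \<le> S" "S \<le> rb" and rb: "0 < rb"
    and S\<psi>: "r * E \<le> S * (1 + 2 * t * up t)"
    and c: "c = n / (2 * rb\<^sup>2)" and \<omega>1e: "\<omega>1 t = c * S * E / (2 * r)"
    and \<omega>2: "\<omega>2 = c * E\<^sup>2 / (4 * t) + \<omega>1 t * (up t - 1 / (2 * t))"
    and gap: "(\<Sum>i\<in>UNIV. \<Sum>j\<in>UNIV. \<Sum>k\<in>UNIV. \<Sum>l\<in>UNIV. ginv x $ i $ k * ginv x $ j $ l
        * (bmat up x $ i $ j * bmat up x $ k $ l)) \<le> n\<^sup>2 / (4 * rb\<^sup>2) * E\<^sup>2"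
  shows False
proof -
  obtain A :: "real ^ 'n ^ 'n" where A: "transpose A ** gram G x ** A = mat 1"
    using orthonormal_coordinates[OF x] by blast
  have dA: "det A \<noteq> 0"
    using arg_cong[OF A, of det] by (auto simp: det_mul)
  define G' where "G' z = G (x + A *v z)" for z
  define \<nu>' where "\<nu>' z = \<nu> (x + A *v z)" for z
  let ?U = "(\<lambda>z. x + A *v z) -` U"
  interpret P: patch_normal ?U G' \<nu>'
    using affine_patch[OF dA, of x] by (simp add: G'_def[abs_def] \<nu>'_def[abs_def])
  note tr = affine_transform[OF dA, of x, folded G'_def[abs_def] \<nu>'_def[abs_def]]
  have z0: "0 \<in> ?U" using x by simp
  have GG: "G' z = G (x + A *v z)" for z by (simp add: G'_def)
  have G0: "G' 0 = G x" by (simp add: GG)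
  have W: "P.W z = W (x + A *v z)" if "z \<in> ?U" for z using tr(2)[of z] that by simp
  have W0: "P.W 0 = W x" using W[OF z0] by simp
  have ginv: "P.ginv z = matrix_inv A ** ginv (x + A *v z) ** transpose (matrix_inv A)" if "z \<in> ?U" for z
    using that tr(1)[of z] by (simp add: P.ginv_def ginv_def matrix_inv_congruence[OF dA gram_det])
  have bm: "P.bmat up z = transpose A ** bmat up (x + A *v z) ** A" if "z \<in> ?U" for z
    using tr(4)[of z] that by simp
  have min: "(\<Sum>i\<in>UNIV. \<Sum>j\<in>UNIV. P.ginv z $ i $ j * P.h i j z) = 2 * n * (up (G' z \<bullet> G' z) * P.W z)"
    if z: "z \<in> ?U" for z
  proof -
    have "(\<Sum>i\<in>UNIV. \<Sum>j\<in>UNIV. P.ginv z $ i $ j * P.bmat up z $ i $ j) = trace (P.ginv z ** P.bmat up z)"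
      by (rule trace_mul_sum[OF P.bmat_sym[OF z]])
    also have "\<dots> = trace (ginv (x + A *v z) ** bmat up (x + A *v z))"
      unfolding ginv[OF z] bm[OF z] by (rule trace_congruence[OF dA])
    also have "\<dots> = (\<Sum>i\<in>UNIV. \<Sum>j\<in>UNIV. ginv (x + A *v z) $ i $ j * bmat up (x + A *v z) $ i $ j)"
      by (rule trace_mul_sum[OF bmat_sym, symmetric]) (use z in auto)
    also have "\<dots> = 0" using minimal z by simp
    finally show ?thesis using P.trace_bmat[OF z, of up] by (simp add: n_def)
  qed
  have orth: "pd i G' 0 \<bullet> pd j G' 0 = (if i = j then 1 else 0)" for i j
  proof -
    have "gram G' 0 = mat 1" using tr(1)[of 0] x A by simp
    then have "gram G' 0 $ i $ j = mat 1 $ i $ j" by simp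
    then show ?thesis by (simp add: gram_def mat_def)
  qed
  have gi: "P.ginv 0 = mat 1" by (rule P.orth_facts(1)[OF z0 orth])
  define b2 where "b2 = (\<Sum>i\<in>UNIV. \<Sum>j\<in>UNIV. (P.bmat up 0 $ i $ j)\<^sup>2)"
  define \<tau> where "\<tau> = (\<Sum>i\<in>UNIV. (P.X i 0)\<^sup>2)"
  have b2: "b2 \<le> n\<^sup>2 / (4 * rb\<^sup>2) * E\<^sup>2"
  proof -
    have "b2 = trace (P.bmat up 0 ** P.bmat up 0)"
      unfolding b2_def power2_eq_square by (rule trace_mul_sum[OF P.bmat_sym[OF z0]])
    also have "\<dots> = trace ((P.ginv 0 ** P.bmat up 0) ** (P.ginv 0 ** P.bmat up 0))" by (simp add: gi)
    also have "\<dots> = trace ((ginv x ** bmat up x) ** (ginv x ** bmat up x))"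
      using trace_congruence(2)[OF dA, of "ginv x" "bmat up x"] ginv[OF z0] bm[OF z0] by simp
    also have "\<dots> = (\<Sum>i\<in>UNIV. \<Sum>j\<in>UNIV. \<Sum>k\<in>UNIV. \<Sum>l\<in>UNIV. ginv x $ i $ k * ginv x $ j $ l
        * (bmat up x $ i $ j * bmat up x $ k $ l))"
      by (rule trace_mul_sum4[OF ginv_sym[OF x] bmat_sym[OF x], symmetric])
    finally show ?thesis using gap by simp
  qed
  \<comment> \<open>At 0 the matrix \<open>h\<close> is \<open>bmat\<close> plus a multiple of the
    identity; the mixed terms vanish because \<open>bmat\<close> is trace free.\<close>
  have hb: "(\<Sum>i\<in>UNIV. \<Sum>j\<in>UNIV. (P.h i j 0)\<^sup>2) = b2 + 4 * n * (up t)\<^sup>2 * (W x)\<^sup>2"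
  proof -
    have g1: "gram G' 0 $ i $ j = (if i = j then 1 else 0)" for i j by (simp add: gram_def orth)
    have tr0: "(\<Sum>i\<in>UNIV. P.bmat up 0 $ i $ i) = 0"
    proof -
      have "(\<Sum>i\<in>UNIV. \<Sum>j\<in>UNIV. P.ginv 0 $ i $ j * P.bmat up 0 $ i $ j) = 0"
        using P.trace_bmat[OF z0, of up] min[OF z0] by (simp add: n_def)
      then show ?thesis by (simp add: gi mat_def if_distrib[of "\<lambda>z. z * _"] cong: if_cong)
    qed
    have "(P.h i j 0)\<^sup>2 = (P.bmat up 0 $ i $ j)\<^sup>2
        + (if i = j then 4 * up t * W x * P.bmat up 0 $ i $ j + 4 * (up t)\<^sup>2 * (W x)\<^sup>2 else 0)" for i j
      by (simp add: P.bmat_def g1 W0 G0 t_def power2_eq_square algebra_simps)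
    then have "(\<Sum>i\<in>UNIV. \<Sum>j\<in>UNIV. (P.h i j 0)\<^sup>2) = b2
        + (4 * up t * W x * (\<Sum>i\<in>UNIV. P.bmat up 0 $ i $ i) + n * (4 * (up t)\<^sup>2 * (W x)\<^sup>2))"
      by (simp add: sum.distrib b2_def sum_distrib_left n_def)
    then show ?thesis by (simp add: tr0)
  qed
  have hb': "(\<Sum>i\<in>UNIV. \<Sum>j\<in>UNIV. (P.h i j 0)\<^sup>2)
      = b2 + 4 * real CARD('n) * (up (G' 0 \<bullet> G' 0))\<^sup>2 * (P.W 0)\<^sup>2"
    by (simp add: hb n_def t_def W0 G0)
  have ineq: "- 4 * n * upp * \<tau> + 4 * n * up t * (up t + \<omega>1 t) * \<tau> - 2 * n * up t - (b2 + 4 * n * (up t)\<^sup>2 * (W x)\<^sup>2)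
     - 4 * \<tau> * (up t + \<omega>1 t)\<^sup>2 + 4 * \<tau> * (upp + \<omega>2) + (up t + \<omega>1 t) * (2 * n + 4 * n * up t * (W x)\<^sup>2) \<le> 0"
    unfolding \<tau>_def n_def t_def W0[symmetric] G0[symmetric] hb'[symmetric]
  proof (rule P.log_support_max[OF z0 orth, where \<Phi> = "\<lambda>t. u t + \<omega> t" and ?\<Phi>1.0 = "\<lambda>t. up t + \<omega>1 t"])
    show "((\<lambda>t. u t + \<omega> t) has_real_derivative up (G' y \<bullet> G' y) + \<omega>1 (G' y \<bullet> G' y)) (at (G' y \<bullet> G' y))"
      if "y \<in> ?U" for y using that unfolding GG by (intro DERIV_add u \<omega>) auto
    show "((\<lambda>t. up t + \<omega>1 t) has_real_derivative upp + \<omega>2) (at (G' 0 \<bullet> G' 0))"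
      unfolding G0 by (intro DERIV_add up \<omega>1)
    show "(up has_real_derivative upp) (at (G' 0 \<bullet> G' 0))" unfolding G0 by (rule up)
    show "0 < P.W y" if "y \<in> ?U" for y using that by (simp add: W pos)
    show "(\<Sum>i\<in>UNIV. \<Sum>j\<in>UNIV. P.ginv y $ i $ j * P.h i j y) = 2 * real CARD('n) * (up (G' y \<bullet> G' y) * P.W y)"
      if "y \<in> ?U" for y using min[OF that] by (simp add: n_def)
    show "ln (P.W y) + (u (G' y \<bullet> G' y) + \<omega> (G' y \<bullet> G' y)) \<le> ln (P.W 0) + (u (G' 0 \<bullet> G' 0) + \<omega> (G' 0 \<bullet> G' 0))"
      if "y \<in> ?U" for y
      unfolding W[OF that] W0 G0 unfolding GG using that by (intro mx) auto
  qed
  have \<tau>t: "\<tau> + (W x)\<^sup>2 = t"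
    using P.orth_facts(3)[OF z0 orth] by (simp add: \<tau>_def t_def W0 G0)
  show False
  proof (rule support_contradiction[of n \<tau> "W x" t r upp "up t" E S rb c "\<omega>1 t" \<omega>2 b2])
    show "1 \<le> n" by (simp add: n_def Suc_le_eq)
    show "0 \<le> \<tau>" by (simp add: \<tau>_def sum_nonneg)
    show "W x \<noteq> 0" using pos[OF x] by simp
    \<comment> \<open>The last summand on the right is 0 by \<open>\<tau>t\<close>; adding it turns
      the equation into a polynomial identity.\<close>
    have "4 * (n - 1) * \<tau> * ((up t)\<^sup>2 - upp) + 4 * n * up t * \<omega>1 t * t + 2 * n * \<omega>1 t - 8 * up t * \<omega>1 t * \<tau>
      + 4 * \<omega>2 * \<tau> - 4 * (\<omega>1 t)\<^sup>2 * \<tau> - b2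
      = - 4 * n * upp * \<tau> + 4 * n * up t * (up t + \<omega>1 t) * \<tau> - 2 * n * up t - (b2 + 4 * n * (up t)\<^sup>2 * (W x)\<^sup>2)
     - 4 * \<tau> * (up t + \<omega>1 t)\<^sup>2 + 4 * \<tau> * (upp + \<omega>2) + (up t + \<omega>1 t) * (2 * n + 4 * n * up t * (W x)\<^sup>2)
      + 4 * n * up t * \<omega>1 t * (t - (\<tau> + (W x)\<^sup>2))"
      by (simp add: algebra_simps power2_eq_square)
    then show "4 * (n - 1) * \<tau> * ((up t)\<^sup>2 - upp) + 4 * n * up t * \<omega>1 t * t + 2 * n * \<omega>1 t - 8 * up t * \<omega>1 t * \<tau>
      + 4 * \<omega>2 * \<tau> - 4 * (\<omega>1 t)\<^sup>2 * \<tau> - b2 \<le> 0"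
      using ineq \<tau>t by simp
  qed (fact \<tau>t r i E S rb S\<psi> c \<omega>1e \<omega>2 b2)+
qed

end

section \<open>Second fundamental form in a conformally Euclidean metric\<close>

text \<open>Even at a boundary point the set contains short steps in every positive coordinate
  direction. These directions form a basis, so they determine the derivative.\<close>

lemma frechet_derivative_within_half_space:
  fixes f :: "real ^ 'n::finite \<Rightarrow> 'b::real_normed_vector"
  assumes S: "openin (top_of_set half_space) S" "x \<in> S" and D: "(f has_derivative D) (at x within S)"
  shows "frechet_derivative f (at x within S) = D"
proof -
  have D2: "(f has_derivative frechet_derivative f (at x within S)) (at x within S)"
    using D frechet_derivative_works differentiable_def by blast
  show ?thesis
  proof (rule frechet_derivative_unique_within[OF D2 D])
    fix b :: "real ^ 'n" and e :: real assume b: "b \<in> Basis" and e: "0 < e"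
    obtain e' where e': "e' > 0" "ball x e' \<inter> half_space \<subseteq> S"
      using S openin_contains_ball[of half_space S] by blast
    obtain k where k: "b = axis k 1" using b by (auto simp: Basis_vec_def)
    define d where "d = min e e' / 2"
    have d: "0 < d" "d < e" "d < e'" using e e' by (auto simp: d_def)
    have "x \<in> half_space" using S openin_imp_subset by blast
    then have "x + d *\<^sub>R b \<in> half_space" using d by (auto simp: half_space_def k axis_def)
    moreover have "x + d *\<^sub>R b \<in> ball x e'" using d b by (simp add: dist_norm)
    ultimately show "\<exists>d. 0 < \<bar>d\<bar> \<and> \<bar>d\<bar> < e \<and> x + d *\<^sub>R b \<in> S" using d e' by (intro exI[of _ d]) auto
  qed
qed

text \<open>The geometric definitions differentiate within the chart image, the computations
  differentiate a smooth extension on an open set; this is the bridge between them.\<close>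

lemma frechet_derivative_extension:
  fixes F :: "real ^ 'n::finite \<Rightarrow> 'b::real_normed_vector"
  assumes S: "openin (top_of_set half_space) S" and U: "open U" "x \<in> S" "x \<in> U"
    and FG: "\<And>y. y \<in> S \<inter> U \<Longrightarrow> F y = G y" and dG: "G differentiable (at x)"
  shows "(F has_derivative frechet_derivative G (at x)) (at x within S)"
    "frechet_derivative F (at x within S) = frechet_derivative G (at x)"
proof -
  obtain d where d: "d > 0" "ball x d \<subseteq> U" using U open_contains_ball by blast
  have "(G has_derivative frechet_derivative G (at x)) (at x within S)"
    using dG frechet_derivative_works has_derivative_at_withinI by blast
  then show 1: "(F has_derivative frechet_derivative G (at x)) (at x within S)"
    by (rule has_derivative_transform_within[OF _ d(1) U(2)])
       (use d FG in \<open>auto simp: dist_commute subset_iff\<close>)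
  show "frechet_derivative F (at x within S) = frechet_derivative G (at x)"
    by (rule frechet_derivative_within_half_space[OF S U(2) 1])
qed

lemma partial_extension:
  assumes "openin (top_of_set half_space) S" "open U" "x \<in> S" "x \<in> U"
    "\<And>y. y \<in> S \<inter> U \<Longrightarrow> F y = G y" "G differentiable (at x)"
  shows "partial S i F x = pd i G x"
  using frechet_derivative_extension(2)[OF assms] by (simp add: partial_def)

lemma matrix_inv_unique:
  fixes B C :: "real ^ 'n ^ 'n::finite"
  assumes "C ** B = mat 1"
  shows "matrix_inv B = C"
proof -
  have "det C * det B = 1" using assms by (metis det_I det_mul)
  then have "det B \<noteq> 0" by auto
  note inv = matrix_inv_det_nz(1)[OF this]
  have "matrix_inv B = (C ** B) ** matrix_inv B" by (simp add: assms)
  also have "\<dots> = C" by (simp add: matrix_mul_assoc[symmetric] inv)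
  finally show ?thesis .
qed

lemma matrix_inv_scaled:
  fixes A :: "real ^ 'n ^ 'n::finite"
  assumes "c \<noteq> 0" "det A \<noteq> 0"
  shows "matrix_inv (\<chi> i j. c * A $ i $ j) = (\<chi> i j. inverse c * matrix_inv A $ i $ j)"
proof -
  let ?B = "\<chi> i j. c * A $ i $ j" and ?C = "\<chi> i j. inverse c * matrix_inv A $ i $ j"
  have c: "inverse c * p * (c * q) = p * q" for p q
    using assms(1) by simp
  have "?C ** ?B = matrix_inv A ** A"
    by (simp add: matrix_matrix_mult_def vec_eq_iff c)
  then show ?thesis using matrix_inv_det_nz[OF assms(2)] by (intro matrix_inv_unique) simp
qed

lemma metric_inner_conformal:
  fixes x :: "real ^ 'm::finite"
  shows "metric_inner (conformal_metric u) x v w = exp (2 * u ((norm x)\<^sup>2)) * (v \<bullet> w)"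
proof -
  have "mat c *v w = c *\<^sub>R w" for c :: real and w :: "real ^ 'm"
    by (simp add: vec_eq_iff mat_def matrix_vector_mult_def if_distrib[of "\<lambda>z. z * _"] cong: if_cong)
  then show ?thesis by (simp add: metric_inner_def conformal_metric_def)
qed

lemma christoffel_conformal:
  fixes x :: "real ^ 'm::finite"
  assumes d: "((\<lambda>z. u ((norm z)\<^sup>2)) has_derivative (\<lambda>v. 2 * p * (x \<bullet> v))) (at x)"
  shows "christoffel (conformal_metric u) x k a b
    = 2 * p * ((if b = k then x $ a else 0) + (if a = k then x $ b else 0) - (if a = b then x $ k else 0))"
proof -
  let ?E = "exp (2 * u ((norm x)\<^sup>2))"
  have pdg: "pd i (\<lambda>y. conformal_metric u y $ j $ l) x = (if j = l then ?E * (4 * p * x $ i) else 0)" for i j l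
  proof (cases "j = l")
    case True
    have "((\<lambda>z. exp (2 * u ((norm z)\<^sup>2))) has_derivative (\<lambda>v. (2 * (2 * p * (x \<bullet> v))) * ?E)) (at x)"
      using d by (auto intro!: derivative_eq_intros)
    from pd_eq[OF this, of i] show ?thesis using True
      by (simp add: conformal_metric_def mat_def inner_axis)
  next
    case False
    then show ?thesis by (simp add: conformal_metric_def mat_def pd_const)
  qed
  have inv: "matrix_inv (conformal_metric u x) = (mat (inverse ?E) :: real ^ 'm ^ 'm)"
  proof -
    have "conformal_metric u x = (\<chi> i j. ?E * (mat 1 :: real ^ 'm ^ 'm) $ i $ j)"
      by (simp add: conformal_metric_def mat_def vec_eq_iff)
    moreover have "matrix_inv (mat 1 :: real ^ 'm ^ 'm) = mat 1"
      using matrix_inv_det_nz(1)[of "mat 1 :: real ^ 'm ^ 'm"] by simp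
    ultimately have "matrix_inv (conformal_metric u x) = (\<chi> i j. inverse ?E * (mat 1 :: real ^ 'm ^ 'm) $ i $ j)"
      using matrix_inv_scaled[of ?E "mat 1 :: real ^ 'm ^ 'm"] by simp
    then show ?thesis by (simp add: mat_def vec_eq_iff)
  qed
  have "christoffel (conformal_metric u) x k a b
    = 1/2 * (\<Sum>l\<in>UNIV. (if k = l then inverse ?E * ((if b = l then ?E * (4 * p * x $ a) else 0)
       + (if a = l then ?E * (4 * p * x $ b) else 0) - (if a = b then ?E * (4 * p * x $ l) else 0)) else 0))"
    unfolding christoffel_def pdg inv by (intro arg_cong[where f = "\<lambda>z. 1/2 * z"] sum.cong refl) (simp add: mat_def)
  moreover have "inverse ?E * (?E * z) = z" for z by simp
  ultimately show ?thesis
    by (cases "a = b"; cases "a = k"; cases "b = k") (simp_all add: distrib_left right_diff_distrib)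
qed

text \<open>The difference between the Levi-Civita connection of the conformal metric and the flat
  one. It is governed by the gradient of the exponent u(|x|^2), which is 2 p x.\<close>

lemma christoffel_conformal_contract:
  fixes x v w :: "real ^ 'm::finite"
  assumes d: "((\<lambda>z. u ((norm z)\<^sup>2)) has_derivative (\<lambda>v. 2 * p * (x \<bullet> v))) (at x)"
  shows "(\<chi> k. \<Sum>a\<in>UNIV. \<Sum>b\<in>UNIV. christoffel (conformal_metric u) x k a b * v $ a * w $ b)
    = (2 * p) *\<^sub>R ((x \<bullet> v) *\<^sub>R w + (x \<bullet> w) *\<^sub>R v - (v \<bullet> w) *\<^sub>R x)"
proof -
  have "(\<Sum>a\<in>UNIV. \<Sum>b\<in>UNIV. christoffel (conformal_metric u) x k a b * v $ a * w $ b)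
    = 2 * p * ((x \<bullet> v) * w $ k + (x \<bullet> w) * v $ k - (v \<bullet> w) * x $ k)" for k
  proof -
    have "christoffel (conformal_metric u) x k a b * v $ a * w $ b
      = (if b = k then 2 * p * (x $ a * v $ a * w $ k) else 0)
        + (if a = k then 2 * p * (x $ b * w $ b * v $ k) else 0)
        - (if a = b then 2 * p * (v $ a * w $ a * x $ k) else 0)" for a b
      by (simp add: christoffel_conformal[OF d] algebra_simps)
    then have "(\<Sum>a\<in>UNIV. \<Sum>b\<in>UNIV. christoffel (conformal_metric u) x k a b * v $ a * w $ b)
      = (\<Sum>a\<in>UNIV. 2 * p * (x $ a * v $ a * w $ k))
        + (\<Sum>a\<in>UNIV. \<Sum>b\<in>UNIV. (if a = k then 2 * p * (x $ b * w $ b * v $ k) else 0))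
        - (\<Sum>a\<in>UNIV. 2 * p * (v $ a * w $ a * x $ k))"
      by (simp add: sum.distrib sum_subtractf)
    also have "(\<Sum>a\<in>UNIV. \<Sum>b\<in>UNIV. (if a = k then 2 * p * (x $ b * w $ b * v $ k) else 0))
      = (\<Sum>b\<in>UNIV. 2 * p * (x $ b * w $ b * v $ k))"
      by (subst sum.swap) simp
    finally show ?thesis
      by (simp add: inner_vec_def sum_distrib_left sum_distrib_right algebra_simps)
  qed
  then show ?thesis by (simp add: vec_eq_iff)
qed

text \<open>Couples the data of the definitions, a map \<open>F\<close> on a chart image
  \<open>S\<close>, with an extension \<open>G\<close> to an open set, where the calculus takes
  place.\<close>

locale chart_patch = patch_normal U G \<nu>
  for U :: "(real ^ 'n::finite) set" and G :: "real ^ 'n \<Rightarrow> real ^ 'm::finite" and \<nu> +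
  fixes S :: "(real ^ 'n) set" and F :: "real ^ 'n \<Rightarrow> real ^ 'm"
  assumes S: "openin (top_of_set half_space) S"
    and FG: "\<And>y. y \<in> S \<inter> U \<Longrightarrow> F y = G y"
begin

lemma partial_F: "y \<in> S \<inter> U \<Longrightarrow> partial S i F y = pd i G y"
  by (rule partial_extension[OF S op _ _ FG]) (auto simp: dG)

lemma partial2_F: "y \<in> S \<inter> U \<Longrightarrow> partial S i (partial S j F) y = pd i (pd j G) y"
  by (rule partial_extension[OF S op _ _ partial_F]) (auto simp: dpd)

context
  fixes u up :: "real \<Rightarrow> real" and y :: "real ^ 'n"
  assumes y: "y \<in> S \<inter> U"
    and d: "((\<lambda>z. u ((norm z)\<^sup>2)) has_derivative (\<lambda>v. 2 * up (G y \<bullet> G y) * (G y \<bullet> v))) (at (G y))"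
begin

lemma induced_metric_eq:
  "induced_metric (conformal_metric u) S F y = (\<chi> i j. exp (2 * u (G y \<bullet> G y)) * gram G y $ i $ j)"
  using y by (simp add: induced_metric_def metric_inner_conformal partial_F FG gram_def vec_eq_iff dot_square_norm)

lemma induced_metric_inv:
  "matrix_inv (induced_metric (conformal_metric u) S F y) $ i $ j = exp (- 2 * u (G y \<bullet> G y)) * ginv y $ i $ j"
proof -
  have dg: "det (gram G y) \<noteq> 0" using gram_det y by blast
  show ?thesis
    unfolding induced_metric_eq matrix_inv_scaled[OF exp_not_eq_zero dg]
    by (simp add: ginv_def exp_minus)
qed

text \<open>The tangential projection is the same for both metrics, since the conformal factors
  cancel. Among the correction terms of the connection only the multiple of the position vector has
  a normal part; this is how \<open>W\<close> enters \<open>bmat\<close>.\<close>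

lemma second_fund_form_eq:
  "second_fund_form (conformal_metric u) S F y i j = bmat up y $ i $ j *\<^sub>R \<nu> y"
proof -
  let ?A = "ambient_deriv (conformal_metric u) S F y i j" and ?E = "exp (2 * u (G y \<bullet> G y))"
  have yU: "y \<in> U" using y by simp
  have A: "?A = pd i (pd j G) y + (2 * up (G y \<bullet> G y)) *\<^sub>R ((G y \<bullet> pd i G y) *\<^sub>R pd j G y
      + (G y \<bullet> pd j G y) *\<^sub>R pd i G y - (pd i G y \<bullet> pd j G y) *\<^sub>R G y)"
    using y christoffel_conformal_contract[OF d]
    by (simp add: ambient_deriv_def partial_F partial2_F FG)
  have An: "?A \<bullet> \<nu> y = bmat up y $ i $ j"
    unfolding A by (simp add: inner_add_left inner_diff_left normal'[OF yU] bmat_def h_def W_def gram_def)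
  have "second_fund_form (conformal_metric u) S F y i j
    = ?A - (\<Sum>k\<in>UNIV. \<Sum>l\<in>UNIV. (ginv y $ k $ l * (?A \<bullet> pd k G y)) *\<^sub>R pd l G y)"
  proof -
    have cancel: "inverse ?E * a * (?E * b) = a * b" for a b by simp
    show ?thesis
      using y by (simp add: cancel second_fund_form_def induced_metric_inv metric_inner_conformal FG partial_F
        dot_square_norm[symmetric] exp_minus)
  qed
  also have "\<dots> = (?A \<bullet> \<nu> y) *\<^sub>R \<nu> y"
    using decompose[OF yU unit[OF yU] normal[OF yU], of ?A] by (simp add: algebra_simps)
  finally show ?thesis by (simp add: An)
qed

lemma mean_curvature_eq_0:
  assumes "mean_curvature_vector (conformal_metric u) S F y = 0"
  shows "(\<Sum>i\<in>UNIV. \<Sum>j\<in>UNIV. ginv y $ i $ j * bmat up y $ i $ j) = 0"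
proof -
  have "mean_curvature_vector (conformal_metric u) S F y
    = (exp (- 2 * u (G y \<bullet> G y)) * (\<Sum>i\<in>UNIV. \<Sum>j\<in>UNIV. ginv y $ i $ j * bmat up y $ i $ j)) *\<^sub>R \<nu> y"
    by (simp add: mean_curvature_vector_def induced_metric_inv second_fund_form_eq sum_distrib_left
        scaleR_sum_left mult.assoc)
  moreover have "\<nu> y \<noteq> 0" using unit y by fastforce
  ultimately show ?thesis using assms by simp
qed

text \<open>Two inverse metrics contribute the factor e^(-4u), and the conformal length of the
  Euclidean normal contributes e^(2u).\<close>

lemma sff_norm_sq_eq:
  "sff_norm_sq (conformal_metric u) S F y = inverse ((exp (u (G y \<bullet> G y)))\<^sup>2) *
    (\<Sum>i\<in>UNIV. \<Sum>j\<in>UNIV. \<Sum>k\<in>UNIV. \<Sum>l\<in>UNIV. ginv y $ i $ k * ginv y $ j $ l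
        * (bmat up y $ i $ j * bmat up y $ k $ l))"
proof -
  let ?E = "exp (u (G y \<bullet> G y))"
  have nn: "\<nu> y \<bullet> \<nu> y = 1" using unit y by (simp add: dot_square_norm)
  have e: "exp (- 2 * u (G y \<bullet> G y)) = inverse (?E\<^sup>2)" "exp (2 * u (G y \<bullet> G y)) = ?E\<^sup>2"
    by (simp_all add: exp_minus exp_double)
  have "inverse (?E\<^sup>2) * a * (inverse (?E\<^sup>2) * b) * (?E\<^sup>2 * c) = inverse (?E\<^sup>2) * (a * b * c)" for a b c
    by simp
  then show ?thesis
    unfolding sff_norm_sq_def Let_def induced_metric_inv second_fund_form_eq metric_inner_conformal
    using y by (simp only: e FG dot_square_norm[symmetric] inner_scaleR_left inner_scaleR_right nn sum_distrib_left mult_1_right)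
      (simp add: mult_ac)
qed

end

end

section \<open>The radial weight\<close>

locale radial =
  fixes R :: ereal and u u' u'' :: "real \<Rightarrow> real" and D :: "real set"
  assumes D_eq: "D = {t. 0 \<le> t \<and> ereal t < R\<^sup>2}"
    and Rpos: "0 < R"
    and u': "\<And>t. t \<in> D \<Longrightarrow> (u has_real_derivative u' t) (at t within D)"
    and u'': "\<And>t. t \<in> D \<Longrightarrow> (u' has_real_derivative u'' t) (at t within D)"
    and ii: "\<And>t. t \<in> D \<Longrightarrow> - u'' t * t - u' t \<le> 0"
begin

lemma D_down: "t \<in> D \<Longrightarrow> 0 \<le> s \<Longrightarrow> s \<le> t \<Longrightarrow> s \<in> D"
  unfolding D_eq by (auto intro: le_less_trans[of "ereal s" "ereal t"])

lemma square_in_D: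
  assumes "0 < r" "ereal r < R"
  shows "r\<^sup>2 \<in> D"
proof (cases R)
  case (real R')
  then have "r * r < R' * R'" using assms by (intro mult_strict_mono) auto
  then show ?thesis using real by (simp add: D_eq power2_eq_square)
next
  case PInf
  then show ?thesis by (simp add: D_eq power2_eq_square)
next
  case MInf
  then show ?thesis using assms by simp
qed

lemma D_pos_open: "open {t. 0 < t \<and> t \<in> D}"
proof -
  have "{t. 0 < t \<and> t \<in> D} = {0<..} \<inter> {t. ereal t < R\<^sup>2}" by (auto simp: D_eq)
  moreover have "open {t. ereal t < R\<^sup>2}" by (intro open_Collect_less continuous_intros)
  ultimately show ?thesis by (simp add: open_Int)
qed

lemma at_D:
  assumes "t \<in> D" "0 < t"
  shows "at t within D = at t"
  by (rule at_within_open_subset[OF _ D_pos_open]) (use assms in auto)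

lemma u'_at: "t \<in> D \<Longrightarrow> 0 < t \<Longrightarrow> (u has_real_derivative u' t) (at t)"
  using u' at_D by metis

lemma u''_at: "t \<in> D \<Longrightarrow> 0 < t \<Longrightarrow> (u' has_real_derivative u'' t) (at t)"
  using u'' at_D by metis

lemma cont_u: "continuous_on D u"
  by (meson DERIV_continuous_on u')

lemma cont_u': "continuous_on D u'"
  by (meson DERIV_continuous_on u'')

text \<open>At \<open>x = 0\<close> the derivative of \<open>u\<close> is only known one-sidedly.
  Near \<open>x\<close> the squared norm takes its values in \<open>D\<close>, so the chain rule
  within sets still applies.\<close>

lemma has_derivative_u_norm:
  fixes x :: "'a::euclidean_space"
  assumes "x \<bullet> x \<in> D"
  shows "((\<lambda>z. u ((norm z)\<^sup>2)) has_derivative (\<lambda>v. 2 * u' (x \<bullet> x) * (x \<bullet> v))) (at x)"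
proof -
  let ?S = "{z::'a. z \<bullet> z \<in> D}"
  have "?S = {z. ereal (z \<bullet> z) < R\<^sup>2}" by (auto simp: D_eq)
  moreover have "open {z::'a. ereal (z \<bullet> z) < R\<^sup>2}" by (intro open_Collect_less continuous_intros)
  ultimately have op: "open ?S" by simp
  have d1: "((\<lambda>z. z \<bullet> z) has_derivative (\<lambda>v. 2 * (x \<bullet> v))) (at x within ?S)"
    by (auto intro!: derivative_eq_intros simp: inner_commute)
  have d2: "(u has_derivative (*) (u' (x \<bullet> x))) (at (x \<bullet> x) within (\<lambda>z. z \<bullet> z) ` ?S)"
    by (rule has_derivative_subset[OF u'[OF assms, unfolded has_field_derivative_def]]) auto
  have "((\<lambda>z. u (z \<bullet> z)) has_derivative (\<lambda>v. u' (x \<bullet> x) * (2 * (x \<bullet> v)))) (at x within ?S)"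
    by (rule has_derivative_in_compose[OF d1 d2])
  then have "((\<lambda>z. u (z \<bullet> z)) has_derivative (\<lambda>v. u' (x \<bullet> x) * (2 * (x \<bullet> v)))) (at x)"
    using op assms at_within_open[of x ?S] by simp
  then show ?thesis by (simp add: dot_square_norm mult_ac)
qed

text \<open>The conformal length of a radial segment. In this form it can be differentiated in
  \<open>r\<close>; \<open>s_eq\<close> identifies it with the normalized integral of the
  theorem.\<close>

definition s :: "real \<Rightarrow> real" where
  "s r = integral {0..r} (\<lambda>\<rho>. exp (u (\<rho>\<^sup>2)))"

lemma sq_D: "r\<^sup>2 \<in> D \<Longrightarrow> 0 \<le> \<rho> \<Longrightarrow> \<rho> \<le> r \<Longrightarrow> \<rho>\<^sup>2 \<in> D"
  by (rule D_down[of "r\<^sup>2"]) (auto intro: power_mono)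

lemma cont_exp_u: "r\<^sup>2 \<in> D \<Longrightarrow> continuous_on {0..r} (\<lambda>\<rho>. exp (u (\<rho>\<^sup>2)))"
  by (intro continuous_on_exp continuous_on_compose2[OF cont_u] continuous_intros) (use sq_D in auto)

lemma cont_s: "r\<^sup>2 \<in> D \<Longrightarrow> continuous_on {0..r} s"
  unfolding s_def[abs_def]
  by (intro indefinite_integral_continuous_1 integrable_continuous_real cont_exp_u)

lemma DERIV_s:
  assumes r: "0 < r" "r\<^sup>2 \<in> D"
  shows "(s has_real_derivative exp (u (r\<^sup>2))) (at r)"
proof -
  have "open {\<rho>::real. 0 < \<rho>\<^sup>2 \<and> \<rho>\<^sup>2 \<in> D}"
    using open_vimage[OF D_pos_open, of "\<lambda>\<rho>. \<rho>\<^sup>2"] by (simp add: vimage_def continuous_intros)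
  moreover have "r \<in> {\<rho>. 0 < \<rho>\<^sup>2 \<and> \<rho>\<^sup>2 \<in> D}" using r by simp
  ultimately obtain e where e: "e > 0" "cball r e \<subseteq> {\<rho>. 0 < \<rho>\<^sup>2 \<and> \<rho>\<^sup>2 \<in> D}"
    using open_contains_cball by blast
  have b: "(r + e)\<^sup>2 \<in> D" using e by (auto simp: subset_iff dist_real_def)
  have "(s has_real_derivative exp (u (r\<^sup>2))) (at r within {0..r+e})"
    unfolding s_def[abs_def] by (rule integral_has_real_derivative[OF cont_exp_u[OF b]]) (use r e in auto)
  then show ?thesis
    using at_within_interior[of r "{0..r+e}"] r e by (simp add: interior_atLeastAtMost_real)
qed

lemma s_nonneg: "r\<^sup>2 \<in> D \<Longrightarrow> 0 \<le> s r"
  unfolding s_def by (intro integral_nonneg integrable_continuous_real cont_exp_u) auto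

lemma s_mono: "b\<^sup>2 \<in> D \<Longrightarrow> a \<le> b \<Longrightarrow> 0 \<le> a \<Longrightarrow> s a \<le> s b"
  unfolding s_def
  by (intro integral_subset_le integrable_continuous_real cont_exp_u) (auto intro: D_down power_mono)

text \<open>With \<open>h = r e\<^sup>u\<close> as a function of the distance \<open>s\<close>, this is \<open>h \<le> s h'\<close>, the convexity of \<open>h\<close>
  given by (ii).\<close>

lemma radial_convexity:
  assumes r: "0 < r" "r\<^sup>2 \<in> D"
  shows "r * exp (u (r\<^sup>2)) \<le> s r * (1 + 2 * r\<^sup>2 * u' (r\<^sup>2))"
proof -
  define k where "k \<rho> = s \<rho> * (1 + 2 * \<rho>\<^sup>2 * u' (\<rho>\<^sup>2)) - \<rho> * exp (u (\<rho>\<^sup>2))" for \<rho>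
  have "k 0 \<le> k r"
  proof (rule DERIV_nonneg_imp_increasing_open[of 0 r])
    show "0 \<le> r" using r by simp
    have "continuous_on {0..r} (\<lambda>\<rho>. u' (\<rho>\<^sup>2))"
      by (intro continuous_on_compose2[OF cont_u'] continuous_intros) (use sq_D[OF r(2)] in auto)
    then show "continuous_on {0..r} k"
      unfolding k_def[abs_def] by (intro continuous_intros cont_s cont_exp_u r)
    fix \<rho> assume \<rho>: "0 < \<rho>" "\<rho> < r"
    then have D: "\<rho>\<^sup>2 \<in> D" "0 < \<rho>\<^sup>2" using sq_D[OF r(2)] by auto
    have sq: "((\<lambda>\<rho>. \<rho>\<^sup>2) has_real_derivative 2 * \<rho>) (at \<rho>)"
      by (auto intro!: derivative_eq_intros)
    note du = DERIV_chain2[OF u'_at[OF D] sq] and du' = DERIV_chain2[OF u''_at[OF D] sq]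
    \<comment> \<open>The terms containing the exponential without \<open>s\<close> cancel, and what
      is left is the expression of condition (ii) with a nonnegative factor.\<close>
    have "(k has_real_derivative s \<rho> * (4 * \<rho> * (u' (\<rho>\<^sup>2) + u'' (\<rho>\<^sup>2) * \<rho>\<^sup>2))) (at \<rho>)"
      unfolding k_def[abs_def]
      by (rule derivative_eq_intros DERIV_s[OF \<rho>(1) D(1)] du du' refl)+
         (simp add: algebra_simps power2_eq_square)
    moreover have "0 \<le> s \<rho> * (4 * \<rho> * (u' (\<rho>\<^sup>2) + u'' (\<rho>\<^sup>2) * \<rho>\<^sup>2))"
      using ii[OF D(1)] s_nonneg[OF D(1)] \<rho> by simp
    ultimately show "\<exists>y. (k has_real_derivative y) (at \<rho>) \<and> 0 \<le> y" by blast
  qed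
  moreover have "k 0 = 0" by (simp add: k_def s_def)
  ultimately show ?thesis by (simp add: k_def)
qed

text \<open>If the length vanished, the convexity inequality would force
  \<open>r * exp (u (r\<^sup>2)) \<le> 0\<close>.\<close>

lemma s_pos:
  assumes "0 < r" "r\<^sup>2 \<in> D"
  shows "0 < s r"
proof -
  have "s r \<noteq> 0" using radial_convexity[OF assms] assms(1) by (auto simp: mult_le_0_iff)
  then show ?thesis using s_nonneg[OF assms(2)] by simp
qed

lemma s_eq:
  assumes r: "0 < r" "r\<^sup>2 \<in> D"
  shows "s r = r * integral {0..1} (\<lambda>t. exp (u (t\<^sup>2 * r\<^sup>2)))"
proof -
  have "((\<lambda>\<rho>. exp (u (\<rho>\<^sup>2))) has_integral s r) {0..r}"
    unfolding s_def by (intro integrable_integral integrable_continuous_real cont_exp_u r)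
  from has_integral_stretch_real[OF this, of r]
  have "((\<lambda>x. exp (u ((r * x)\<^sup>2))) has_integral s r / r) ((\<lambda>x. x / r) ` {0..r})"
    using r by simp
  moreover have "(\<lambda>x. x / r) ` {0..r} = {0..1}"
    using r by (auto simp: image_iff field_simps intro!: bexI[of _ "r * _"])
  ultimately have "integral {0..1} (\<lambda>x. exp (u ((r * x)\<^sup>2))) = s r / r"
    by (simp add: integral_unique)
  then show ?thesis using r by (simp add: power_mult_distrib mult.commute)
qed

text \<open>The variable is t = |x|^2, as for \<open>u\<close>. Because of the square root the
  derivatives are claimed for \<open>0 < t\<close> only; this covers all points with nonzero support
  function, as the position vector is nonzero there.\<close>

definition \<omega> where "\<omega> c t = c / 2 * (s (sqrt t))\<^sup>2"
definition \<omega>1 where "\<omega>1 c t = c * s (sqrt t) * exp (u t) / (2 * sqrt t)"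

lemma DERIV_s_sqrt:
  assumes t: "t \<in> D" "0 < t"
  shows "((\<lambda>t. s (sqrt t)) has_real_derivative exp (u t) / (2 * sqrt t)) (at t)"
proof -
  have "(s has_real_derivative exp (u ((sqrt t)\<^sup>2))) (at (sqrt t))"
    by (rule DERIV_s) (use t in auto)
  from DERIV_chain2[OF this DERIV_real_sqrt[OF t(2)]] show ?thesis
    using t by (simp add: field_simps)
qed

lemma DERIV_\<omega>:
  assumes t: "t \<in> D" "0 < t"
  shows "(\<omega> c has_real_derivative \<omega>1 c t) (at t)"
  unfolding \<omega>_def[abs_def] \<omega>1_def
  by (rule derivative_eq_intros DERIV_s_sqrt[OF t] refl)+ (simp add: field_simps power2_eq_square)

lemma DERIV_\<omega>1:
  assumes t: "t \<in> D" "0 < t"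
  shows "(\<omega>1 c has_real_derivative c * (exp (u t))\<^sup>2 / (4 * t) + \<omega>1 c t * (u' t - 1 / (2 * t))) (at t)"
proof -
  have st: "sqrt t * sqrt t = t" "sqrt t > 0" using t by auto
  have N: "((\<lambda>t. c * s (sqrt t) * exp (u t)) has_real_derivative
      c * (exp (u t) / (2 * sqrt t)) * exp (u t) + c * s (sqrt t) * (exp (u t) * u' t)) (at t)"
    by (rule derivative_eq_intros DERIV_s_sqrt[OF t] u'_at[OF t] refl)+ (simp add: algebra_simps)
  have M: "((\<lambda>t. 2 * sqrt t) has_real_derivative inverse (sqrt t)) (at t)"
    by (rule DERIV_cong[OF DERIV_cmult[OF DERIV_real_sqrt[OF t(2)]]]) simp
  have nz: "2 * sqrt t \<noteq> 0" using st by simp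
  note DERIV_divide[OF N M nz]
  moreover have "((c * (exp (u t) / (2 * sqrt t)) * exp (u t) + c * s (sqrt t) * (exp (u t) * u' t)) * (2 * sqrt t)
      - c * s (sqrt t) * exp (u t) * inverse (sqrt t)) / (2 * sqrt t * (2 * sqrt t))
    = c * (exp (u t))\<^sup>2 / (4 * (sqrt t * sqrt t)) + \<omega>1 c t * (u' t - 1 / (2 * (sqrt t * sqrt t)))"
    unfolding \<omega>1_def using st(2) by (simp add: divide_simps power2_eq_square del: real_sqrt_mult_self) (simp add: algebra_simps del: real_sqrt_mult_self)
  ultimately show ?thesis unfolding \<omega>1_def[abs_def] by (simp only: st)
qed

lemma cont_\<omega>:
  assumes "r\<^sup>2 \<in> D" "0 \<le> r"
  shows "continuous_on {0..r\<^sup>2} (\<omega> c)"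
proof -
  have "continuous_on {0..r\<^sup>2} (\<lambda>t. s (sqrt t))"
    by (rule continuous_on_compose2[OF cont_s[OF assms(1)]])
       (use assms(2) in \<open>auto intro!: continuous_intros real_le_lsqrt\<close>)
  then show ?thesis unfolding \<omega>_def[abs_def] by (intro continuous_intros)
qed

end

section \<open>Immersed hypersurfaces of a ball\<close>

lemma smooth_onE:
  assumes "smooth_on S f" "x \<in> S"
  obtains U g where "open U" "x \<in> U" "\<And>k. Ck_on k U g" "\<And>y. y \<in> S \<inter> U \<Longrightarrow> g y = f y"
  using assms unfolding smooth_on_def by metis

lemma openin_topE:
  assumes "openin (top_of_set S) A"
  obtains T where "open T" "A = S \<inter> T"
  using assms unfolding openin_open by metis

lemma (in patch) subpatch:
  assumes "open V" "V \<subseteq> U"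
  shows "patch V G"
  by unfold_locales (use assms card inj Ck_on_subset[OF C] in auto)

lemma (in patch_normal) subpatch_normal:
  assumes "open V" "V \<subseteq> U"
  shows "patch_normal V G \<nu>"
  using subpatch[OF assms] assms(2) unit normal d_normal
  by (auto simp: patch_normal_def patch_normal_axioms_def)

lemma (in patch_normal) patch_normal_neg: "patch_normal U G (\<lambda>y. - \<nu> y)"
  using patch_axioms unit normal d_normal
  by (auto simp: patch_normal_def patch_normal_axioms_def intro: differentiable_minus)

lemma (in chart_patch) restrict:
  assumes "open V" "V \<subseteq> U"
  shows "chart_patch V G \<nu> S F"
  using subpatch_normal[OF assms] S FG assms(2)
  by (auto simp: chart_patch_def chart_patch_axioms_def)

lemma (in chart_patch) negate: "chart_patch U G (\<lambda>y. - \<nu> y) S F"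
  using patch_normal_neg S FG by (auto simp: chart_patch_def chart_patch_axioms_def)

text \<open>The free boundary condition is put in Euclidean form: both metrics have the same
  normals, and the sphere has normal \<open>f p\<close> at \<open>f p\<close>, so every normal of
  the hypersurface is orthogonal to the position vector.\<close>

locale immersed_in_ball =
  fixes M :: "'p topology" and \<A> :: "('p set \<times> ('p \<Rightarrow> real ^ 'n::finite)) set"
    and f :: "'p \<Rightarrow> real ^ 'm::finite" and r0 :: real
  assumes hyp: "immersed_hypersurface M \<A> f" and comp: "compact_space M"
    and ball: "f ` topspace M \<subseteq> cball 0 r0" and r0: "0 < r0"
    and bd_sphere: "\<And>p. p \<in> manifold_boundary \<A> \<Longrightarrow> norm (f p) = r0"
    and bd_orth: "\<And>U \<phi> p \<nu>. (U, \<phi>) \<in> \<A> \<Longrightarrow> p \<in> U \<Longrightarrow> p \<in> manifold_boundary \<A> \<Longrightarrow>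
      (\<And>v. \<nu> \<bullet> frechet_derivative (in_chart f U \<phi>) (at (\<phi> p) within \<phi> ` U) v = 0) \<Longrightarrow> \<nu> \<bullet> f p = 0"
begin

lemma card: "CARD('m) = CARD('n) + 1"
  using hyp by (simp add: immersed_hypersurface_def)

lemma Hausdorff: "Hausdorff_space M"
  using hyp by (simp add: immersed_hypersurface_def smooth_manifold_with_boundary_def)

lemma atlas: "smooth_atlas M \<A>"
  using hyp by (simp add: immersed_hypersurface_def smooth_manifold_with_boundary_def)

lemma chart_open: "(U, \<phi>) \<in> \<A> \<Longrightarrow> openin M U"
  and chart_image: "(U, \<phi>) \<in> \<A> \<Longrightarrow> openin (top_of_set half_space) (\<phi> ` U)"
  and chart_homeo: "(U, \<phi>) \<in> \<A> \<Longrightarrow> homeomorphic_map (subtopology M U) (top_of_set (\<phi> ` U)) \<phi>"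
  and chart_transition: "(U, \<phi>) \<in> \<A> \<Longrightarrow> (V, \<psi>) \<in> \<A> \<Longrightarrow> smooth_on (\<phi> ` (U \<inter> V)) (\<psi> \<circ> inv_into U \<phi>)"
  and chart_cover: "p \<in> topspace M \<Longrightarrow> \<exists>U \<phi>. (U, \<phi>) \<in> \<A> \<and> p \<in> U"
  using atlas unfolding smooth_atlas_def by fast+

lemma chart_subset: "(U, \<phi>) \<in> \<A> \<Longrightarrow> U \<subseteq> topspace M"
  using chart_open openin_subset by blast

lemma chart_inj: "(U, \<phi>) \<in> \<A> \<Longrightarrow> inj_on \<phi> U"
  using homeomorphic_imp_injective_map[OF chart_homeo] chart_subset
  by (metis Int_absorb1 topspace_subtopology)

lemma in_chart_eq: "(U, \<phi>) \<in> \<A> \<Longrightarrow> q \<in> U \<Longrightarrow> in_chart f U \<phi> (\<phi> q) = f q"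
  using chart_inj by (simp add: inv_into_f_f)

lemma norm_f_le: "p \<in> topspace M \<Longrightarrow> norm (f p) \<le> r0"
  using ball by auto

lemma boundaryI: "(U, \<phi>) \<in> \<A> \<Longrightarrow> p \<in> U \<Longrightarrow> \<phi> p $ bdry_coord = 0 \<Longrightarrow> p \<in> manifold_boundary \<A>"
  by (auto simp: manifold_boundary_def)

lemma chart_nbhd_open:
  assumes c: "(U, \<phi>) \<in> \<A>" and V: "open V"
  shows "openin M {q \<in> U. \<phi> q \<in> V}"
proof -
  have "continuous_map (subtopology M U) euclidean \<phi>"
    using homeomorphic_imp_continuous_map[OF chart_homeo[OF c]] by (simp add: continuous_map_in_subtopology)
  then have "openin (subtopology M U) {q \<in> topspace (subtopology M U). \<phi> q \<in> V}"
    by (rule openin_continuous_map_preimage) (use V in auto)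
  moreover have "{q \<in> topspace (subtopology M U). \<phi> q \<in> V} = {q \<in> U. \<phi> q \<in> V}" using chart_subset[OF c] by auto
  ultimately show ?thesis using openin_trans_full[OF _ chart_open[OF c]] by metis
qed

text \<open>The parametrization is extended beyond the chart image and cut down to where the Gram
  determinant is nonzero. The last inclusion ensures that every half-space point of \<open>V\<close>
  comes from a point of the hypersurface.\<close>

lemma chart_patch_exists:
  assumes c: "(U, \<phi>) \<in> \<A>" and p: "p \<in> U"
  shows "\<exists>V G \<nu>. chart_patch V G \<nu> (\<phi> ` U) (in_chart f U \<phi>) \<and> \<phi> p \<in> V \<and> half_space \<inter> V \<subseteq> \<phi> ` U"
proof -
  let ?F = "in_chart f U \<phi>" and ?S = "\<phi> ` U"
  have imm: "smooth_on ?S ?F" "\<And>x. x \<in> ?S \<Longrightarrow> inj (frechet_derivative ?F (at x within ?S))"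
    using hyp c unfolding immersed_hypersurface_def smooth_immersion_def by fast+
  obtain T where T: "open T" "?S = half_space \<inter> T" by (rule openin_topE[OF chart_image[OF c]])
  obtain B G where B: "open B" "\<phi> p \<in> B" "\<And>k. Ck_on k B G" "\<And>y. y \<in> ?S \<inter> B \<Longrightarrow> G y = ?F y"
    by (rule smooth_onE[OF imm(1) imageI[OF p]]) blast
  have lin: "linear (frechet_derivative G (at y))" if "y \<in> B" for y
    using Ck_on_has_derivative[OF B(3) that] has_derivative_linear by blast
  define O' where "O' = B \<inter> T \<inter> (B \<inter> (\<lambda>y. det (gram G y)) -` (- {0}))"
  have "Ck_on k B (\<lambda>y. gram G y $ i $ j)" for k i j
    unfolding gram_def vec_lambda_beta by (rule Ck_on_inner[OF B(1) Ck_on_pd[OF B(3)] Ck_on_pd[OF B(3)]])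
  from Ck_on_imp_continuous[OF Ck_on_det[OF B(1) this]]
  have "continuous_on B (\<lambda>y. det (gram G y))" .
  from continuous_open_preimage[OF this B(1), of "- {0}"]
  have "open (B \<inter> (\<lambda>y. det (gram G y)) -` (- {0}))" by blast
  from open_Int[OF open_Int[OF B(1) T(1)] this] have O': "open O'" unfolding O'_def .
  have "frechet_derivative ?F (at (\<phi> p) within ?S) = frechet_derivative G (at (\<phi> p))"
    by (rule frechet_derivative_extension(2)[OF chart_image[OF c] B(1) _ B(2)])
       (use p B in \<open>auto intro: Ck_on_differentiable\<close>)
  then have pO: "\<phi> p \<in> O'"
    using gram_det_nz_iff_inj[OF lin[OF B(2)]] imm(2)[of "\<phi> p"] p B(2) T by (auto simp: O'_def)
  interpret P: patch O' G
    using card O' B(3) gram_det_nz_iff_inj[OF lin] by unfold_locales (auto simp: O'_def intro: Ck_on_subset)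
  obtain V \<nu> where V: "open V" "\<phi> p \<in> V" "V \<subseteq> O'"
    "\<And>y. y \<in> V \<Longrightarrow> norm (\<nu> y) = 1" "\<And>y i. y \<in> V \<Longrightarrow> \<nu> y \<bullet> pd i G y = 0"
    "\<And>y. y \<in> V \<Longrightarrow> \<nu> differentiable (at y)"
    using P.normal_field_exists[OF pO] by blast
  have "patch_normal V G \<nu>"
    using P.subpatch[OF V(1,3)] V by (auto simp: patch_normal_def patch_normal_axioms_def)
  then have "chart_patch V G \<nu> ?S ?F"
    using chart_image[OF c] B(4) V(3) by (auto simp: chart_patch_def chart_patch_axioms_def O'_def)
  moreover have "half_space \<inter> V \<subseteq> ?S" using T V(3) by (auto simp: O'_def)
  ultimately show ?thesis using V(2) by blast
qed

text \<open>The transition map factors one differential through the other. With the charts exchanged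
  this gives equality, so tangent spaces and normals do not depend on the chart.\<close>

lemma tangent_subset:
  assumes c: "(U, \<phi>) \<in> \<A>" and d: "(V, \<psi>) \<in> \<A>" and p: "p \<in> U" "p \<in> V"
  shows "range (frechet_derivative (in_chart f U \<phi>) (at (\<phi> p) within \<phi> ` U))
    \<subseteq> range (frechet_derivative (in_chart f V \<psi>) (at (\<psi> p) within \<psi> ` V))"
proof -
  obtain V' G \<nu> where P: "chart_patch V' G \<nu> (\<psi> ` V) (in_chart f V \<psi>)" "\<psi> p \<in> V'"
    using chart_patch_exists[OF d p(2)] by blast
  interpret P: chart_patch V' G \<nu> "\<psi> ` V" "in_chart f V \<psi>" by (rule P)
  have pUV: "\<phi> p \<in> \<phi> ` (U \<inter> V)" using p by blast
  obtain B g where B: "open B" "\<phi> p \<in> B" "\<And>k. Ck_on k B g"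
    "\<And>y. y \<in> \<phi> ` (U \<inter> V) \<inter> B \<Longrightarrow> g y = (\<psi> \<circ> inv_into U \<phi>) y"
    by (rule smooth_onE[OF chart_transition[OF c d] pUV]) blast
  have gp: "g (\<phi> p) = \<psi> p" using B(4)[of "\<phi> p"] B(2) p chart_inj[OF c] by (auto simp: inv_into_f_f)
  have "openin (subtopology M U) (U \<inter> V)"
    using chart_open[OF c] chart_open[OF d] by (simp add: openin_open_subtopology openin_Int)
  then have opn: "openin (top_of_set (\<phi> ` U)) (\<phi> ` (U \<inter> V))"
    using homeomorphic_map_openness[OF chart_homeo[OF c], of "U \<inter> V"] chart_subset[OF c] by auto
  obtain T where T: "open T" "\<phi> ` (U \<inter> V) = \<phi> ` U \<inter> T" by (rule openin_topE[OF opn])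
  define O' where "O' = B \<inter> T \<inter> (B \<inter> g -` V')"
  have O': "open O'"
    unfolding O'_def using B T continuous_open_preimage[OF Ck_on_imp_continuous[OF B(3)] B(1) P.op] by blast
  have pO: "\<phi> p \<in> O'" using B(2) T(2) p gp P(2) by (auto simp: O'_def)
  have gd: "(g has_derivative frechet_derivative g (at (\<phi> p))) (at (\<phi> p))"
    by (rule Ck_on_has_derivative[OF B(3,2)])
  have Gd: "(G has_derivative frechet_derivative G (at (\<psi> p))) (at (g (\<phi> p)))"
    using Ck_on_has_derivative[OF P.C P(2)] gp by simp
  note Gg = has_derivative_compose[OF gd Gd]
  have "frechet_derivative (in_chart f U \<phi>) (at (\<phi> p) within \<phi> ` U) = frechet_derivative (\<lambda>y. G (g y)) (at (\<phi> p))"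
  proof (rule frechet_derivative_extension(2)[OF chart_image[OF c] O' _ pO])
    show "(\<lambda>y. G (g y)) differentiable at (\<phi> p)" using Gg by (auto simp: differentiable_def)
    fix y assume y: "y \<in> \<phi> ` U \<inter> O'"
    then obtain q where q: "q \<in> U" "q \<in> V" "y = \<phi> q" using T(2) by (auto simp: O'_def)
    have "g y = \<psi> q" using B(4)[of y] q y chart_inj[OF c] by (auto simp: O'_def inv_into_f_f)
    moreover have "g y \<in> V'" using y by (auto simp: O'_def)
    ultimately have "G (g y) = in_chart f V \<psi> (\<psi> q)" using P.FG[of "\<psi> q"] q by auto
    then show "in_chart f U \<phi> y = G (g y)" using in_chart_eq[OF d q(2)] in_chart_eq[OF c q(1)] q by simp
  qed (use p in auto)
  also have "\<dots> = (\<lambda>v. frechet_derivative G (at (\<psi> p)) (frechet_derivative g (at (\<phi> p)) v))"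
    by (rule frechet_derivative_at[OF Gg, symmetric])
  finally have 1: "frechet_derivative (in_chart f U \<phi>) (at (\<phi> p) within \<phi> ` U) = \<dots>" .
  have "frechet_derivative (in_chart f V \<psi>) (at (\<psi> p) within \<psi> ` V) = frechet_derivative G (at (\<psi> p))"
    by (rule frechet_derivative_extension(2)[OF chart_image[OF d] P.op _ P(2) P.FG]) (use p P P.dG in auto)
  then show ?thesis using 1 by auto
qed

text \<open>Demanding orthogonality in every chart keeps the set free of choices;
  \<open>tangent_subset\<close> reduces membership to a single chart.\<close>

definition unit_normals :: "'p \<Rightarrow> (real ^ 'm) set" where
  "unit_normals p = {\<nu>. norm \<nu> = 1 \<and> (\<forall>(U, \<phi>)\<in>\<A>. p \<in> U \<longrightarrow>
     (\<forall>v. \<nu> \<bullet> frechet_derivative (in_chart f U \<phi>) (at (\<phi> p) within \<phi> ` U) v = 0))}"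

text \<open>The sign of \<open>N\<close> is arbitrary at each point (the hypersurface need not be orientable), so only even
  functions of \<open>N\<close> can be expected to be continuous.\<close>

definition N :: "'p \<Rightarrow> real ^ 'm" where
  "N p = (SOME \<nu>. \<nu> \<in> unit_normals p)"

lemma N_chart:
  assumes c: "(U, \<phi>) \<in> \<A>" and P: "chart_patch V G \<nu> (\<phi> ` U) (in_chart f U \<phi>)" and q: "q \<in> U" "\<phi> q \<in> V"
  shows "N q = \<nu> (\<phi> q) \<or> N q = - \<nu> (\<phi> q)"
proof -
  interpret P: chart_patch V G \<nu> "\<phi> ` U" "in_chart f U \<phi>" by (rule P)
  have D: "frechet_derivative (in_chart f U \<phi>) (at (\<phi> q) within \<phi> ` U) = frechet_derivative G (at (\<phi> q))"
    by (rule frechet_derivative_extension(2)[OF chart_image[OF c] P.op _ q(2) P.FG]) (use q P.dG in auto)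
  have "\<nu> (\<phi> q) \<in> unit_normals q"
    unfolding unit_normals_def
  proof (intro CollectI conjI ballI, goal_cases)
    case 1 show ?case by (rule P.unit[OF q(2)])
  next
    case (2 x)
    obtain V' \<psi> where x: "x = (V', \<psi>)" by (cases x)
    have "\<nu> (\<phi> q) \<bullet> frechet_derivative (in_chart f V' \<psi>) (at (\<psi> q) within \<psi> ` V') v = 0" if qV: "q \<in> V'" for v
    proof -
      obtain w where "frechet_derivative (in_chart f V' \<psi>) (at (\<psi> q) within \<psi> ` V') v = frechet_derivative G (at (\<phi> q)) w"
        using tangent_subset[OF _ c qV q(1), of \<psi>] 2 x unfolding D by blast
      then show ?thesis by (simp add: P.deriv_expand[OF q(2)] inner_sum_right P.normal[OF q(2)])
    qed
    then show ?case by (simp add: x)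
  qed
  then have "N q \<in> unit_normals q" unfolding N_def by (rule someI)
  then have "norm (N q) = 1" "\<And>v. N q \<bullet> frechet_derivative G (at (\<phi> q)) v = 0"
    using c q(1) D by (force simp: unit_normals_def)+
  then show ?thesis
    using P.unit_normal_unique[OF q(2) P.unit[OF q(2)] P.normal[OF q(2)]] by (auto simp: pd_frechet)
qed

lemma continuous_via_charts:
  fixes k :: "'p \<Rightarrow> 'c::topological_space"
  assumes "\<And>U \<phi> p. (U, \<phi>) \<in> \<A> \<Longrightarrow> p \<in> U \<Longrightarrow>
     \<exists>V K. open V \<and> \<phi> p \<in> V \<and> continuous_on (\<phi> ` U \<inter> V) K \<and> (\<forall>q\<in>U. \<phi> q \<in> V \<longrightarrow> k q = K (\<phi> q))"
  shows "continuous_map M euclidean k"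
  unfolding continuous_map_eq_topcontinuous_at topcontinuous_at_def
proof (intro ballI conjI allI impI)
  fix p W assume p: "p \<in> topspace M" and W: "openin euclidean W \<and> k p \<in> W"
  obtain U \<phi> where c: "(U, \<phi>) \<in> \<A>" "p \<in> U" using chart_cover[OF p] by blast
  obtain V K where V: "open V" "\<phi> p \<in> V" "continuous_on (\<phi> ` U \<inter> V) K"
    "\<And>q. q \<in> U \<Longrightarrow> \<phi> q \<in> V \<Longrightarrow> k q = K (\<phi> q)"
    using assms[OF c] by blast
  have "openin (top_of_set (\<phi> ` U \<inter> V)) (\<phi> ` U \<inter> V \<inter> K -` W)"
    by (rule continuous_openin_preimage_gen[OF V(3)]) (use W in auto)
  then obtain T where T: "open T" "\<phi> ` U \<inter> V \<inter> K -` W = \<phi> ` U \<inter> V \<inter> T"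
    by (rule openin_topE)
  show "\<exists>U. openin M U \<and> p \<in> U \<and> (\<forall>y\<in>U. k y \<in> W)"
  proof (intro exI conjI ballI)
    show "openin M {q \<in> U. \<phi> q \<in> V \<inter> T}" by (rule chart_nbhd_open[OF c(1)]) (use V T in auto)
    have "\<phi> p \<in> \<phi> ` U \<inter> V \<inter> K -` W" using c V W by auto
    then show "p \<in> {q \<in> U. \<phi> q \<in> V \<inter> T}" using c T by auto
    fix y assume "y \<in> {q \<in> U. \<phi> q \<in> V \<inter> T}"
    then have "\<phi> y \<in> \<phi> ` U \<inter> V \<inter> K -` W" "y \<in> U" "\<phi> y \<in> V" using T by auto
    then show "k y \<in> W" using V(4) by auto
  qed
qed auto

lemma continuous_f: "continuous_map M euclidean f"
proof (rule continuous_via_charts)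
  fix U \<phi> p assume c: "(U, \<phi>) \<in> \<A>" "p \<in> U"
  obtain V G \<nu> where P: "chart_patch V G \<nu> (\<phi> ` U) (in_chart f U \<phi>)" "\<phi> p \<in> V"
    using chart_patch_exists[OF c] by blast
  interpret P: chart_patch V G \<nu> "\<phi> ` U" "in_chart f U \<phi>" by (rule P)
  show "\<exists>V K. open V \<and> \<phi> p \<in> V \<and> continuous_on (\<phi> ` U \<inter> V) K \<and> (\<forall>q\<in>U. \<phi> q \<in> V \<longrightarrow> f q = K (\<phi> q))"
  proof (intro exI conjI ballI impI)
    show "continuous_on (\<phi> ` U \<inter> V) G"
      using Ck_on_imp_continuous[OF P.C] continuous_on_subset by blast
    show "f q = G (\<phi> q)" if "q \<in> U" "\<phi> q \<in> V" for q
      using P.FG[of "\<phi> q"] in_chart_eq[OF c(1) that(1)] that by auto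
  qed (use P P.op in auto)
qed

text \<open>In a chart the composite equals \<open>k\<close> evaluated at a smooth \<open>G\<close>
  and a continuous \<open>\<nu>\<close>, whichever sign was chosen for \<open>N\<close>.\<close>

lemma continuous_N_even:
  fixes k :: "real ^ 'm \<Rightarrow> real ^ 'm \<Rightarrow> real"
  assumes k: "\<And>x \<nu>. k x (- \<nu>) = k x \<nu>" and cont: "continuous_on (cball 0 r0 \<times> UNIV) (\<lambda>(x, \<nu>). k x \<nu>)"
  shows "continuous_map M euclidean (\<lambda>p. k (f p) (N p))"
proof (rule continuous_via_charts)
  fix U \<phi> p assume c: "(U, \<phi>) \<in> \<A>" "p \<in> U"
  obtain V G \<nu> where P: "chart_patch V G \<nu> (\<phi> ` U) (in_chart f U \<phi>)" "\<phi> p \<in> V"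
    using chart_patch_exists[OF c] by blast
  interpret P: chart_patch V G \<nu> "\<phi> ` U" "in_chart f U \<phi>" by (rule P)
  have fG: "f q = G (\<phi> q)" if "q \<in> U" "\<phi> q \<in> V" for q
    using P.FG[of "\<phi> q"] in_chart_eq[OF c(1) that(1)] that by auto
  show "\<exists>V K. open V \<and> \<phi> p \<in> V \<and> continuous_on (\<phi> ` U \<inter> V) K \<and> (\<forall>q\<in>U. \<phi> q \<in> V \<longrightarrow> k (f q) (N q) = K (\<phi> q))"
  proof (intro exI conjI ballI impI)
    have "continuous_on V \<nu>"
      by (intro continuous_at_imp_continuous_on ballI differentiable_imp_continuous_within P.d_normal)
    then have cc: "continuous_on (\<phi> ` U \<inter> V) (\<lambda>y. (G y, \<nu> y))"
      using Ck_on_imp_continuous[OF P.C] by (intro continuous_on_Pair) (auto intro: continuous_on_subset)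
    have "(\<lambda>y. (G y, \<nu> y)) ` (\<phi> ` U \<inter> V) \<subseteq> cball 0 r0 \<times> UNIV"
      using fG norm_f_le chart_subset[OF c(1)] by fastforce
    from continuous_on_compose2[OF cont cc this]
    show "continuous_on (\<phi> ` U \<inter> V) (\<lambda>y. k (G y) (\<nu> y))" by simp
    show "k (f q) (N q) = k (G (\<phi> q)) (\<nu> (\<phi> q))" if "q \<in> U" "\<phi> q \<in> V" for q
      using N_chart[OF c(1) P(1) that] k fG[OF that] by auto
  qed (use P P.op in auto)
qed

lemma attains_max:
  fixes k :: "'p \<Rightarrow> real"
  assumes "continuous_map M euclidean k" "topspace M \<noteq> {}"
  shows "\<exists>p\<in>topspace M. \<forall>q\<in>topspace M. k q \<le> k p"
proof -
  have "compactin M (topspace M)" using comp by (simp add: compact_space_def)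
  then have "compact (k ` topspace M)" using image_compactin[OF _ assms(1)] by auto
  then show ?thesis using compact_attains_sup[of "k ` topspace M"] assms(2) by auto
qed

lemma boundary_support_zero:
  assumes c: "(U, \<phi>) \<in> \<A>" "p \<in> U" and p: "p \<in> manifold_boundary \<A>"
  shows "f p \<bullet> N p = 0"
proof -
  obtain V G \<nu> where P: "chart_patch V G \<nu> (\<phi> ` U) (in_chart f U \<phi>)" "\<phi> p \<in> V"
    using chart_patch_exists[OF c] by blast
  interpret P: chart_patch V G \<nu> "\<phi> ` U" "in_chart f U \<phi>" by (rule P)
  have D: "frechet_derivative (in_chart f U \<phi>) (at (\<phi> p) within \<phi> ` U) = frechet_derivative G (at (\<phi> p))"
    by (rule frechet_derivative_extension(2)[OF chart_image[OF c(1)] P.op _ P(2) P.FG]) (use c P P.dG in auto)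
  have "\<nu> (\<phi> p) \<bullet> f p = 0"
    by (rule bd_orth[OF c p]) (simp add: D P.deriv_expand[OF P(2)] inner_sum_right P.normal[OF P(2)])
  then show ?thesis using N_chart[OF c(1) P(1) c(2) P(2)] by (auto simp: inner_commute)
qed

end

locale gap_hypersurface = immersed_in_ball M \<A> f r0 + radial R u u' u'' D
  for M :: "'p topology" and \<A> :: "('p set \<times> ('p \<Rightarrow> real ^ 'n::finite)) set"
    and f :: "'p \<Rightarrow> real ^ 'm::finite" and r0 :: real and R u u' u'' D +
  assumes i: "\<And>t. t \<in> D \<Longrightarrow> u'' t - (u' t)\<^sup>2 \<le> 0"
    and r0R: "ereal r0 < R" and nonempty: "topspace M \<noteq> {}"
    and minimal: "minimal_immersion (conformal_metric u) \<A> f"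
    and gap: "sff_norm_sq_le (conformal_metric u) \<A> f ((real CARD('n))\<^sup>2 / (4 * (s r0)\<^sup>2))"
begin

lemma r0D: "r0\<^sup>2 \<in> D"
  by (rule square_in_D[OF r0 r0R])

lemma inner_le: "norm (x :: real ^ 'm) \<le> r0 \<Longrightarrow> x \<bullet> x \<le> r0\<^sup>2"
  using power_mono[of "norm x" r0 2] by (simp add: dot_square_norm)

lemma inner_D: "norm (x :: real ^ 'm) \<le> r0 \<Longrightarrow> x \<bullet> x \<in> D"
  by (rule D_down[OF r0D _ inner_le]) auto

lemma support_zero:
  assumes p: "p \<in> topspace M"
  shows "f p \<bullet> N p = 0"
proof (rule ccontr)
  assume ne: "f p \<bullet> N p \<noteq> 0"
  define n where "n = real CARD('n)"
  define c where "c = n / (2 * (s r0)\<^sup>2)"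
  \<comment> \<open>The square of |W| e^(u + c s^2 / 2). It is even in the normal, hence continuous
    on the hypersurface, and unlike the logarithm it is defined where the support function is
    0.\<close>
  define k where "k x \<nu> = (x \<bullet> \<nu>)\<^sup>2 * exp (2 * (u (x \<bullet> x) + \<omega> c (x \<bullet> x)))" for x \<nu> :: "real ^ 'm"
  have "continuous_on (cball (0 :: real ^ 'm) r0 \<times> (UNIV :: (real ^ 'm) set)) (\<lambda>z. u (fst z \<bullet> fst z))"
    by (rule continuous_on_compose2[OF cont_u]) (auto intro!: continuous_intros inner_D)
  moreover have "continuous_on (cball (0 :: real ^ 'm) r0 \<times> (UNIV :: (real ^ 'm) set)) (\<lambda>z. \<omega> c (fst z \<bullet> fst z))"
    by (rule continuous_on_compose2[OF cont_\<omega>[OF r0D]]) (use r0 in \<open>auto intro!: continuous_intros inner_le\<close>)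
  ultimately have "continuous_on (cball 0 r0 \<times> UNIV) (\<lambda>(x, \<nu>). k x \<nu>)"
    unfolding k_def case_prod_unfold by (intro continuous_intros)
  then have "continuous_map M euclidean (\<lambda>p. k (f p) (N p))"
    by (rule continuous_N_even[rotated]) (simp add: k_def)
  then obtain p0 where p0: "p0 \<in> topspace M" "\<And>q. q \<in> topspace M \<Longrightarrow> k (f q) (N q) \<le> k (f p0) (N p0)"
    using attains_max nonempty by blast
  have "0 < k (f p) (N p)" using ne by (simp add: k_def)
  also have "\<dots> \<le> k (f p0) (N p0)" by (rule p0(2)[OF p])
  finally have pos0: "f p0 \<bullet> N p0 \<noteq> 0" by (auto simp: k_def)
  obtain U \<phi> where c0: "(U, \<phi>) \<in> \<A>" "p0 \<in> U" using chart_cover[OF p0(1)] by blast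
  let ?S = "\<phi> ` U" and ?F = "in_chart f U \<phi>"
  have nb: "p0 \<notin> manifold_boundary \<A>" using boundary_support_zero[OF c0] pos0 by blast
  have hs: "\<phi> p0 \<in> half_space" using chart_image[OF c0(1)] c0(2) openin_imp_subset by blast
  then have int0: "\<phi> p0 $ bdry_coord > 0"
    using nb boundaryI[OF c0] by (force simp: half_space_def)
  obtain V1 G \<nu>1 where P1: "chart_patch V1 G \<nu>1 ?S ?F" "\<phi> p0 \<in> V1" "half_space \<inter> V1 \<subseteq> ?S"
    using chart_patch_exists[OF c0] by blast
  have fG: "f q = G (\<phi> q)" if "q \<in> U" "\<phi> q \<in> V1" for q
  proof -
    interpret P1: chart_patch V1 G \<nu>1 ?S ?F by (rule P1)
    show ?thesis using P1.FG[of "\<phi> q"] in_chart_eq[OF c0(1) that(1)] that by auto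
  qed
  have "\<exists>\<nu>. chart_patch V1 G \<nu> ?S ?F \<and> G (\<phi> p0) \<bullet> \<nu> (\<phi> p0) > 0"
  proof -
    have ne0: "G (\<phi> p0) \<bullet> \<nu>1 (\<phi> p0) \<noteq> 0"
      using N_chart[OF c0(1) P1(1) c0(2) P1(2)] pos0 fG[OF c0(2) P1(2)] by auto
    show ?thesis
    proof (cases "G (\<phi> p0) \<bullet> \<nu>1 (\<phi> p0) > 0")
      case False
      then show ?thesis using chart_patch.negate[OF P1(1)] ne0 by (intro exI[of _ "\<lambda>y. - \<nu>1 y"]) auto
    qed (use P1 in blast)
  qed
  then obtain \<nu> where P2: "chart_patch V1 G \<nu> ?S ?F" "G (\<phi> p0) \<bullet> \<nu> (\<phi> p0) > 0" by blast
  interpret P2: chart_patch V1 G \<nu> ?S ?F by (rule P2)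
  \<comment> \<open>On \<open>V\<close> the support function is positive and no boundary point
    occurs, so all of \<open>V\<close> comes from the hypersurface and the global maximum is a
    maximum over an open set.\<close>
  define V where "V = (V1 \<inter> (\<lambda>y. G y \<bullet> \<nu> y) -` {0<..}) \<inter> {y. 0 < y $ bdry_coord}"
  have "continuous_on V1 (\<lambda>y. G y \<bullet> \<nu> y)"
    using P2.dW unfolding P2.W_def[abs_def]
    by (intro continuous_at_imp_continuous_on ballI differentiable_imp_continuous_within) auto
  from continuous_open_preimage[OF this P2.op, of "{0<..}"]
  have "open (V1 \<inter> (\<lambda>y. G y \<bullet> \<nu> y) -` {0<..})" by simp
  moreover have "open {y :: real ^ 'n. 0 < y $ bdry_coord}"
    by (intro open_Collect_less continuous_intros)
  ultimately have opV: "open V" unfolding V_def by (rule open_Int)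
  have VS: "y \<in> ?S" "y \<in> V1" if "y \<in> V" for y
    using that P1(3) by (auto simp: V_def half_space_def)
  have "V \<subseteq> V1" by (auto simp: V_def)
  then interpret P: chart_patch V G \<nu> ?S ?F by (rule P2.restrict[OF opV])
  have x: "\<phi> p0 \<in> V" using P1(2) P2(2) int0 by (simp add: V_def)
  have Gle: "norm (G y) \<le> r0" and GD: "G y \<bullet> G y \<in> D" and Gpos: "0 < G y \<bullet> G y" if y: "y \<in> V" for y
  proof -
    obtain q where q: "q \<in> U" "y = \<phi> q" using VS[OF y] by blast
    have "q \<in> topspace M" using q(1) chart_subset[OF c0(1)] by blast
    from norm_f_le[OF this] show le: "norm (G y) \<le> r0" using fG[OF q(1)] VS(2)[OF y] q(2) by simp
    show "G y \<bullet> G y \<in> D" by (rule inner_D[OF le])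
    have "G y \<noteq> 0" using y by (auto simp: V_def)
    then show "0 < G y \<bullet> G y" by simp
  qed
  have du: "((\<lambda>z. u ((norm z)\<^sup>2)) has_derivative (\<lambda>v. 2 * u' (G y \<bullet> G y) * (G y \<bullet> v))) (at (G y))" if "y \<in> V" for y
    by (rule has_derivative_u_norm[OF GD[OF that]])
  have WP: "P.W y = G y \<bullet> \<nu> y" for y by (simp add: P.W_def)
  let ?t = "G (\<phi> p0) \<bullet> G (\<phi> p0)" and ?x = "\<phi> p0"
  show False
  proof (rule P.no_weighted_support_max[OF x, where u = u and up = u' and upp = "u'' ?t" and \<omega> = "\<omega> c" and ?\<omega>1.0 = "\<omega>1 c"
        and r = "sqrt ?t" and E = "exp (u ?t)" and S = "s (sqrt ?t)" and rb = "s r0" and c = c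
        and ?\<omega>2.0 = "c * (exp (u ?t))\<^sup>2 / (4 * ?t) + \<omega>1 c ?t * (u' ?t - 1 / (2 * ?t))"])
    show "0 < P.W y" if "y \<in> V" for y using that by (simp add: WP V_def)
    show "(u has_real_derivative u' (G y \<bullet> G y)) (at (G y \<bullet> G y))" if "y \<in> V" for y
      by (rule u'_at[OF GD[OF that] Gpos[OF that]])
    show "(\<omega> c has_real_derivative \<omega>1 c (G y \<bullet> G y)) (at (G y \<bullet> G y))" if "y \<in> V" for y
      by (rule DERIV_\<omega>[OF GD[OF that] Gpos[OF that]])
    show "(u' has_real_derivative u'' ?t) (at ?t)" by (rule u''_at[OF GD[OF x] Gpos[OF x]])
    show "(\<omega>1 c has_real_derivative c * (exp (u ?t))\<^sup>2 / (4 * ?t) + \<omega>1 c ?t * (u' ?t - 1 / (2 * ?t))) (at ?t)"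
      by (rule DERIV_\<omega>1[OF GD[OF x] Gpos[OF x]])
    show "(\<Sum>i\<in>UNIV. \<Sum>j\<in>UNIV. P.ginv y $ i $ j * P.bmat u' y $ i $ j) = 0" if "y \<in> V" for y
    proof (rule P.mean_curvature_eq_0[where u = u])
      show "y \<in> ?S \<inter> V" using VS[OF that] that by simp
      show "mean_curvature_vector (conformal_metric u) ?S ?F y = 0"
        using minimal c0(1) VS(1)[OF that] unfolding minimal_immersion_def by fast
    qed (rule du[OF that])
    show "ln (P.W y) + (u (G y \<bullet> G y) + \<omega> c (G y \<bullet> G y)) \<le> ln (P.W ?x) + (u ?t + \<omega> c ?t)" if y: "y \<in> V" for y
    proof -
      obtain q where q: "q \<in> U" "y = \<phi> q" using VS[OF y] by blast
      have k_eq: "k (f q) (N q) = exp (2 * (ln (P.W (\<phi> q)) + (u (G (\<phi> q) \<bullet> G (\<phi> q)) + \<omega> c (G (\<phi> q) \<bullet> G (\<phi> q)))))"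
        if q: "q \<in> U" "\<phi> q \<in> V" for q
      proof -
        have "(f q \<bullet> N q)\<^sup>2 = (P.W (\<phi> q))\<^sup>2"
          using N_chart[OF c0(1) P.chart_patch_axioms q] fG[OF q(1) VS(2)[OF q(2)]] by (auto simp: WP)
        also have "\<dots> = exp (2 * ln (P.W (\<phi> q)))" using q(2) by (simp add: WP V_def exp_double)
        finally show ?thesis
          unfolding k_def fG[OF q(1) VS(2)[OF q(2)]] by (simp add: distrib_left exp_add mult.assoc)
      qed
      have "k (f q) (N q) \<le> k (f p0) (N p0)"
        using p0(2) q(1) chart_subset[OF c0(1)] by blast
      then show ?thesis using k_eq[OF q(1)] k_eq[OF c0(2) x] q y by simp
    qed
    show "0 < sqrt ?t" "(sqrt ?t)\<^sup>2 = ?t" using Gpos[OF x] by (simp_all add: less_imp_le)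
    show "u'' ?t - (u' ?t)\<^sup>2 \<le> 0" by (rule i[OF GD[OF x]])
    have sq: "(sqrt ?t)\<^sup>2 \<in> D" using GD[OF x] by simp
    show "0 \<le> s (sqrt ?t)" by (rule s_nonneg[OF sq])
    have "sqrt ?t \<le> r0" using Gle[OF x] by (simp add: norm_eq_sqrt_inner)
    then show "s (sqrt ?t) \<le> s r0" by (intro s_mono[OF r0D]) auto
    show "0 < s r0" by (rule s_pos[OF r0 r0D])
    show "sqrt ?t * exp (u ?t) \<le> s (sqrt ?t) * (1 + 2 * ?t * u' ?t)"
      using radial_convexity[OF _ sq] Gpos[OF x] by simp
    show "c = real CARD('n) / (2 * (s r0)\<^sup>2)" by (simp add: c_def n_def)
    show "\<omega>1 c ?t = c * s (sqrt ?t) * exp (u ?t) / (2 * sqrt ?t)" by (simp add: \<omega>1_def)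
    have "sff_norm_sq (conformal_metric u) ?S ?F ?x \<le> n\<^sup>2 / (4 * (s r0)\<^sup>2)"
      using gap c0 unfolding sff_norm_sq_le_def n_def by fast
    then have "inverse ((exp (u ?t))\<^sup>2) * (\<Sum>i\<in>UNIV. \<Sum>j\<in>UNIV. \<Sum>k\<in>UNIV. \<Sum>l\<in>UNIV. P.ginv ?x $ i $ k * P.ginv ?x $ j $ l
        * (P.bmat u' ?x $ i $ j * P.bmat u' ?x $ k $ l)) \<le> n\<^sup>2 / (4 * (s r0)\<^sup>2)"
      using P.sff_norm_sq_eq[of ?x u u', OF _ du[OF x]] x VS(1)[OF x] by simp
    then show "(\<Sum>i\<in>UNIV. \<Sum>j\<in>UNIV. \<Sum>k\<in>UNIV. \<Sum>l\<in>UNIV. P.ginv ?x $ i $ k * P.ginv ?x $ j $ l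
        * (P.bmat u' ?x $ i $ j * P.bmat u' ?x $ k $ l)) \<le> (real CARD('n))\<^sup>2 / (4 * (s r0)\<^sup>2) * (exp (u ?t))\<^sup>2"
      unfolding n_def by (simp add: field_simps)
  qed simp_all
qed

end

section \<open>Constancy of the normal\<close>

text \<open>The half-space determines derivatives also at its boundary points. An identity known
  only on the hypersurface can therefore be differentiated through the extension.\<close>

lemma half_space_vanishing_derivative:
  fixes k :: "real ^ 'n::finite \<Rightarrow> 'b::real_normed_vector"
  assumes V: "open V" "x \<in> half_space \<inter> V" and k: "\<And>y. y \<in> half_space \<inter> V \<Longrightarrow> k y = 0"
    and d: "k differentiable (at x)"
  shows "frechet_derivative k (at x) = (\<lambda>v. 0)"
proof -
  have S: "openin (top_of_set half_space) (half_space :: (real ^ 'n) set)" by simp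
  have "frechet_derivative (\<lambda>_. 0) (at x within half_space) = frechet_derivative k (at x)"
    by (rule frechet_derivative_extension(2)[OF S V(1)]) (use V k d in auto)
  moreover have "frechet_derivative (\<lambda>_. 0 :: 'b) (at x within half_space) = (\<lambda>v. 0)"
    by (rule frechet_derivative_within_half_space[OF S]) (use V in auto)
  ultimately show ?thesis by simp
qed

lemma has_derivative_line:
  fixes K :: "'a::real_normed_vector \<Rightarrow> real"
  assumes "(K has_derivative K') (at y)"
  shows "((\<lambda>\<tau>. K (y + \<tau> *\<^sub>R v)) has_real_derivative K' v) (at 0)"
proof -
  have 1: "((\<lambda>\<tau>. y + \<tau> *\<^sub>R v) has_derivative (\<lambda>t. t *\<^sub>R v)) (at 0)"
    by (auto intro!: derivative_eq_intros)
  have 2: "(K has_derivative K') (at (y + 0 *\<^sub>R v))" using assms by simp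
  have "((\<lambda>\<tau>. K (y + \<tau> *\<^sub>R v)) has_derivative (\<lambda>t. K' (t *\<^sub>R v))) (at 0)"
    by (rule has_derivative_compose[OF 1 2])
  moreover have "(\<lambda>t. K' (t *\<^sub>R v)) = (*) (K' v)"
    using has_derivative_linear[OF assms] by (auto simp: linear_cmul)
  ultimately show ?thesis by (simp add: has_field_derivative_def)
qed

lemma line_in_open:
  fixes y v :: "'a::real_normed_vector"
  assumes "open V" "y \<in> V"
  obtains e where "e > 0" "\<And>\<tau>. \<bar>\<tau>\<bar> < e \<Longrightarrow> y + \<tau> *\<^sub>R v \<in> V"
proof -
  obtain d where d: "d > 0" "ball y d \<subseteq> V" using assms open_contains_ball by blast
  have "norm v + 1 > 0" by (simp add: add_nonneg_pos)
  have "y + \<tau> *\<^sub>R v \<in> V" if "\<bar>\<tau>\<bar> < d / (norm v + 1)" for \<tau>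
  proof -
    have "norm (\<tau> *\<^sub>R v) \<le> \<bar>\<tau>\<bar> * (norm v + 1)" by (simp add: algebra_simps)
    also have "\<dots> < d" using that \<open>norm v + 1 > 0\<close> by (simp add: pos_less_divide_eq)
    finally show ?thesis using d by (auto simp: subset_iff dist_norm)
  qed
  then show ?thesis using d \<open>norm v + 1 > 0\<close> by (intro that[of "d / (norm v + 1)"]) auto
qed

text \<open>Vanishing of the support function makes the position vector tangent everywhere, as on a
  cone with vertex 0.\<close>

locale conical_hypersurface = immersed_in_ball M \<A> f r0
  for M :: "'p topology" and \<A> :: "('p set \<times> ('p \<Rightarrow> real ^ 'n::finite)) set"
    and f :: "'p \<Rightarrow> real ^ 'm::finite" and r0 :: real +
  assumes support: "\<And>p. p \<in> topspace M \<Longrightarrow> f p \<bullet> N p = 0"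
    and nonempty: "topspace M \<noteq> {}" and connected: "connected_space M"
begin

context
  fixes U \<phi> p V G \<nu>
  assumes c: "(U, \<phi>) \<in> \<A>" "p \<in> U"
    and P: "chart_patch V G \<nu> (\<phi> ` U) (in_chart f U \<phi>)" "\<phi> p \<in> V" "half_space \<inter> V \<subseteq> \<phi> ` U"
begin

interpretation P: chart_patch V G \<nu> "\<phi> ` U" "in_chart f U \<phi>" by (rule P)

lemma f_eq_G: "q \<in> U \<Longrightarrow> \<phi> q \<in> V \<Longrightarrow> f q = G (\<phi> q)"
  using P.FG[of "\<phi> q"] in_chart_eq[OF c(1)] by auto

lemma chart_point: "y \<in> half_space \<inter> V \<Longrightarrow> \<exists>q\<in>U. y = \<phi> q"
  using P(3) by blast

lemma in_half_space: "\<phi> p \<in> half_space \<inter> V"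
  using chart_image[OF c(1)] c(2) P(2) openin_imp_subset by blast

lemma W_zero: "y \<in> half_space \<inter> V \<Longrightarrow> P.W y = 0"
proof -
  assume y: "y \<in> half_space \<inter> V"
  then obtain q where q: "q \<in> U" "y = \<phi> q" using chart_point by blast
  have "f q \<bullet> N q = 0" using support q(1) chart_subset[OF c(1)] by blast
  then show "P.W y = 0"
    using N_chart[OF c(1) P(1) q(1)] f_eq_G[OF q(1)] y q(2) by (auto simp: P.W_def)
qed

definition "Xv = (\<chi> j. P.X j (\<phi> p))"

lemma deriv_Xv: "frechet_derivative G (at (\<phi> p)) Xv = G (\<phi> p)"
  using P.position_decompose[OF P(2)] W_zero[OF in_half_space]
  by (simp add: P.deriv_expand[OF P(2)] Xv_def)

text \<open>Its tangential components are -h(X, .), which by \<open>pd_W\<close> is the derivative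
  of \<open>W\<close>, and \<open>W\<close> vanishes on the half-space part of the patch.\<close>

lemma normal_deriv_Xv: "frechet_derivative \<nu> (at (\<phi> p)) Xv = 0"
proof -
  let ?y = "\<phi> p"
  have lin: "linear (frechet_derivative \<nu> (at ?y))"
    using P.d_normal[OF P(2)] frechet_derivative_works has_derivative_linear by blast
  have exp: "frechet_derivative \<nu> (at ?y) Xv = (\<Sum>i\<in>UNIV. P.X i ?y *\<^sub>R pd i \<nu> ?y)"
    using linear_axis_expand[OF lin, of Xv] unfolding pd_frechet by (simp add: Xv_def)
  show ?thesis
  proof (rule P.zero_if_orthogonal[OF P(2) P.unit[OF P(2)] P.normal[OF P(2)]])
    show "frechet_derivative \<nu> (at ?y) Xv \<bullet> \<nu> ?y = 0"
      by (simp add: exp inner_sum_left P.normal_deriv_normal[OF P(2)])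
    fix j
    have "frechet_derivative \<nu> (at ?y) Xv \<bullet> pd j G ?y = - (\<Sum>i\<in>UNIV. P.h j i ?y * P.X i ?y)"
      by (simp add: exp inner_sum_left P.normal_deriv_tangent[OF P(2)] sum_negf P.h_sym[OF P(2), of _ j] mult.commute)
    also have "\<dots> = pd j P.W ?y" by (simp add: P.pd_W[OF P(2)])
    also have "\<dots> = 0"
      using half_space_vanishing_derivative[OF P.op in_half_space W_zero P.dW[OF P(2)]] by (simp add: pd_frechet)
    finally show "frechet_derivative \<nu> (at ?y) Xv \<bullet> pd j G ?y = 0" .
  qed
qed

lemma d_norm_sq: "((\<lambda>y. G y \<bullet> G y) has_derivative (\<lambda>v. 2 * (G (\<phi> p) \<bullet> frechet_derivative G (at (\<phi> p)) v))) (at (\<phi> p))"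
  using Ck_on_has_derivative[OF P.C P(2)] by (auto intro!: derivative_eq_intros simp: inner_commute)

text \<open>The direction \<open>- Xv\<close> points into the half-space: along \<open>Xv\<close> the norm of \<open>f\<close> increases, which is
  impossible inside the hypersurface at a boundary point.\<close>

lemma inward:
  assumes "f p \<noteq> 0"
  obtains e where "e > 0" "\<And>\<tau>. 0 \<le> \<tau> \<Longrightarrow> \<tau> < e \<Longrightarrow> \<phi> p - \<tau> *\<^sub>R Xv \<in> half_space \<inter> V"
proof -
  let ?y = "\<phi> p"
  have hs: "?y $ bdry_coord \<ge> 0" using in_half_space by (simp add: half_space_def)
  obtain e1 where e1: "e1 > 0" "\<And>\<tau>. \<bar>\<tau>\<bar> < e1 \<Longrightarrow> ?y + \<tau> *\<^sub>R Xv \<in> V"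
    using line_in_open[OF P.op P(2)] by blast
  show ?thesis
  proof (cases "?y $ bdry_coord = 0")
    case True
    then have nb: "norm (f p) = r0" using bd_sphere boundaryI[OF c] by blast
    have "Xv $ bdry_coord \<le> 0"
    proof (rule ccontr)
      assume pos: "\<not> Xv $ bdry_coord \<le> 0"
      have "((\<lambda>\<tau>. G (?y + \<tau> *\<^sub>R Xv) \<bullet> G (?y + \<tau> *\<^sub>R Xv)) has_real_derivative 2 * (G ?y \<bullet> G ?y)) (at 0)"
        using has_derivative_line[OF d_norm_sq, of Xv] by (simp add: deriv_Xv)
      moreover have "2 * (G ?y \<bullet> G ?y) > 0" using assms f_eq_G[OF c(2) P(2)] by simp
      ultimately obtain d where d: "d > 0"
        "\<And>h. 0 < h \<Longrightarrow> h < d \<Longrightarrow> G (?y + 0 *\<^sub>R Xv) \<bullet> G (?y + 0 *\<^sub>R Xv) < G (?y + (0 + h) *\<^sub>R Xv) \<bullet> G (?y + (0 + h) *\<^sub>R Xv)"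
        using DERIV_pos_inc_right by blast
      define h where "h = min d e1 / 2"
      have h: "0 < h" "h < d" "h < e1" using d e1 by (auto simp: h_def)
      have hin: "?y + h *\<^sub>R Xv \<in> half_space \<inter> V" using True pos h e1(2)[of h] by (simp add: half_space_def)
      then obtain q where q: "q \<in> U" "?y + h *\<^sub>R Xv = \<phi> q" using chart_point by blast
      have "f p \<bullet> f p < f q \<bullet> f q" using d(2)[OF h(1,2)] f_eq_G[OF q(1)] f_eq_G[OF c(2) P(2)] q(2) hin by simp
      moreover have "norm (f q) \<le> r0" using norm_f_le q(1) chart_subset[OF c(1)] by blast
      ultimately show False using nb power_mono[of "norm (f q)" r0 2] by (simp add: dot_square_norm)
    qed
    then have "?y - \<tau> *\<^sub>R Xv \<in> half_space \<inter> V" if "0 \<le> \<tau>" "\<tau> < e1" for \<tau>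
      using e1(2)[of "- \<tau>"] that True by (simp add: half_space_def mult_nonneg_nonpos)
    then show ?thesis using that e1(1) by blast
  next
    case False
    then have "?y \<in> {y. 0 < y $ bdry_coord}" using hs by simp
    moreover have "open {y :: real ^ 'n. 0 < y $ bdry_coord}"
      by (intro open_Collect_less continuous_intros)
    ultimately obtain e2 where e2: "e2 > 0" "\<And>\<tau>. \<bar>\<tau>\<bar> < e2 \<Longrightarrow> ?y + \<tau> *\<^sub>R Xv \<in> {y. 0 < y $ bdry_coord}"
      using line_in_open by blast
    have "?y - \<tau> *\<^sub>R Xv \<in> half_space \<inter> V" if "0 \<le> \<tau>" "\<tau> < min e1 e2" for \<tau>
      using e1(2)[of "- \<tau>"] e2(2)[of "- \<tau>"] that by (simp add: half_space_def)
    then show ?thesis using that[of "min e1 e2"] e1(1) e2(1) by auto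
  qed
qed

text \<open>Short steps against \<open>Xv\<close> stay on the hypersurface, at boundary points too.
  So a function that decreases along \<open>Xv\<close> cannot be maximal at a point that is not
  mapped to the origin.\<close>

lemma radial_descent:
  assumes "f p \<noteq> 0" and K: "(K has_derivative K') (at (\<phi> p))" "K' Xv < 0"
  shows "\<exists>q\<in>U. \<phi> q \<in> V \<and> K (\<phi> p) < (K (\<phi> q) :: real)"
proof -
  obtain e where e: "e > 0" "\<And>\<tau>. 0 \<le> \<tau> \<Longrightarrow> \<tau> < e \<Longrightarrow> \<phi> p - \<tau> *\<^sub>R Xv \<in> half_space \<inter> V"
    using inward[OF assms(1)] by blast
  have "K' (- Xv) > 0" using K has_derivative_linear[OF K(1)] by (simp add: linear_neg)
  then obtain d where d: "d > 0" "\<And>h. 0 < h \<Longrightarrow> h < d \<Longrightarrow> K (\<phi> p + 0 *\<^sub>R (- Xv)) < K (\<phi> p + (0 + h) *\<^sub>R (- Xv))"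
    using DERIV_pos_inc_right[OF has_derivative_line[OF K(1)]] by blast
  define h where "h = min d e / 2"
  have h: "0 < h" "h < d" "h < e" using d e by (auto simp: h_def)
  have hin: "\<phi> p - h *\<^sub>R Xv \<in> half_space \<inter> V" using e(2)[of h] h by simp
  then obtain q where "q \<in> U" "\<phi> p - h *\<^sub>R Xv = \<phi> q" using chart_point by blast
  then show ?thesis using d(2)[OF h(1,2)] hin by auto
qed

text \<open>An injective differential is bounded below, so \<open>norm (G y)\<close> grows at least
  linearly in the distance of \<open>y\<close> from \<open>\<phi> p\<close>.\<close>

lemma isolated_zero:
  assumes "f p = 0"
  shows "\<exists>B. openin M B \<and> p \<in> B \<and> (\<forall>q\<in>B. f q = 0 \<longrightarrow> q = p)"
proof -
  let ?D = "frechet_derivative G (at (\<phi> p))"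
  have G0: "G (\<phi> p) = 0" using assms f_eq_G[OF c(2) P(2)] by simp
  obtain B where B: "B > 0" "\<And>v. B * norm v \<le> norm (?D v)"
    using linear_inj_bounded_below_pos[OF P.lin[OF P(2)] P.inj[OF P(2)]] by blast
  have "\<forall>e>0. \<exists>d>0. \<forall>y. norm (y - \<phi> p) < d \<longrightarrow> norm (G y - G (\<phi> p) - ?D (y - \<phi> p)) \<le> e * norm (y - \<phi> p)"
    using Ck_on_has_derivative[OF P.C P(2)] unfolding has_derivative_at_alt by blast
  then obtain d where d: "d > 0" "\<And>y. norm (y - \<phi> p) < d \<Longrightarrow> norm (G y - ?D (y - \<phi> p)) \<le> B / 2 * norm (y - \<phi> p)"
    using B(1) G0 by (metis diff_zero half_gt_zero)
  have z: "y = \<phi> p" if "norm (y - \<phi> p) < d" "G y = 0" for y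
  proof -
    have "B * norm (y - \<phi> p) \<le> B / 2 * norm (y - \<phi> p)"
      using B(2)[of "y - \<phi> p"] d(2)[OF that(1)] that(2) by simp
    then have "norm (y - \<phi> p) \<le> 0" using B(1) by (simp add: field_simps mult_le_0_iff)
    then show ?thesis by simp
  qed
  let ?B = "{q \<in> U. \<phi> q \<in> V \<inter> ball (\<phi> p) d}"
  have "openin M ?B" by (rule chart_nbhd_open[OF c(1)]) (use P.op in auto)
  moreover have "p \<in> ?B" using c P d by simp
  moreover have "q = p" if "q \<in> ?B" "f q = 0" for q
  proof -
    have "\<phi> q = \<phi> p" using z[of "\<phi> q"] that f_eq_G[of q] by (simp add: dist_norm norm_minus_commute)
    then show ?thesis using chart_inj[OF c(1)] that c(2) by (auto dest: inj_onD)
  qed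
  ultimately show ?thesis by blast
qed

end

lemma chart_data:
  assumes "p \<in> topspace M"
  obtains U \<phi> V G \<nu> where "(U, \<phi>) \<in> \<A>" "p \<in> U" "chart_patch V G \<nu> (\<phi> ` U) (in_chart f U \<phi>)"
    "\<phi> p \<in> V" "half_space \<inter> V \<subseteq> \<phi> ` U"
  using chart_cover[OF assms] chart_patch_exists by metis

text \<open>Consider a point nearest to the origin: unless it is mapped to 0, moving against the
  radial direction leads closer.\<close>

lemma zero_in_image: "\<exists>p\<in>topspace M. f p = 0"
proof -
  have "continuous_map M euclidean (\<lambda>p. - (f p \<bullet> f p))"
    using continuous_N_even[of "\<lambda>x \<nu>. - (x \<bullet> x)"] by (simp add: case_prod_unfold continuous_intros)
  then obtain p where p: "p \<in> topspace M" "\<And>q. q \<in> topspace M \<Longrightarrow> - (f q \<bullet> f q) \<le> - (f p \<bullet> f p)"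
    using attains_max nonempty by blast
  obtain U \<phi> V G \<nu> where c: "(U, \<phi>) \<in> \<A>" "p \<in> U" and P: "chart_patch V G \<nu> (\<phi> ` U) (in_chart f U \<phi>)"
    "\<phi> p \<in> V" "half_space \<inter> V \<subseteq> \<phi> ` U" by (rule chart_data[OF p(1)]) (rule that)
  note fG = f_eq_G[OF c P]
  have "f p = 0"
  proof (rule ccontr)
    assume ne: "f p \<noteq> 0"
    have "\<exists>q\<in>U. \<phi> q \<in> V \<and> - (G (\<phi> p) \<bullet> G (\<phi> p)) < - (G (\<phi> q) \<bullet> G (\<phi> q))"
      by (rule radial_descent[OF c P ne has_derivative_minus[OF d_norm_sq[OF c P]]])
         (use ne fG[OF c(2) P(2)] in \<open>simp add: deriv_Xv[OF c P]\<close>)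
    then obtain q where q: "q \<in> U" "\<phi> q \<in> V" "- (G (\<phi> p) \<bullet> G (\<phi> p)) < - (G (\<phi> q) \<bullet> G (\<phi> q))" by blast
    then have "- (f p \<bullet> f p) < - (f q \<bullet> f q)" using fG[OF q(1,2)] fG[OF c(2) P(2)] by simp
    moreover have "q \<in> topspace M" using q(1) chart_subset[OF c(1)] by blast
    ultimately show False using p(2) by fastforce
  qed
  then show ?thesis using p(1) by blast
qed

lemma finite_zeros: "finite {p \<in> topspace M. f p = 0}"
proof -
  have "\<exists>B. openin M B \<and> p \<in> B \<and> (\<forall>q\<in>B. f q = 0 \<longrightarrow> q = p)" if p: "p \<in> topspace M" for p
  proof (cases "f p = 0")
    case True
    obtain U \<phi> V G \<nu> where c: "(U, \<phi>) \<in> \<A>" "p \<in> U" and P: "chart_patch V G \<nu> (\<phi> ` U) (in_chart f U \<phi>)"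
      "\<phi> p \<in> V" "half_space \<inter> V \<subseteq> \<phi> ` U" by (rule chart_data[OF p]) (rule that)
    show ?thesis by (rule isolated_zero[OF c P True])
  next
    case False
    have "openin M {q \<in> topspace M. f q \<in> - {0}}"
      by (rule openin_continuous_map_preimage[OF continuous_f]) auto
    then show ?thesis using False p by blast
  qed
  then obtain B where B: "\<And>p. p \<in> topspace M \<Longrightarrow> openin M (B p) \<and> p \<in> B p \<and> (\<forall>q\<in>B p. f q = 0 \<longrightarrow> q = p)"
    by metis
  have "compactin M (topspace M)" using comp by (simp add: compact_space_def)
  then have "\<exists>F. finite F \<and> F \<subseteq> B ` topspace M \<and> topspace M \<subseteq> \<Union>F"
    by (rule compactinD) (use B in auto)
  then obtain F where F: "finite F" "F \<subseteq> B ` topspace M" "topspace M \<subseteq> \<Union>F" by blast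
  then obtain C where C: "C \<subseteq> topspace M" "finite C" "F = B ` C" by (meson finite_subset_image)
  have "{p \<in> topspace M. f p = 0} \<subseteq> C" using F(3) C B by (auto simp: subset_iff)
  then show ?thesis using C(2) finite_subset by blast
qed

lemma unit_N: "p \<in> topspace M \<Longrightarrow> norm (N p) = 1"
proof -
  assume p: "p \<in> topspace M"
  obtain U \<phi> V G \<nu> where c: "(U, \<phi>) \<in> \<A>" "p \<in> U" and P: "chart_patch V G \<nu> (\<phi> ` U) (in_chart f U \<phi>)"
    "\<phi> p \<in> V" "half_space \<inter> V \<subseteq> \<phi> ` U" by (rule chart_data[OF p]) (rule that)
  interpret P: chart_patch V G \<nu> "\<phi> ` U" "in_chart f U \<phi>" by (rule P)
  show ?thesis using N_chart[OF c(1) P(1) c(2) P(2)] P.unit[OF P(2)] by auto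
qed

text \<open>\<open>(N \<bullet> e)\<^sup>2\<close> is constant along the radial direction, so a function of it minus a small multiple of
  \<open>\<bar>f\<bar>\<^sup>2\<close> can attain its maximum only at a zero of \<open>f\<close>.\<close>

lemma normal_values:
  assumes p: "p \<in> topspace M"
  shows "\<exists>z\<in>topspace M. f z = 0 \<and> (N p \<bullet> e)\<^sup>2 = (N z \<bullet> e)\<^sup>2"
proof -
  define Z where "Z = (\<lambda>z. (N z \<bullet> e)\<^sup>2) ` {p \<in> topspace M. f p = 0}"
  \<comment> \<open>A differentiable function that is nonnegative, due to the squares, and vanishes
    precisely at the values attained over the origin.\<close>
  define \<zeta> where "\<zeta> a = (\<Prod>v\<in>Z. (a - v)\<^sup>2)" for a :: real
  have finZ: "finite Z" using finite_zeros by (simp add: Z_def)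
  have \<zeta>0: "0 \<le> \<zeta> a" for a unfolding \<zeta>_def by (intro prod_nonneg) simp
  have d\<zeta>: "\<zeta> differentiable (at a)" for a
    unfolding \<zeta>_def[abs_def] differentiable_def by (rule exI) (rule derivative_intros | rule refl)+
  then obtain \<zeta>' where \<zeta>': "\<And>a. (\<zeta> has_real_derivative \<zeta>' a) (at a)"
    unfolding real_differentiable_def by metis
  have c\<zeta>: "continuous_on UNIV \<zeta>"
    unfolding \<zeta>_def[abs_def] by (intro continuous_intros)
  \<comment> \<open>At the maximum both \<open>\<zeta>\<close> and the penalty vanish, so at
    \<open>p\<close> the value of \<open>\<zeta>\<close> is at most the penalty there, which is as
    small as \<open>\<delta>\<close> makes it.\<close>
  have le: "\<zeta> ((N p \<bullet> e)\<^sup>2) \<le> \<delta> * r0\<^sup>2" if \<delta>: "\<delta> > 0" for \<delta>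
  proof -
    have "continuous_on (cball 0 r0 \<times> UNIV) (\<lambda>(x::real^'m, \<nu>). \<zeta> ((\<nu> \<bullet> e)\<^sup>2) - \<delta> * (x \<bullet> x))"
      unfolding case_prod_unfold by (intro continuous_intros continuous_on_compose2[OF c\<zeta>]) auto
    then have "continuous_map M euclidean (\<lambda>p. \<zeta> ((N p \<bullet> e)\<^sup>2) - \<delta> * (f p \<bullet> f p))"
      using continuous_N_even[of "\<lambda>x \<nu>. \<zeta> ((\<nu> \<bullet> e)\<^sup>2) - \<delta> * (x \<bullet> x)"] by simp
    then obtain q where q: "q \<in> topspace M"
      "\<And>p. p \<in> topspace M \<Longrightarrow> \<zeta> ((N p \<bullet> e)\<^sup>2) - \<delta> * (f p \<bullet> f p) \<le> \<zeta> ((N q \<bullet> e)\<^sup>2) - \<delta> * (f q \<bullet> f q)"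
      using attains_max nonempty by blast
    obtain U \<phi> V G \<nu> where c: "(U, \<phi>) \<in> \<A>" "q \<in> U" and P: "chart_patch V G \<nu> (\<phi> ` U) (in_chart f U \<phi>)"
      "\<phi> q \<in> V" "half_space \<inter> V \<subseteq> \<phi> ` U" by (rule chart_data[OF q(1)]) (rule that)
    interpret P: chart_patch V G \<nu> "\<phi> ` U" "in_chart f U \<phi>" by (rule P)
    note fG = f_eq_G[OF c P]
    have NN: "(N q \<bullet> e)\<^sup>2 = (\<nu> (\<phi> q) \<bullet> e)\<^sup>2" if "q \<in> U" "\<phi> q \<in> V" for q
      using N_chart[OF c(1) P(1) that] by auto
    have "f q = 0"
    proof (rule ccontr)
      assume ne: "f q \<noteq> 0"
      let ?y = "\<phi> q"
      have d\<nu>: "(\<nu> has_derivative frechet_derivative \<nu> (at ?y)) (at ?y)"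
        using P.d_normal[OF P(2)] frechet_derivative_works by blast
      have "((\<lambda>y. (\<nu> y \<bullet> e)\<^sup>2) has_derivative (\<lambda>v. 2 * (\<nu> ?y \<bullet> e) * (frechet_derivative \<nu> (at ?y) v \<bullet> e))) (at ?y)"
        by (auto intro!: derivative_eq_intros d\<nu>)
      from has_derivative_compose[OF this \<zeta>'[unfolded has_field_derivative_def]]
      have "((\<lambda>y. \<zeta> ((\<nu> y \<bullet> e)\<^sup>2)) has_derivative
         (\<lambda>v. \<zeta>' ((\<nu> ?y \<bullet> e)\<^sup>2) * (2 * (\<nu> ?y \<bullet> e) * (frechet_derivative \<nu> (at ?y) v \<bullet> e)))) (at ?y)" .
      from has_derivative_diff[OF this has_derivative_mult_right[OF d_norm_sq[OF c P], of \<delta>]]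
      have "\<exists>q'\<in>U. \<phi> q' \<in> V \<and> \<zeta> ((\<nu> ?y \<bullet> e)\<^sup>2) - \<delta> * (G ?y \<bullet> G ?y) < \<zeta> ((\<nu> (\<phi> q') \<bullet> e)\<^sup>2) - \<delta> * (G (\<phi> q') \<bullet> G (\<phi> q'))"
        by (rule radial_descent[OF c P ne])
           (use ne \<delta> fG[OF c(2) P(2)] in \<open>simp add: deriv_Xv[OF c P] normal_deriv_Xv[OF c P]\<close>)
      then obtain q' where q': "q' \<in> U" "\<phi> q' \<in> V"
        "\<zeta> ((\<nu> ?y \<bullet> e)\<^sup>2) - \<delta> * (G ?y \<bullet> G ?y) < \<zeta> ((\<nu> (\<phi> q') \<bullet> e)\<^sup>2) - \<delta> * (G (\<phi> q') \<bullet> G (\<phi> q'))" by blast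
      have "q' \<in> topspace M" using q'(1) chart_subset[OF c(1)] by blast
      from q(2)[OF this] q'(3) show False
        by (simp add: NN[OF q'(1,2)] NN[OF c(2) P(2)] fG[OF q'(1,2)] fG[OF c(2) P(2)])
    qed
    then have "(N q \<bullet> e)\<^sup>2 \<in> Z" using q(1) by (auto simp: Z_def)
    then have "\<zeta> ((N q \<bullet> e)\<^sup>2) = 0" using finZ by (auto simp: \<zeta>_def intro!: prod_zero)
    then have "\<zeta> ((N p \<bullet> e)\<^sup>2) \<le> \<delta> * (f p \<bullet> f p)" using q(2)[OF p] \<open>f q = 0\<close> by simp
    also have "\<dots> \<le> \<delta> * r0\<^sup>2"
      using \<delta> norm_f_le[OF p] power_mono[of "norm (f p)" r0 2] by (simp add: dot_square_norm)
    finally show ?thesis .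
  qed
  have "\<zeta> ((N p \<bullet> e)\<^sup>2) \<le> 0"
  proof (rule field_le_epsilon)
    fix \<epsilon> :: real assume "0 < \<epsilon>"
    then show "\<zeta> ((N p \<bullet> e)\<^sup>2) \<le> 0 + \<epsilon>" using le[of "\<epsilon> / r0\<^sup>2"] r0 by simp
  qed
  then have "\<zeta> ((N p \<bullet> e)\<^sup>2) = 0" using \<zeta>0 by (metis antisym)
  then show ?thesis using finZ unfolding \<zeta>_def by (auto simp: Z_def)
qed

text \<open>A continuous function with finitely many values on a connected space is constant. With
  the normal at one point as reference the constant is 1, the equality case of Cauchy-Schwarz;
  squaring absorbs the sign.\<close>

lemma normal_constant: "\<exists>e. norm e = 1 \<and> (\<forall>p\<in>topspace M. N p = e \<or> N p = - e)"
proof -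
  obtain p0 where p0: "p0 \<in> topspace M" using nonempty by blast
  let ?s = "\<lambda>p. (N p \<bullet> N p0)\<^sup>2"
  have "continuous_on (cball 0 r0 \<times> UNIV) (\<lambda>(x::real^'m, \<nu>). (\<nu> \<bullet> N p0)\<^sup>2)"
    unfolding case_prod_unfold by (intro continuous_intros)
  then have "continuous_map M euclidean ?s"
    using continuous_N_even[of "\<lambda>x \<nu>. (\<nu> \<bullet> N p0)\<^sup>2"] by simp
  then have "connected (?s ` topspace M)"
    using connectedin_continuous_map_image[of M euclidean ?s "topspace M"] connected
    by (simp add: connectedin_topspace)
  moreover have "finite (?s ` topspace M)"
    by (rule finite_subset[of _ "?s ` {p \<in> topspace M. f p = 0}"])
       (use normal_values[of _ "N p0"] finite_zeros in auto)
  ultimately obtain a where a: "?s ` topspace M = {a}"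
    using connected_finite_iff_sing[of "?s ` topspace M"] p0 by auto
  have one: "?s p = 1" if "p \<in> topspace M" for p
  proof -
    have "?s p \<in> {a}" "?s p0 \<in> {a}" unfolding a[symmetric] using that p0 by auto
    then have "?s p = ?s p0" by simp
    then show ?thesis using unit_N[OF p0] by (simp add: dot_square_norm)
  qed
  have "N p = N p0 \<or> N p = - N p0" if p: "p \<in> topspace M" for p
  proof -
    have nn: "N p \<bullet> N p = 1" "N p0 \<bullet> N p0 = 1" using unit_N[OF p] unit_N[OF p0] by (simp_all add: dot_square_norm)
    have "N p \<bullet> N p0 = 1 \<or> N p \<bullet> N p0 = -1" using one[OF p] by (simp add: power2_eq_1_iff)
    moreover have "(norm (N p - N p0))\<^sup>2 = 2 - 2 * (N p \<bullet> N p0)" "(norm (N p + N p0))\<^sup>2 = 2 + 2 * (N p \<bullet> N p0)"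
      by (simp_all add: power2_norm_eq_inner inner_diff_left inner_diff_right inner_add_left inner_add_right
          inner_commute[of "N p0" "N p"] nn)
    ultimately show ?thesis by (elim disjE) (simp_all add: eq_neg_iff_add_eq_0)
  qed
  then show ?thesis using unit_N[OF p0] by blast
qed

end

section \<open>Local homeomorphisms onto a ball\<close>

text \<open>Sections with open images over relatively open pieces of the closed ball say that
  \<open>F\<close> is a local homeomorphism into the closed ball, over its boundary sphere as well.
  The radial contraction of the ball then serves in place of path lifting.\<close>

locale ball_covering =
  fixes M :: "'p topology" and F :: "'p \<Rightarrow> 'a::euclidean_space"
  assumes comp: "compact_space M" and haus: "Hausdorff_space M" and conn: "connected_space M"
    and ne: "topspace M \<noteq> {}"
    and cont: "continuous_map M euclidean F" and FK: "F ` topspace M \<subseteq> cball 0 1"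
    and loc: "\<And>p. p \<in> topspace M \<Longrightarrow> \<exists>\<epsilon>>0. \<exists>\<sigma>.
       continuous_map (top_of_set (ball (F p) \<epsilon> \<inter> cball 0 1)) M \<sigma> \<and> \<sigma> (F p) = p \<and>
       (\<forall>x\<in>ball (F p) \<epsilon> \<inter> cball 0 1. F (\<sigma> x) = x) \<and> openin M (\<sigma> ` (ball (F p) \<epsilon> \<inter> cball 0 1))"
begin

definition sect :: "real \<Rightarrow> 'p \<Rightarrow> ('a \<Rightarrow> 'p) \<Rightarrow> bool" where
  "sect \<epsilon> p \<sigma> \<longleftrightarrow> continuous_map (top_of_set (ball (F p) \<epsilon> \<inter> cball 0 1)) M \<sigma> \<and> \<sigma> (F p) = p \<and>
       (\<forall>x\<in>ball (F p) \<epsilon> \<inter> cball 0 1. F (\<sigma> x) = x) \<and> openin M (\<sigma> ` (ball (F p) \<epsilon> \<inter> cball 0 1))"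

lemma sectD:
  assumes "sect \<epsilon> p \<sigma>"
  shows "continuous_map (top_of_set (ball (F p) \<epsilon> \<inter> cball 0 1)) M \<sigma>" "\<sigma> (F p) = p"
    "\<And>x. x \<in> ball (F p) \<epsilon> \<inter> cball 0 1 \<Longrightarrow> F (\<sigma> x) = x"
    "openin M (\<sigma> ` (ball (F p) \<epsilon> \<inter> cball 0 1))"
  using assms unfolding sect_def by blast+

lemma loc': "p \<in> topspace M \<Longrightarrow> \<exists>\<epsilon>>0. \<exists>\<sigma>. sect \<epsilon> p \<sigma>"
  unfolding sect_def by (rule loc)

lemma FK': "p \<in> topspace M \<Longrightarrow> F p \<in> cball 0 1"
  using FK by blast

text \<open>The set of agreement is closed because \<open>M\<close> is Hausdorff. It is open because
  the image of a local section is open and \<open>F\<close> is injective on it.\<close>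

lemma unique_section:
  assumes s: "continuous_map (top_of_set C) M \<sigma>" "\<And>x. x \<in> C \<Longrightarrow> F (\<sigma> x) = x"
    and t: "continuous_map (top_of_set C) M \<tau>" "\<And>x. x \<in> C \<Longrightarrow> F (\<tau> x) = x"
    and C: "connected C" and a: "a \<in> C" "\<sigma> a = \<tau> a" and x: "x \<in> C"
  shows "\<sigma> x = \<tau> x"
proof -
  let ?T = "{x \<in> C. \<sigma> x = \<tau> x}"
  have "closedin (top_of_set C) ?T"
    using closedin_continuous_maps_eq[OF haus s(1) t(1)] by simp
  moreover have "openin (top_of_set C) ?T"
  proof (subst openin_subopen, intro ballI)
    fix y assume y: "y \<in> ?T"
    have sy: "\<sigma> y \<in> topspace M" using continuous_map_image_subset_topspace[OF s(1)] y by auto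
    obtain \<epsilon> \<rho> where \<rho>: "\<epsilon> > 0" "sect \<epsilon> (\<sigma> y) \<rho>" using loc'[OF sy] by blast
    let ?B = "ball (F (\<sigma> y)) \<epsilon> \<inter> cball 0 1"
    let ?O = "{z \<in> C. \<sigma> z \<in> \<rho> ` ?B} \<inter> {z \<in> C. \<tau> z \<in> \<rho> ` ?B}"
    have "openin (top_of_set C) {z \<in> C. \<sigma> z \<in> \<rho> ` ?B}" "openin (top_of_set C) {z \<in> C. \<tau> z \<in> \<rho> ` ?B}"
      using openin_continuous_map_preimage[OF s(1) sectD(4)[OF \<rho>(2)]]
        openin_continuous_map_preimage[OF t(1) sectD(4)[OF \<rho>(2)]] by simp_all
    then have "openin (top_of_set C) ?O" by (rule openin_Int)
    moreover have "y \<in> ?O"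
    proof -
      have "F (\<sigma> y) \<in> ?B" using FK'[OF sy] \<rho>(1) by simp
      then have "\<rho> (F (\<sigma> y)) \<in> \<rho> ` ?B" by (rule imageI)
      then show ?thesis using y sectD(2)[OF \<rho>(2)] by simp
    qed
    moreover have "?O \<subseteq> ?T"
    proof
      fix z assume z: "z \<in> ?O"
      then obtain b c where b: "b \<in> ?B" "\<sigma> z = \<rho> b" and c: "c \<in> ?B" "\<tau> z = \<rho> c" by auto
      have "b = z" using sectD(3)[OF \<rho>(2) b(1)] s(2)[of z] b z by simp
      moreover have "c = z" using sectD(3)[OF \<rho>(2) c(1)] t(2)[of z] c z by simp
      ultimately show "z \<in> ?T" using b c z by simp
    qed
    ultimately show "\<exists>T. openin (top_of_set C) T \<and> y \<in> T \<and> T \<subseteq> ?T" by blast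
  qed
  ultimately have "?T = {} \<or> ?T = C" using C unfolding connected_clopen by blast
  then show ?thesis using a x by blast
qed

text \<open>A Lebesgue number argument: half of each local radius is reserved for moving the centre.
  The bound \<open>e \<le> 1\<close> keeps the factor 1 - e / 2 positive later on.\<close>

lemma uniform_radius: "\<exists>e. 0 < e \<and> e \<le> 1 \<and> (\<forall>p\<in>topspace M. \<exists>\<sigma>. sect e p \<sigma>)"
proof -
  obtain \<epsilon> \<sigma> where \<epsilon>: "\<And>p. p \<in> topspace M \<Longrightarrow> 0 < \<epsilon> p" and \<sigma>: "\<And>p. p \<in> topspace M \<Longrightarrow> sect (\<epsilon> p) p (\<sigma> p)"
    using loc' by metis
  define B where "B p = \<sigma> p ` (ball (F p) (\<epsilon> p) \<inter> cball 0 1) \<inter> {q \<in> topspace M. F q \<in> ball (F p) (\<epsilon> p / 2)}" for p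
  have B: "openin M (B p)" "p \<in> B p" if p: "p \<in> topspace M" for p
  proof -
    have "openin M {q \<in> topspace M. F q \<in> ball (F p) (\<epsilon> p / 2)}"
      by (rule openin_continuous_map_preimage[OF cont]) auto
    then show "openin M (B p)" unfolding B_def by (rule openin_Int[OF sectD(4)[OF \<sigma>[OF p]]])
    have "F p \<in> ball (F p) (\<epsilon> p) \<inter> cball 0 1" using FK'[OF p] \<epsilon>[OF p] by simp
    then have "\<sigma> p (F p) \<in> \<sigma> p ` (ball (F p) (\<epsilon> p) \<inter> cball 0 1)" by (rule imageI)
    then show "p \<in> B p" using sectD(2)[OF \<sigma>[OF p]] p \<epsilon>[OF p] by (simp add: B_def)
  qed
  have "compactin M (topspace M)" using comp by (simp add: compact_space_def)
  then have "\<exists>\<F>. finite \<F> \<and> \<F> \<subseteq> B ` topspace M \<and> topspace M \<subseteq> \<Union>\<F>"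
    by (rule compactinD) (use B in auto)
  then obtain C where C: "C \<subseteq> topspace M" "finite C" "topspace M \<subseteq> \<Union>(B ` C)"
    by (metis finite_subset_image)
  have C0: "C \<noteq> {}" using C(3) ne by auto
  define e where "e = min 1 (Min ((\<lambda>p. \<epsilon> p / 2) ` C))"
  have e: "0 < e" "e \<le> 1" using C C0 \<epsilon> by (auto simp: e_def)
  have "\<exists>\<sigma>. sect e q \<sigma>" if q: "q \<in> topspace M" for q
  proof -
    obtain p where p: "p \<in> C" "q \<in> B p" using C(3) q by auto
    then have pM: "p \<in> topspace M" using C(1) by blast
    have "Min ((\<lambda>p. \<epsilon> p / 2) ` C) \<le> \<epsilon> p / 2" by (rule Min_le) (use p C in auto)
    then have ep: "e \<le> \<epsilon> p / 2" unfolding e_def by (rule min.coboundedI2)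
    have sub: "ball (F q) e \<inter> cball 0 1 \<subseteq> ball (F p) (\<epsilon> p) \<inter> cball 0 1"
    proof
      fix x assume x: "x \<in> ball (F q) e \<inter> cball 0 1"
      have "dist (F p) x \<le> dist (F p) (F q) + dist (F q) x" by (rule dist_triangle)
      moreover have "dist (F p) (F q) < \<epsilon> p / 2" using p(2) by (simp add: B_def)
      ultimately show "x \<in> ball (F p) (\<epsilon> p) \<inter> cball 0 1" using x ep by auto
    qed
    let ?s = "\<sigma> p"
    obtain x where x: "x \<in> ball (F p) (\<epsilon> p) \<inter> cball 0 1" "q = ?s x" using p(2) by (auto simp: B_def)
    have "F q = x" using sectD(3)[OF \<sigma>[OF pM] x(1)] x(2) by simp
    moreover have "?s ` (ball (F q) e \<inter> cball 0 1)
        = ?s ` (ball (F p) (\<epsilon> p) \<inter> cball 0 1) \<inter> {q' \<in> topspace M. F q' \<in> ball (F q) e}"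
    proof (intro set_eqI iffI)
      fix z assume "z \<in> ?s ` (ball (F q) e \<inter> cball 0 1)"
      then obtain y where y: "y \<in> ball (F q) e \<inter> cball 0 1" "z = ?s y" by blast
      then show "z \<in> ?s ` (ball (F p) (\<epsilon> p) \<inter> cball 0 1) \<inter> {q' \<in> topspace M. F q' \<in> ball (F q) e}"
      proof -
        have yp: "y \<in> ball (F p) (\<epsilon> p) \<inter> cball 0 1" using y(1) sub by blast
        then have "?s y \<in> ?s ` (ball (F p) (\<epsilon> p) \<inter> cball 0 1)" by (rule imageI)
        then show ?thesis
          using sectD(3)[OF \<sigma>[OF pM] yp] openin_subset[OF sectD(4)[OF \<sigma>[OF pM]]] y by auto
      qed
    next
      fix z assume "z \<in> ?s ` (ball (F p) (\<epsilon> p) \<inter> cball 0 1) \<inter> {q' \<in> topspace M. F q' \<in> ball (F q) e}"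
      then obtain y where y: "y \<in> ball (F p) (\<epsilon> p) \<inter> cball 0 1" "z = ?s y" "F z \<in> ball (F q) e" by blast
      then show "z \<in> ?s ` (ball (F q) e \<inter> cball 0 1)" using sectD(3)[OF \<sigma>[OF pM] y(1)] by auto
    qed
    moreover have "openin M {q' \<in> topspace M. F q' \<in> ball (F q) e}"
      by (rule openin_continuous_map_preimage[OF cont]) auto
    ultimately have "sect e q ?s"
      unfolding sect_def
      using continuous_map_from_subtopology_mono[OF sectD(1)[OF \<sigma>[OF pM]] sub] x sub sectD(3,4)[OF \<sigma>[OF pM]]
      by (auto intro: openin_Int)
    then show ?thesis by blast
  qed
  then show ?thesis using e by blast
qed

section \<open>Radial pushing towards the fibre over 0\<close>

definition "e = (SOME e. 0 < e \<and> e \<le> 1 \<and> (\<forall>p\<in>topspace M. \<exists>\<sigma>. sect e p \<sigma>))"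
definition "\<tau> p = (SOME \<sigma>. sect e p \<sigma>)"
definition "K p = ball (F p) e \<inter> cball 0 1"

lemma e: "0 < e" "e \<le> 1"
  and \<tau>: "p \<in> topspace M \<Longrightarrow> sect e p (\<tau> p)"
proof -
  have *: "0 < e \<and> e \<le> 1 \<and> (\<forall>p\<in>topspace M. \<exists>\<sigma>. sect e p \<sigma>)"
    unfolding e_def by (rule someI_ex[OF uniform_radius])
  then show "0 < e" "e \<le> 1" by simp_all
  assume "p \<in> topspace M"
  with * have "\<exists>\<sigma>. sect e p \<sigma>" by simp
  then show "sect e p (\<tau> p)" unfolding \<tau>_def by (rule someI_ex)
qed

lemma \<tau>_cont: "p \<in> topspace M \<Longrightarrow> continuous_map (top_of_set (K p)) M (\<tau> p)"
  and \<tau>_base: "p \<in> topspace M \<Longrightarrow> \<tau> p (F p) = p"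
  and \<tau>_F: "p \<in> topspace M \<Longrightarrow> x \<in> K p \<Longrightarrow> F (\<tau> p x) = x"
  and \<tau>_open: "p \<in> topspace M \<Longrightarrow> openin M (\<tau> p ` K p)"
  using sectD[OF \<tau>] unfolding K_def by auto

lemma \<tau>_in: "p \<in> topspace M \<Longrightarrow> x \<in> K p \<Longrightarrow> \<tau> p x \<in> topspace M"
  using openin_subset[OF \<tau>_open] by blast

lemma \<tau>_agree:
  assumes pq: "p \<in> topspace M" "q \<in> topspace M" and C: "C \<subseteq> K p \<inter> K q" "connected C"
    and a: "a \<in> C" "\<tau> p a = \<tau> q a" and x: "x \<in> C"
  shows "\<tau> p x = \<tau> q x"
proof (rule unique_section[where \<sigma> = "\<tau> p" and \<tau> = "\<tau> q", OF _ _ _ _ C(2) a x])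
  show "continuous_map (top_of_set C) M (\<tau> p)" "continuous_map (top_of_set C) M (\<tau> q)"
    using continuous_map_from_subtopology_mono[OF \<tau>_cont] pq C(1) by auto
qed (use \<tau>_F pq C in auto)

lemma F_in_K: "p \<in> topspace M \<Longrightarrow> F p \<in> K p"
  using FK' e by (simp add: K_def)

text \<open>Every point is pushed radially towards the fibre over \<open>0\<close>; iterating the push retracts \<open>M\<close> into
  small disjoint neighbourhoods of the points of that fibre, so connectedness leaves only one of them.\<close>

definition "push p = \<tau> p ((1 - e / 2) *\<^sub>R F p)"

lemma scaled_norm:
  fixes x :: 'a
  shows "x \<in> cball 0 1 \<Longrightarrow> (1 - e / 2) *\<^sub>R x \<in> cball 0 1" "x \<in> cball 0 1 \<Longrightarrow> dist x ((1 - e / 2) *\<^sub>R x) \<le> e / 2"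
proof -
  assume x: "x \<in> cball 0 1"
  have "norm ((1 - e / 2) *\<^sub>R x) \<le> 1 * 1"
    unfolding norm_scaleR using e x by (intro mult_mono) auto
  then show "(1 - e / 2) *\<^sub>R x \<in> cball 0 1" by simp
  have "x - (1 - e / 2) *\<^sub>R x = (e / 2) *\<^sub>R x" by (simp add: algebra_simps)
  then have "dist x ((1 - e / 2) *\<^sub>R x) = e / 2 * norm x" using e by (simp add: dist_norm)
  also have "\<dots> \<le> e / 2" using e x by (simp add: mult_left_le)
  finally show "dist x ((1 - e / 2) *\<^sub>R x) \<le> e / 2" .
qed

text \<open>The factor 1 - e / 2 moves a point of the unit ball by at most e / 2, so from a start
  within e / 2 of \<open>F p\<close> the whole move stays in the domain of one section.\<close>

lemma segment_in_K:
  assumes p: "p \<in> topspace M" and x: "x \<in> cball 0 1" "dist (F p) x < e / 2"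
  shows "closed_segment x ((1 - e / 2) *\<^sub>R x) \<subseteq> K p"
proof -
  have "x \<in> K p" using x e by (simp add: K_def)
  moreover have "dist (F p) ((1 - e / 2) *\<^sub>R x) < e"
    using dist_triangle[of "F p" "(1 - e / 2) *\<^sub>R x" x] x scaled_norm(2)[OF x(1)] by simp
  then have "(1 - e / 2) *\<^sub>R x \<in> K p" using scaled_norm(1)[OF x(1)] by (simp add: K_def)
  moreover have "convex (K p)" unfolding K_def by (intro convex_Int convex_ball convex_cball)
  ultimately show ?thesis by (rule closed_segment_subset)
qed

lemma push_in: "p \<in> topspace M \<Longrightarrow> push p \<in> topspace M"
  and F_push: "p \<in> topspace M \<Longrightarrow> F (push p) = (1 - e / 2) *\<^sub>R F p"
proof -
  assume p: "p \<in> topspace M"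
  have "(1 - e / 2) *\<^sub>R F p \<in> K p"
    using segment_in_K[OF p FK'[OF p]] e by auto
  then show "push p \<in> topspace M" "F (push p) = (1 - e / 2) *\<^sub>R F p"
    unfolding push_def using \<tau>_in[OF p] \<tau>_F[OF p] by auto
qed

text \<open>The two sections agree at \<open>F q\<close>, hence along the segment. Points near
  \<open>p\<close> are thus pushed by one common section, and \<open>push\<close> is continuous
  although its sections are chosen independently.\<close>

lemma push_local:
  assumes p: "p \<in> topspace M" and q: "q \<in> \<tau> p ` K p" "dist (F p) (F q) < e / 2"
  shows "push q = \<tau> p ((1 - e / 2) *\<^sub>R F q)"
proof -
  obtain x where x: "x \<in> K p" "q = \<tau> p x" using q(1) by blast
  then have qM: "q \<in> topspace M" and Fq: "F q = x" using \<tau>_in[OF p] \<tau>_F[OF p] by auto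
  have Fq1: "F q \<in> cball 0 1" by (rule FK'[OF qM])
  let ?C = "closed_segment (F q) ((1 - e / 2) *\<^sub>R F q)"
  have "\<tau> q ((1 - e / 2) *\<^sub>R F q) = \<tau> p ((1 - e / 2) *\<^sub>R F q)"
  proof (rule \<tau>_agree[OF qM p, of ?C "F q"])
    show "?C \<subseteq> K q \<inter> K p"
      using segment_in_K[OF qM Fq1] segment_in_K[OF p Fq1 q(2)] e by auto
    show "\<tau> q (F q) = \<tau> p (F q)" using \<tau>_base[OF qM] x Fq by simp
  qed auto
  then show ?thesis by (simp add: push_def)
qed

lemma push_cont: "continuous_map M M push"
  unfolding continuous_map_eq_topcontinuous_at
proof
  fix p assume p: "p \<in> topspace M"
  define A where "A = \<tau> p ` K p \<inter> {q \<in> topspace M. F q \<in> ball (F p) (e / 2)}"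
  have "openin M {q \<in> topspace M. F q \<in> ball (F p) (e / 2)}"
    by (rule openin_continuous_map_preimage[OF cont]) auto
  then have A: "openin M A" unfolding A_def by (rule openin_Int[OF \<tau>_open[OF p]])
  have pA: "p \<in> A"
    using p e F_in_K[OF p] \<tau>_base[OF p] by (auto simp: A_def intro: rev_image_eqI)
  have "continuous_map (subtopology M A) M (\<lambda>q. \<tau> p ((1 - e / 2) *\<^sub>R F q))"
  proof (rule continuous_map_compose[OF _ \<tau>_cont[OF p], unfolded o_def])
    have "continuous_map (subtopology M A) euclidean (\<lambda>q. (1 - e / 2) *\<^sub>R F q)"
      using continuous_map_compose[OF continuous_map_from_subtopology[OF cont], of euclidean "\<lambda>x. (1 - e / 2) *\<^sub>R x" A]
      by (simp add: o_def continuous_intros)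
    moreover have "(1 - e / 2) *\<^sub>R F q \<in> K p" if "q \<in> A" for q
    proof -
      have "q \<in> topspace M" "dist (F p) (F q) < e / 2" using that by (auto simp: A_def)
      then show ?thesis using segment_in_K[OF p FK', of q] by auto
    qed
    ultimately show "continuous_map (subtopology M A) (top_of_set (K p)) (\<lambda>q. (1 - e / 2) *\<^sub>R F q)"
      by (auto simp: continuous_map_in_subtopology)
  qed
  then have "continuous_map (subtopology M A) M push"
    by (rule continuous_map_eq) (auto simp: A_def push_local[OF p])
  then have "topcontinuous_at (subtopology M A) M push p"
    using p pA by (simp add: continuous_map_eq_topcontinuous_at)
  then show "topcontinuous_at M M push p"
    unfolding topcontinuous_at_def using p push_in openin_trans_full[OF _ A]
    by (intro conjI allI impI) (simp_all, meson)
qed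

lemma push_zero: "p \<in> topspace M \<Longrightarrow> F p = 0 \<Longrightarrow> push p = p"
  using \<tau>_base[of p] by (simp add: push_def)

lemma iterate_push: "p \<in> topspace M \<Longrightarrow> (push ^^ k) p \<in> topspace M \<and> F ((push ^^ k) p) = ((1 - e / 2) ^ k) *\<^sub>R F p"
  by (induction k) (auto simp: push_in F_push)

lemma small_iterate: "\<exists>k. \<forall>p\<in>topspace M. norm (F ((push ^^ k) p)) < e"
proof -
  obtain k where k: "(1 - e / 2) ^ k < e" using real_arch_pow_inv[of e "1 - e / 2"] e by auto
  have "norm (F ((push ^^ k) p)) < e" if p: "p \<in> topspace M" for p
  proof -
    have "norm (F ((push ^^ k) p)) = (1 - e / 2) ^ k * norm (F p)"
      using iterate_push[OF p] e by simp
    also have "\<dots> \<le> (1 - e / 2) ^ k * 1" using FK'[OF p] e by (intro mult_left_mono) auto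
    finally show ?thesis using k by simp
  qed
  then show ?thesis by blast
qed

text \<open>Once \<open>norm (F q) < e\<close>, the section at \<open>q\<close> is defined over 0.
  Its value there is the required \<open>z\<close>, and the sections at \<open>q\<close> and
  \<open>z\<close> agree along the segment from 0 to \<open>F q\<close>.\<close>

lemma near_zero:
  assumes q: "q \<in> topspace M" "norm (F q) < e"
  shows "\<exists>z\<in>topspace M. F z = 0 \<and> F q \<in> K z \<and> q = \<tau> z (F q)"
proof -
  have K0: "0 \<in> K q" using q by (simp add: K_def)
  define z where "z = \<tau> q 0"
  have z: "z \<in> topspace M" "F z = 0" using \<tau>_in[OF q(1) K0] \<tau>_F[OF q(1) K0] by (auto simp: z_def)
  have Kz: "F q \<in> K z" "0 \<in> K z" using q FK'[OF q(1)] e z by (auto simp: K_def)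
  let ?C = "closed_segment 0 (F q)"
  have conv: "convex (K p)" for p unfolding K_def by (intro convex_Int convex_ball convex_cball)
  have "\<tau> q (F q) = \<tau> z (F q)"
  proof (rule \<tau>_agree[OF q(1) z(1), of ?C 0])
    show "?C \<subseteq> K q \<inter> K z"
      using closed_segment_subset[OF K0 F_in_K[OF q(1)] conv] closed_segment_subset[OF Kz(2,1) conv] by blast
    show "\<tau> q 0 = \<tau> z 0" using \<tau>_base[OF z(1)] z by (simp add: z_def)
  qed auto
  then show ?thesis using z Kz \<tau>_base[OF q(1)] by (intro bexI[of _ z]) auto
qed

lemma unique_zero:
  assumes z: "z1 \<in> topspace M" "F z1 = 0" "z2 \<in> topspace M" "F z2 = 0"
  shows "z1 = z2"
proof (rule ccontr)
  assume ne: "z1 \<noteq> z2"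
  obtain k where k: "\<And>p. p \<in> topspace M \<Longrightarrow> norm (F ((push ^^ k) p)) < e" using small_iterate by blast
  let ?A = "\<tau> z1 ` K z1" and ?B = "\<Union>z\<in>{z \<in> topspace M. F z = 0 \<and> z \<noteq> z1}. \<tau> z ` K z"
  have "continuous_map M M (push ^^ k)"
  proof (induction k)
    case (Suc k)
    show ?case unfolding funpow.simps by (rule continuous_map_compose[OF Suc push_cont])
  qed simp
  then have con: "connectedin M ((push ^^ k) ` topspace M)"
    using connectedin_continuous_map_image conn connectedin_topspace by blast
  have op: "openin M ?A" "openin M ?B" using \<tau>_open z by auto
  have sub: "(push ^^ k) ` topspace M \<subseteq> ?A \<union> ?B"
  proof
    fix q assume "q \<in> (push ^^ k) ` topspace M"
    then have "q \<in> topspace M" "norm (F q) < e" using k iterate_push by auto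
    from near_zero[OF this] obtain z where "z \<in> topspace M" "F z = 0" "F q \<in> K z" "q = \<tau> z (F q)" by blast
    then show "q \<in> ?A \<union> ?B" by (cases "z = z1") (blast intro: rev_image_eqI)+
  qed
  have disj: "?A \<inter> ?B = {}"
  proof (rule ccontr)
    assume "?A \<inter> ?B \<noteq> {}"
    then obtain x y z' where *: "x \<in> K z1" "y \<in> K z'" "\<tau> z1 x = \<tau> z' y" "z' \<in> topspace M" "F z' = 0" "z' \<noteq> z1"
      by blast
    have "x = y" using \<tau>_F[OF z(1) *(1)] \<tau>_F[OF *(4,2)] *(3) by simp
    have KK: "K z' = K z1" using z * by (simp add: K_def)
    have "connected (K z1)" unfolding K_def by (intro convex_connected convex_Int convex_ball convex_cball)
    then have "\<tau> z1 0 = \<tau> z' 0"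
      using \<tau>_agree[OF z(1) *(4), of "K z1" x 0] * KK \<open>x = y\<close> F_in_K[OF z(1)] z by auto
    then show False using \<tau>_base[OF z(1)] \<tau>_base[OF *(4)] z * by simp
  qed
  \<comment> \<open>Points over 0 are fixed by \<open>push\<close>, so both zeros lie in the
    connected image and the two open sets would separate it.\<close>
  have "(push ^^ k) z = z" if "z \<in> topspace M" "F z = 0" for z
    using that by (induction k) (auto simp: push_zero)
  then have zz: "z1 \<in> (push ^^ k) ` topspace M" "z2 \<in> (push ^^ k) ` topspace M"
    using z by (metis imageI)+
  have self: "z \<in> \<tau> z ` K z" if "z \<in> topspace M" for z
    using imageI[OF F_in_K[OF that], of "\<tau> z"] \<tau>_base[OF that] by simp
  have "z1 \<in> ?A" "z2 \<in> ?B" using self[OF z(1)] self[OF z(3)] z ne by auto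
  then have "?A \<inter> (push ^^ k) ` topspace M \<noteq> {}" "?B \<inter> (push ^^ k) ` topspace M \<noteq> {}"
    using zz by blast+
  moreover have "?A \<inter> ?B \<inter> (push ^^ k) ` topspace M = {}" using disj by simp
  ultimately show False using connectedinD[OF con op sub] by simp
qed

text \<open>Within a fibre of \<open>F\<close> a push is injective, by agreement of sections along
  the segment. After enough pushes both points lie on the sheet of the unique zero, where
  \<open>F\<close> determines the point.\<close>

lemma inj: "inj_on F (topspace M)"
proof (rule inj_onI)
  fix p q assume pq: "p \<in> topspace M" "q \<in> topspace M" "F p = F q"
  have push_inj: "p = q" if "p \<in> topspace M" "q \<in> topspace M" "F p = F q" "push p = push q" for p q
  proof -
    let ?C = "closed_segment (F p) ((1 - e / 2) *\<^sub>R F p)"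
    have "\<tau> p (F p) = \<tau> q (F p)"
    proof (rule \<tau>_agree[OF that(1,2), of ?C "(1 - e / 2) *\<^sub>R F p"])
      show "?C \<subseteq> K p \<inter> K q"
        using segment_in_K[OF that(1) FK'[OF that(1)]] segment_in_K[OF that(2) FK'[OF that(1)]] that(3) e by auto
      show "\<tau> p ((1 - e / 2) *\<^sub>R F p) = \<tau> q ((1 - e / 2) *\<^sub>R F p)"
        using that(3,4) by (simp add: push_def)
    qed auto
    then show ?thesis using \<tau>_base that by metis
  qed
  have iter: "p = q" if "p \<in> topspace M" "q \<in> topspace M" "F p = F q" "(push ^^ k) p = (push ^^ k) q" for p q k
    using that
  proof (induction k arbitrary: p q)
    case (Suc k)
    have "push p = push q"
      by (rule Suc.IH) (use Suc.prems in \<open>auto simp: push_in F_push funpow_swap1\<close>)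
    then show ?case using push_inj Suc.prems by blast
  qed simp
  obtain k where k: "\<And>p. p \<in> topspace M \<Longrightarrow> norm (F ((push ^^ k) p)) < e" using small_iterate by blast
  let ?p = "(push ^^ k) p" and ?q = "(push ^^ k) q"
  have in': "?p \<in> topspace M" "?q \<in> topspace M" and FF: "F ?p = F ?q" using iterate_push pq by auto
  obtain z where z: "z \<in> topspace M" "F z = 0" "?p = \<tau> z (F ?p)" using near_zero[OF in'(1) k[OF pq(1)]] by blast
  obtain z' where z': "z' \<in> topspace M" "F z' = 0" "?q = \<tau> z' (F ?q)" using near_zero[OF in'(2) k[OF pq(2)]] by blast
  have "z = z'" by (rule unique_zero[OF z(1,2) z'(1,2)])
  then have "?p = ?q" using z(3) z'(3) FF by simp
  then show "p = q" using iter pq by blast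
qed

lemma image: "F ` topspace M = cball 0 1"
proof -
  let ?I = "F ` topspace M"
  have "compactin M (topspace M)" using comp by (simp add: compact_space_def)
  then have "compact ?I" using image_compactin[OF _ cont] by auto
  then have "closedin (top_of_set (cball 0 1)) ?I"
    using FK by (simp add: closed_subset compact_imp_closed)
  moreover have "openin (top_of_set (cball 0 1)) ?I"
  proof (subst openin_subopen, intro ballI)
    fix x assume "x \<in> ?I"
    then obtain p where p: "p \<in> topspace M" "x = F p" by blast
    have "openin (top_of_set (cball 0 1)) (K p)"
      unfolding K_def by (simp add: Int_commute openin_open_Int)
    moreover have "K p \<subseteq> ?I" using \<tau>_in[OF p(1)] \<tau>_F[OF p(1)] by (metis image_eqI subsetI)
    ultimately show "\<exists>T. openin (top_of_set (cball 0 1)) T \<and> x \<in> T \<and> T \<subseteq> ?I"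
      using F_in_K[OF p(1)] p(2) by blast
  qed
  ultimately have "?I = {} \<or> ?I = cball 0 1"
    using convex_connected[OF convex_cball[of "0::'a" 1]] unfolding connected_clopen by blast
  then show ?thesis using ne by blast
qed

lemma homeomorphic: "homeomorphic_map M (top_of_set (cball 0 1)) F"
proof (rule continuous_imp_homeomorphic_map[OF _ comp])
  show "Hausdorff_space (top_of_set (cball (0::'a) 1))" by (simp add: Hausdorff_space_subtopology)
  show "continuous_map M (top_of_set (cball 0 1)) F" using cont FK by (auto simp: continuous_map_in_subtopology)
  show "F ` topspace M = topspace (top_of_set (cball 0 1))" using image by simp
qed (rule inj)

end

section \<open>Hypersurfaces with constant normal\<close>

text \<open>The inverse function theorem supplies a local inverse with invertible differentials on a
  whole neighbourhood; \<open>Ck_on_inverse_map\<close> then gives all higher regularity.\<close>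

lemma smooth_local_inverse:
  fixes H :: "real ^ 'n::finite \<Rightarrow> real ^ 'n"
  assumes V: "open V" "y0 \<in> V" and C: "\<And>k. Ck_on k V H" and inj: "inj (frechet_derivative H (at y0))"
  obtains A B g where "open A" "y0 \<in> A" "A \<subseteq> V" "open B" "homeomorphism A B H g" "\<And>k. Ck_on k B g"
proof -
  define H' where "H' x = Blinfun (frechet_derivative H (at x))" for x
  have bl: "bounded_linear (frechet_derivative H (at x))" if "x \<in> V" for x
    using Ck_on_has_derivative[OF C that] has_derivative_bounded_linear by blast
  have H': "blinfun_apply (H' x) = frechet_derivative H (at x)" if "x \<in> V" for x
    unfolding H'_def by (rule bounded_linear_Blinfun_apply[OF bl[OF that]])
  obtain k where k: "linear k" "k \<circ> frechet_derivative H (at y0) = id"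
    using linear_injective_left_inverse[OF bounded_linear.linear[OF bl[OF V(2)]] inj] by blast
  have kb: "blinfun_apply (Blinfun k) = k"
    using k(1) by (intro bounded_linear_Blinfun_apply) (simp add: linear_conv_bounded_linear)
  have cont: "continuous_on V H'"
  proof (rule continuous_on_blinfun_componentwise)
    fix i :: "real ^ 'n"
    have "Ck_on 0 V (\<lambda>x. frechet_derivative H (at x) i)" by (rule Ck_on_Suc_deriv[OF C])
    then show "continuous_on V (\<lambda>x. blinfun_apply (H' x) i)"
      by (simp add: H' cong: continuous_on_cong)
  qed
  have der: "(H has_derivative blinfun_apply (H' x)) (at x)" if "x \<in> V" for x
    using Ck_on_has_derivative[OF C that] by (simp add: H'[OF that])
  have inv: "Blinfun k o\<^sub>L H' y0 = id_blinfun"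
    by (rule blinfun_eqI) (use k(2) in \<open>simp add: H'[OF V(2)] kb fun_eq_iff\<close>)
  obtain A B g g' where *: "open A" "A \<subseteq> V" "y0 \<in> A" "open B" "homeomorphism A B H g"
    "\<And>y. y \<in> B \<Longrightarrow> bij (blinfun_apply (H' (g y)))"
    using inverse_function_theorem[OF V(1) der cont V(2) inv] by metis
  have "inj (frechet_derivative H (at x))" if "x \<in> A" for x
  proof -
    have "H x \<in> B" "g (H x) = x" using *(5) that by (auto simp: homeomorphism_def)
    then have "bij (blinfun_apply (H' x))" using *(6) by metis
    then show ?thesis using H'[of x] that *(2) by (auto simp: bij_def)
  qed
  then have "Ck_on k B g" for k
    using Ck_on_inverse_map[OF *(1,4,5) Ck_on_subset[OF C *(2)]] by blast
  then show ?thesis using that * by blast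
qed

text \<open>The image lies in the hyperplane orthogonal to \<open>e\<close>, which \<open>L\<close>
  identifies with n-dimensional space; \<open>L\<close> is isometric on that hyperplane
  only.\<close>

locale planar_hypersurface = immersed_in_ball M \<A> f r0
  for M :: "'p topology" and \<A> :: "('p set \<times> ('p \<Rightarrow> real ^ 'n::finite)) set"
    and f :: "'p \<Rightarrow> real ^ 'm::finite" and r0 :: real +
  fixes e :: "real ^ 'm" and L :: "real ^ 'm \<Rightarrow> real ^ 'n"
  assumes Ne: "\<And>p. p \<in> topspace M \<Longrightarrow> N p = e \<or> N p = - e"
    and fe: "\<And>p. p \<in> topspace M \<Longrightarrow> f p \<bullet> e = 0"
    and linL: "linear L" and isoL: "\<And>v. v \<bullet> e = 0 \<Longrightarrow> norm (L v) = norm v"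
    and nonempty: "topspace M \<noteq> {}" and connected: "connected_space M"
begin

definition F :: "'p \<Rightarrow> real ^ 'n" where
  "F p = (1 / r0) *\<^sub>R L (f p)"

lemma norm_F: "p \<in> topspace M \<Longrightarrow> norm (F p) = norm (f p) / r0"
  using r0 by (simp add: F_def isoL fe)

lemma F_cball: "p \<in> topspace M \<Longrightarrow> F p \<in> cball 0 1"
  using norm_F norm_f_le r0 by simp

lemma F_bdry: "p \<in> topspace M \<Longrightarrow> p \<in> manifold_boundary \<A> \<Longrightarrow> norm (F p) = 1"
  using norm_F bd_sphere r0 by simp

lemma bounded_linear_scaled_L: "bounded_linear (\<lambda>v. (1 / r0) *\<^sub>R L v)"
  using linL by (simp add: linear_conv_bounded_linear bounded_linear_scaleR_right[THEN bounded_linear_compose])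

lemma continuous_F: "continuous_map M euclidean F"
proof -
  have "continuous_map euclidean euclidean (\<lambda>v. (1 / r0) *\<^sub>R L v)"
    using linear_continuous_on[OF bounded_linear_scaled_L] by simp
  then show ?thesis
    using continuous_map_compose[OF continuous_f, of euclidean] by (simp add: F_def[abs_def] o_def)
qed

text \<open>The tangent space at \<open>p\<close> is orthogonal to \<open>e\<close>, where
  \<open>L\<close> is isometric. So the extended parametrization keeps an injective differential
  after \<open>L\<close>, now between spaces of equal dimension, and is invertible also across a
  boundary point.\<close>

lemma chart_inverse:
  assumes c: "(U, \<phi>) \<in> \<A>" "p \<in> U"
  obtains A B g H where "open A" "\<phi> p \<in> A" "half_space \<inter> A \<subseteq> \<phi> ` U" "open B" "homeomorphism A B H g"
    "\<And>k. Ck_on k B g" "\<And>q. q \<in> U \<Longrightarrow> \<phi> q \<in> A \<Longrightarrow> F q = H (\<phi> q)"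
proof -
  obtain V G \<nu> where P: "chart_patch V G \<nu> (\<phi> ` U) (in_chart f U \<phi>)" "\<phi> p \<in> V" "half_space \<inter> V \<subseteq> \<phi> ` U"
    using chart_patch_exists[OF c] by metis
  interpret P: chart_patch V G \<nu> "\<phi> ` U" "in_chart f U \<phi>" by (rule P)
  define H where "H y = (1 / r0) *\<^sub>R L (G y)" for y
  have CH: "Ck_on k V H" for k
    unfolding H_def[abs_def] by (rule Ck_on_bounded_linear[OF bounded_linear_scaled_L P.op P.C])
  let ?D = "frechet_derivative G (at (\<phi> p))"
  have "(H has_derivative (\<lambda>v. (1 / r0) *\<^sub>R L (?D v))) (at (\<phi> p))"
    unfolding H_def[abs_def]
    by (rule bounded_linear.has_derivative[OF bounded_linear_scaled_L Ck_on_has_derivative[OF P.C P(2)]])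
  then have DH: "frechet_derivative H (at (\<phi> p)) = (\<lambda>v. (1 / r0) *\<^sub>R L (?D v))"
    using frechet_derivative_at by metis
  have pM: "p \<in> topspace M" using c chart_subset by blast
  have De: "?D v \<bullet> e = 0" for v
  proof -
    have "?D v \<bullet> \<nu> (\<phi> p) = 0"
      by (simp add: P.deriv_expand[OF P(2)] inner_sum_left P.normal'[OF P(2)])
    moreover have "e = \<nu> (\<phi> p) \<or> e = - \<nu> (\<phi> p)"
      using N_chart[OF c(1) P(1) c(2) P(2)] Ne[OF pM] by (metis minus_minus)
    ultimately show ?thesis by auto
  qed
  have "inj (frechet_derivative H (at (\<phi> p)))"
  proof (rule injI)
    fix v w assume "frechet_derivative H (at (\<phi> p)) v = frechet_derivative H (at (\<phi> p)) w"
    then have "L (?D v) = L (?D w)" using r0 by (simp add: DH)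
    then have "norm (L (?D (v - w))) = 0"
      using linL P.lin[OF P(2)] by (simp add: linear_diff)
    then have "norm (?D (v - w)) = 0" using isoL[OF De] by simp
    then have "?D v = ?D w" using P.lin[OF P(2)] by (simp add: linear_diff)
    then show "v = w" using P.inj[OF P(2)] by (simp add: inj_eq)
  qed
  then obtain A B g where *: "open A" "\<phi> p \<in> A" "A \<subseteq> V" "open B" "homeomorphism A B H g" "\<And>k. Ck_on k B g"
    using smooth_local_inverse[OF P.op P(2) CH] by metis
  have "F q = H (\<phi> q)" if "q \<in> U" "\<phi> q \<in> A" for q
    using P.FG[of "\<phi> q"] in_chart_eq[OF c(1) that(1)] that *(3) by (auto simp: F_def H_def)
  moreover have "half_space \<inter> A \<subseteq> \<phi> ` U" using P(3) *(3) by blast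
  ultimately show ?thesis using that * by blast
qed

lemma half_space_pos_open: "open {y :: real ^ 'n. 0 < y $ bdry_coord}"
  by (intro open_Collect_less continuous_intros)

lemma image_open:
  assumes "homeomorphism A B H g" "open A" "open B" "open T"
  shows "open (H ` (A \<inter> T))"
proof -
  have "openin (top_of_set A) (A \<inter> T)" using assms(4) by (simp add: openin_open_Int)
  then have "openin (top_of_set B) (H ` (A \<inter> T))" by (rule homeomorphism_imp_open_map[OF assms(1)])
  then show ?thesis using assms(3) openin_open_eq by blast
qed

text \<open>A neighbourhood of the point has an open image inside the closed ball, hence inside its
  interior.\<close>

lemma interior_point:
  assumes c: "(U, \<phi>) \<in> \<A>" "p \<in> U" and pos: "0 < \<phi> p $ bdry_coord"
  shows "norm (F p) < 1"
proof -
  obtain A B g H where A: "open A" "\<phi> p \<in> A" "half_space \<inter> A \<subseteq> \<phi> ` U" "open B" "homeomorphism A B H g"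
    "\<And>q. q \<in> U \<Longrightarrow> \<phi> q \<in> A \<Longrightarrow> F q = H (\<phi> q)"
    using chart_inverse[OF c] by metis
  let ?I = "H ` (A \<inter> {y. 0 < y $ bdry_coord})"
  have "open ?I" by (rule image_open[OF A(5,1,4) half_space_pos_open])
  moreover have "?I \<subseteq> cball 0 1"
  proof
    fix x assume "x \<in> ?I"
    then obtain y where y: "y \<in> A" "0 < y $ bdry_coord" "x = H y" by blast
    then have "y \<in> half_space \<inter> A" by (simp add: half_space_def)
    then obtain q where q: "q \<in> U" "y = \<phi> q" using A(3) by blast
    then have "q \<in> topspace M" using chart_subset[OF c(1)] by blast
    then show "x \<in> cball 0 1" using F_cball A(6)[OF q(1)] q y by metis
  qed
  ultimately have "?I \<subseteq> interior (cball 0 1)" by (rule interior_maximal[rotated])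
  moreover have "F p \<in> ?I" using A(2) A(6)[OF c(2)] pos by auto
  ultimately show ?thesis by (auto simp: interior_cball)
qed

text \<open>Near a boundary point the image of the local inverse over the open unit ball is connected and
  avoids the boundary of the half-space, which is mapped to the unit sphere.\<close>

lemma local_structure:
  assumes c: "(U, \<phi>) \<in> \<A>" "p \<in> U"
  obtains \<epsilon> g where "\<epsilon> > 0" "\<And>k. Ck_on k (ball (F p) \<epsilon>) g" "g (F p) = \<phi> p"
    "\<And>x. x \<in> ball (F p) \<epsilon> \<inter> cball 0 1 \<Longrightarrow> g x \<in> \<phi> ` U \<and> F (inv_into U \<phi> (g x)) = x"
    "openin M ((\<lambda>x. inv_into U \<phi> (g x)) ` (ball (F p) \<epsilon> \<inter> cball 0 1))"
proof -
  obtain A B g H where A: "open A" "\<phi> p \<in> A" "half_space \<inter> A \<subseteq> \<phi> ` U" "open B" "homeomorphism A B H g"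
    and Cg: "\<And>k. Ck_on k B g" and FH: "\<And>q. q \<in> U \<Longrightarrow> \<phi> q \<in> A \<Longrightarrow> F q = H (\<phi> q)"
    using chart_inverse[OF c] by metis
  have gH: "\<And>y. y \<in> A \<Longrightarrow> H y \<in> B \<and> g (H y) = y" and Hg: "\<And>x. x \<in> B \<Longrightarrow> g x \<in> A \<and> H (g x) = x"
    using A(5) by (auto simp: homeomorphism_def)
  have Fp: "F p = H (\<phi> p)" using FH c(2) A(2) by blast
  have hs: "\<phi> p \<in> half_space" using chart_image[OF c(1)] c(2) openin_imp_subset by blast
  let ?pos = "{y :: real ^ 'n. 0 < y $ bdry_coord}"
  \<comment> \<open>At an interior point the radius is taken so small that the local inverse meets
    only the interior of the half-space.\<close>
  obtain \<epsilon> where \<epsilon>: "\<epsilon> > 0" "ball (F p) \<epsilon> \<subseteq> B"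
    and int: "0 < \<phi> p $ bdry_coord \<Longrightarrow> ball (F p) \<epsilon> \<subseteq> H ` (A \<inter> ?pos)"
  proof (cases "0 < \<phi> p $ bdry_coord")
    case True
    have "open (H ` (A \<inter> ?pos))" by (rule image_open[OF A(5,1,4) half_space_pos_open])
    moreover have "F p \<in> H ` (A \<inter> ?pos)" using True A(2) Fp by blast
    ultimately obtain d where "d > 0" "ball (F p) d \<subseteq> H ` (A \<inter> ?pos)" using open_contains_ball by blast
    moreover have "H ` (A \<inter> ?pos) \<subseteq> B" using gH by blast
    ultimately show ?thesis using that[of d] by blast
  next
    case False
    have "F p \<in> B" using gH A(2) Fp by metis
    then obtain d where "d > 0" "ball (F p) d \<subseteq> B" using A(4) open_contains_ball by blast
    then show ?thesis using that[of d] False by blast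
  qed
  let ?B = "ball (F p) \<epsilon>"
  have cg: "continuous_on ?B (\<lambda>x. g x $ bdry_coord)"
    by (intro continuous_intros continuous_on_subset[OF Ck_on_imp_continuous[OF Cg]] \<epsilon>)
  have inh: "g x \<in> half_space" if x: "x \<in> ?B \<inter> cball 0 1" for x
  proof (cases "0 < \<phi> p $ bdry_coord")
    case True
    then obtain y where "y \<in> A" "0 < y $ bdry_coord" "x = H y" using int x by blast
    then show ?thesis using gH[of y] by (simp add: half_space_def)
  next
    case False
    then have "\<phi> p $ bdry_coord = 0" using hs by (simp add: half_space_def)
    let ?C = "?B \<inter> ball 0 1" and ?h = "\<lambda>x. g x $ bdry_coord"
    have conC: "connected (?h ` ?C)"
      by (intro connected_continuous_image continuous_on_subset[OF cg] convex_connected convex_Int convex_ball) auto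
    have nz: "?h x \<noteq> 0" if x: "x \<in> ?C" for x
    proof
      assume z: "?h x = 0"
      have xB: "x \<in> B" using x \<epsilon> by blast
      then have "g x \<in> half_space \<inter> A" using z Hg by (simp add: half_space_def)
      then obtain q where q: "q \<in> U" "g x = \<phi> q" using A(3) by blast
      then have "q \<in> manifold_boundary \<A>" using boundaryI[OF c(1)] z by simp
      then have "norm (F q) = 1" using F_bdry q(1) chart_subset[OF c(1)] by blast
      moreover have "F q = x" using FH[OF q(1)] q(2) Hg[OF xB] by simp
      ultimately show False using x by simp
    qed
    \<comment> \<open>A short step from the boundary point into the half-space; by
      \<open>interior_point\<close> it lands over the open ball and thus fixes the sign.\<close>
    obtain b where b: "b \<in> ?C" "0 < ?h b"
    proof -
      have "open (A \<inter> H -` ?B)"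
        by (rule continuous_open_preimage) (use A(1,5) in \<open>auto simp: homeomorphism_def\<close>)
      moreover have "\<phi> p \<in> A \<inter> H -` ?B" using A(2) Fp \<epsilon>(1) by simp
      ultimately obtain d where d: "d > 0" "\<And>\<tau>. \<bar>\<tau>\<bar> < d \<Longrightarrow> \<phi> p + \<tau> *\<^sub>R axis bdry_coord 1 \<in> A \<inter> H -` ?B"
        using line_in_open by metis
      let ?y = "\<phi> p + (d / 2) *\<^sub>R axis bdry_coord 1"
      have y: "?y \<in> A" "H ?y \<in> ?B" using d(2)[of "d / 2"] d(1) by auto
      have yp: "0 < ?y $ bdry_coord" using \<open>\<phi> p $ bdry_coord = 0\<close> d(1) by simp
      then have "?y \<in> half_space \<inter> A" using y by (simp add: half_space_def)
      then obtain q where q: "q \<in> U" "?y = \<phi> q" using A(3) by blast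
      have "norm (F q) < 1" by (rule interior_point[OF c(1) q(1)]) (use q yp in simp)
      then have "H ?y \<in> ?C" using FH[OF q(1)] q(2) y by simp
      moreover have "?h (H ?y) > 0" using gH[OF y(1)] yp by simp
      ultimately show ?thesis using that by blast
    qed
    have pos: "?h x > 0" if "x \<in> ?C" for x
    proof (rule ccontr)
      assume "\<not> ?h x > 0"
      then have "?h x \<le> 0" "0 \<le> ?h b" using b(2) by auto
      then have "0 \<in> ?h ` ?C"
        using connectedD_interval[OF conC] that b(1) by blast
      then show False using nz by force
    qed
    \<comment> \<open>Points of the unit sphere are reached as limits of the points (1 - \<tau>) x
      of the open ball.\<close>
    have "?h x \<ge> 0"
    proof -
      obtain d where d: "d > 0" "\<And>\<tau>. \<bar>\<tau>\<bar> < d \<Longrightarrow> x + \<tau> *\<^sub>R (- x) \<in> ?B"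
        using line_in_open[of ?B x "- x"] x by (metis IntD1 open_ball)
      have "continuous_on ?B (\<lambda>x. g x $ bdry_coord)" by (rule cg)
      then have "isCont ?h x" using x by (simp add: continuous_on_eq_continuous_at)
      then have "((\<lambda>\<tau>. ?h (x + \<tau> *\<^sub>R (- x))) \<longlongrightarrow> ?h (x + 0 *\<^sub>R (- x))) (at_right 0)"
        by (intro isCont_tendsto_compose[of _ ?h] tendsto_intros) simp
      moreover have "eventually (\<lambda>\<tau>. 0 \<le> ?h (x + \<tau> *\<^sub>R (- x))) (at_right 0)"
        unfolding eventually_at_right_field
      proof (intro exI conjI allI impI)
        show "0 < min d 1" using d(1) by simp
        fix \<tau> :: real assume \<tau>: "0 < \<tau>" "\<tau> < min d 1"
        have "x + \<tau> *\<^sub>R (- x) = (1 - \<tau>) *\<^sub>R x" by (simp add: algebra_simps)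
        then have "norm (x + \<tau> *\<^sub>R (- x)) = (1 - \<tau>) * norm x" using \<tau> by simp
        also have "\<dots> \<le> (1 - \<tau>) * 1" using x \<tau> by (intro mult_left_mono) auto
        finally have "x + \<tau> *\<^sub>R (- x) \<in> ?C" using d(2)[of \<tau>] \<tau> by simp
        then show "0 \<le> ?h (x + \<tau> *\<^sub>R (- x))" using pos by (simp add: less_imp_le)
      qed
      ultimately have "0 \<le> ?h (x + 0 *\<^sub>R (- x))"
        by (rule tendsto_lowerbound) simp
      then show ?thesis by simp
    qed
    then show ?thesis by (simp add: half_space_def)
  qed
  have gx: "g x \<in> \<phi> ` U \<and> F (inv_into U \<phi> (g x)) = x" if x: "x \<in> ?B \<inter> cball 0 1" for x
  proof -
    have xB: "x \<in> B" using x \<epsilon> by blast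
    then have "g x \<in> \<phi> ` U" using inh[OF x] Hg A(3) by blast
    moreover from this have "F (inv_into U \<phi> (g x)) = H (g x)"
      using FH[of "inv_into U \<phi> (g x)"] Hg[OF xB] by (simp add: inv_into_into f_inv_into_f)
    ultimately show ?thesis using Hg[OF xB] by simp
  qed
  have "(\<lambda>x. inv_into U \<phi> (g x)) ` (?B \<inter> cball 0 1) = {q \<in> U. \<phi> q \<in> A \<inter> H -` ?B}"
  proof (intro set_eqI iffI)
    fix q assume "q \<in> (\<lambda>x. inv_into U \<phi> (g x)) ` (?B \<inter> cball 0 1)"
    then obtain x where x: "x \<in> ?B \<inter> cball 0 1" "q = inv_into U \<phi> (g x)" by blast
    then have "q \<in> U" "\<phi> q = g x" using gx[OF x(1)] by (auto simp: inv_into_into f_inv_into_f)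
    moreover have "x \<in> B" using x \<epsilon> by blast
    ultimately show "q \<in> {q \<in> U. \<phi> q \<in> A \<inter> H -` ?B}" using Hg[of x] x(1) by simp
  next
    fix q assume q: "q \<in> {q \<in> U. \<phi> q \<in> A \<inter> H -` ?B}"
    then have "F q = H (\<phi> q)" "q \<in> topspace M" using FH chart_subset[OF c(1)] by auto
    moreover have "inv_into U \<phi> (g (H (\<phi> q))) = q"
      using q gH[of "\<phi> q"] chart_inj[OF c(1)] by (simp add: inv_into_f_f)
    ultimately show "q \<in> (\<lambda>x. inv_into U \<phi> (g x)) ` (?B \<inter> cball 0 1)"
      using q F_cball[of q] by (intro image_eqI[of _ _ "H (\<phi> q)"]) auto
  qed
  moreover have "openin M {q \<in> U. \<phi> q \<in> A \<inter> H -` ?B}"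
    by (rule chart_nbhd_open[OF c(1)], rule continuous_open_preimage)
       (use A(1,5) in \<open>auto simp: homeomorphism_def\<close>)
  moreover have "g (F p) = \<phi> p" using gH[OF A(2)] Fp by simp
  ultimately show ?thesis
    using that[of \<epsilon> g] \<epsilon>(1) gx Ck_on_subset[OF Cg \<epsilon>(2)] by simp
qed

lemma chart_inv_continuous:
  assumes "(U, \<phi>) \<in> \<A>"
  shows "continuous_map (top_of_set (\<phi> ` U)) M (inv_into U \<phi>)"
proof -
  have "U = topspace (subtopology M U)" using chart_subset[OF assms] by auto
  moreover obtain g where g: "homeomorphic_maps (subtopology M U) (top_of_set (\<phi> ` U)) \<phi> g"
    using chart_homeo[OF assms] homeomorphic_map_maps by blast
  ultimately have "continuous_map (top_of_set (\<phi> ` U)) M g" "\<And>q. q \<in> U \<Longrightarrow> g (\<phi> q) = q"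
    by (auto simp: homeomorphic_maps_def continuous_map_in_subtopology)
  then show ?thesis
    by (elim continuous_map_eq) (use chart_inj[OF assms] in \<open>auto simp: inv_into_f_f\<close>)
qed

sublocale ball_covering M F
proof
  show "compact_space M" by (rule comp)
  show "Hausdorff_space M" by (rule Hausdorff)
  show "connected_space M" by (rule connected)
  show "topspace M \<noteq> {}" by (rule nonempty)
  show "continuous_map M euclidean F" by (rule continuous_F)
  show "F ` topspace M \<subseteq> cball 0 1" using F_cball by blast
  fix p assume p: "p \<in> topspace M"
  obtain U \<phi> where c: "(U, \<phi>) \<in> \<A>" "p \<in> U" using chart_cover[OF p] by blast
  obtain \<epsilon> g where g: "\<epsilon> > 0" "\<And>k. Ck_on k (ball (F p) \<epsilon>) g" "g (F p) = \<phi> p"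
    "\<And>x. x \<in> ball (F p) \<epsilon> \<inter> cball 0 1 \<Longrightarrow> g x \<in> \<phi> ` U \<and> F (inv_into U \<phi> (g x)) = x"
    "openin M ((\<lambda>x. inv_into U \<phi> (g x)) ` (ball (F p) \<epsilon> \<inter> cball 0 1))"
    by (rule local_structure[OF c]) (rule that)
  let ?\<sigma> = "\<lambda>x. inv_into U \<phi> (g x)" and ?B = "ball (F p) \<epsilon> \<inter> cball 0 1"
  have "continuous_map (top_of_set ?B) (top_of_set (\<phi> ` U)) g"
    using continuous_on_subset[OF Ck_on_imp_continuous[OF g(2)], of ?B] g(4)
    by (auto simp: continuous_map_in_subtopology)
  from continuous_map_compose[OF this chart_inv_continuous[OF c(1)]]
  have "continuous_map (top_of_set ?B) M ?\<sigma>" by (simp add: o_def)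
  moreover have "?\<sigma> (F p) = p" using g(3) chart_inj[OF c(1)] c(2) by (simp add: inv_into_f_f)
  ultimately show "\<exists>\<epsilon>>0. \<exists>\<sigma>. continuous_map (top_of_set (ball (F p) \<epsilon> \<inter> cball 0 1)) M \<sigma> \<and> \<sigma> (F p) = p \<and>
       (\<forall>x\<in>ball (F p) \<epsilon> \<inter> cball 0 1. F (\<sigma> x) = x) \<and> openin M (\<sigma> ` (ball (F p) \<epsilon> \<inter> cball 0 1))"
    using g by (intro exI[of _ \<epsilon>] conjI exI[of _ ?\<sigma>]) auto
qed

text \<open>Since \<open>F\<close> is bijective, its inverse read in a chart must coincide near each
  point with the smooth local inverse from \<open>local_structure\<close>.\<close>

lemma diffeomorphic: "diffeomorphic_to_closed_disk M \<A>"
proof -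
  obtain \<psi> where \<psi>: "homeomorphic_maps M (top_of_set (cball 0 1)) F \<psi>"
    using homeomorphic homeomorphic_map_maps by blast
  have \<psi>F: "\<psi> (F q) = q" if "q \<in> topspace M" for q
    using \<psi> that by (simp add: homeomorphic_maps_def)
  have F\<psi>: "F (\<psi> x) = x" and \<psi>M: "\<psi> x \<in> topspace M" if "x \<in> cball 0 1" for x
    using \<psi> that by (auto simp: homeomorphic_maps_def continuous_map_def)
  have "smooth_on (cball 0 1 \<inter> \<psi> -` U) (\<phi> \<circ> \<psi>)" if c: "(U, \<phi>) \<in> \<A>" for U \<phi>
    unfolding smooth_on_def
  proof
    fix x assume x: "x \<in> cball 0 1 \<inter> \<psi> -` U"
    then have cx: "\<psi> x \<in> U" and Fx: "F (\<psi> x) = x" using F\<psi> by auto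
    obtain \<epsilon> g where g: "\<epsilon> > 0" "\<And>k. Ck_on k (ball (F (\<psi> x)) \<epsilon>) g" "g (F (\<psi> x)) = \<phi> (\<psi> x)"
      "\<And>y. y \<in> ball (F (\<psi> x)) \<epsilon> \<inter> cball 0 1 \<Longrightarrow> g y \<in> \<phi> ` U \<and> F (inv_into U \<phi> (g y)) = y"
      "openin M ((\<lambda>y. inv_into U \<phi> (g y)) ` (ball (F (\<psi> x)) \<epsilon> \<inter> cball 0 1))"
      by (rule local_structure[OF c cx]) (rule that)
    have "g y = (\<phi> \<circ> \<psi>) y" if y: "y \<in> cball 0 1 \<inter> \<psi> -` U \<inter> ball x \<epsilon>" for y
    proof -
      have gy: "g y \<in> \<phi> ` U" "F (inv_into U \<phi> (g y)) = y" using g(4)[of y] y Fx by auto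
      have "inv_into U \<phi> (g y) \<in> U" by (rule inv_into_into[OF gy(1)])
      then have "\<psi> (F (inv_into U \<phi> (g y))) = inv_into U \<phi> (g y)" using \<psi>F chart_subset[OF c] by blast
      then have "\<psi> y = inv_into U \<phi> (g y)" using gy(2) by simp
      then show ?thesis using f_inv_into_f[OF gy(1)] by simp
    qed
    then show "\<exists>V h. open V \<and> x \<in> V \<and> (\<forall>k. Ck_on k V h) \<and> (\<forall>y\<in>cball 0 1 \<inter> \<psi> -` U \<inter> V. h y = (\<phi> \<circ> \<psi>) y)"
      using g(1,2) Fx by (intro exI[of _ "ball x \<epsilon>"] exI[of _ g]) auto
  qed
  moreover have "smooth_on (\<phi> ` U) (F \<circ> inv_into U \<phi>)" if c: "(U, \<phi>) \<in> \<A>" for U \<phi>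
    unfolding smooth_on_def
  proof
    fix x assume x: "x \<in> \<phi> ` U"
    have "smooth_on (\<phi> ` U) (in_chart f U \<phi>)"
      using hyp c unfolding immersed_hypersurface_def smooth_immersion_def by fast
    then obtain V g where g: "open V" "x \<in> V" "\<And>k. Ck_on k V g" "\<And>y. y \<in> \<phi> ` U \<inter> V \<Longrightarrow> g y = in_chart f U \<phi> y"
      using x by (rule smooth_onE) (rule that)
    have "Ck_on k V (\<lambda>y. (1 / r0) *\<^sub>R L (g y))" for k
      by (rule Ck_on_bounded_linear[OF bounded_linear_scaled_L g(1,3)])
    then show "\<exists>V h. open V \<and> x \<in> V \<and> (\<forall>k. Ck_on k V h) \<and> (\<forall>y\<in>\<phi> ` U \<inter> V. h y = (F \<circ> inv_into U \<phi>) y)"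
      using g by (intro exI[of _ V] exI[of _ "\<lambda>y. (1 / r0) *\<^sub>R L (g y)"]) (auto simp: F_def)
  qed
  moreover have "homeomorphic_maps (top_of_set (cball 0 1)) M \<psi> F"
    by (rule homeomorphic_maps_sym[THEN iffD1, OF \<psi>])
  ultimately show ?thesis
    unfolding diffeomorphic_to_closed_disk_def by blast
qed

end

context planar_hypersurface
begin

text \<open>Both parts of \<open>bmat\<close> vanish: tangent vectors stay orthogonal to the
  constant normal, so their derivatives have no normal part, and the position vector lies in the
  same hyperplane, so \<open>W\<close> is 0.\<close>

lemma totally_geodesic:
  assumes d: "\<And>x :: real ^ 'm. norm x \<le> r0 \<Longrightarrow>
    ((\<lambda>z. u ((norm z)\<^sup>2)) has_derivative (\<lambda>v. 2 * up (x \<bullet> x) * (x \<bullet> v))) (at x)"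
  shows "totally_geodesic_immersion (conformal_metric u) \<A> f"
  unfolding totally_geodesic_immersion_def
proof (clarify)
  fix U \<phi> p i j assume c: "(U, \<phi>) \<in> \<A>" "p \<in> U"
  obtain V G \<nu> where P: "chart_patch V G \<nu> (\<phi> ` U) (in_chart f U \<phi>)" "\<phi> p \<in> V" "half_space \<inter> V \<subseteq> \<phi> ` U"
    using chart_patch_exists[OF c] by metis
  interpret P: chart_patch V G \<nu> "\<phi> ` U" "in_chart f U \<phi>" by (rule P)
  have fG: "f q = G (\<phi> q)" if "q \<in> U" "\<phi> q \<in> V" for q
    using P.FG[of "\<phi> q"] in_chart_eq[OF c(1) that(1)] that by auto
  have \<nu>e: "\<nu> (\<phi> q) = e \<or> \<nu> (\<phi> q) = - e" if "q \<in> U" "\<phi> q \<in> V" for q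
  proof -
    have "q \<in> topspace M" using that(1) chart_subset[OF c(1)] by blast
    then show ?thesis using N_chart[OF c(1) P(1) that] Ne[of q] by (metis minus_minus)
  qed
  have pM: "p \<in> topspace M" using c chart_subset by blast
  have hs: "\<phi> p \<in> half_space \<inter> V"
    using chart_image[OF c(1)] c(2) P(2) openin_imp_subset by blast
  have tangent: "pd j G y \<bullet> e = 0" if y: "y \<in> half_space \<inter> V" for y
  proof -
    obtain q where "q \<in> U" "y = \<phi> q" using P(3) y by blast
    then show ?thesis using \<nu>e[of q] P.normal'[of y j] y by auto
  qed
  have dp: "pd j G differentiable at (\<phi> p)" by (rule P.dpd[OF P(2)])
  have "(\<lambda>y. pd j G y \<bullet> e) differentiable at (\<phi> p)" by (rule differentiable_inner'[OF dp differentiable_const])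
  from half_space_vanishing_derivative[OF P.op hs tangent this]
  have "pd i (\<lambda>y. pd j G y \<bullet> e) (\<phi> p) = 0" by (simp add: pd_frechet)
  then have "pd i (pd j G) (\<phi> p) \<bullet> e = 0"
    by (simp add: pd_inner[OF dp differentiable_const] pd_const)
  then have "P.h i j (\<phi> p) = 0" using \<nu>e[OF c(2) P(2)] by (auto simp: P.h_def)
  moreover have "P.W (\<phi> p) = 0"
    using \<nu>e[OF c(2) P(2)] fe[OF pM] fG[OF c(2) P(2)] by (auto simp: P.W_def)
  ultimately have "P.bmat up (\<phi> p) $ i $ j = 0" by (simp add: P.bmat_def)
  moreover have "norm (G (\<phi> p)) \<le> r0" using norm_f_le[OF pM] fG[OF c(2) P(2)] by simp
  ultimately show "second_fund_form (conformal_metric u) (\<phi> ` U) (in_chart f U \<phi>) (\<phi> p) i j = 0"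
    using P.second_fund_form_eq[of "\<phi> p" u up i j] d c(2) P(2) by simp
qed

end

section \<open>Hyperplanes as Euclidean spaces, and the gap theorem\<close>

lemma hyperplane_isometry:
  fixes e :: "real ^ 'm::finite"
  assumes "CARD('m) = CARD('n::finite) + 1" "e \<noteq> 0"
  obtains L :: "real ^ 'm \<Rightarrow> real ^ 'n" where "linear L" "\<And>v. v \<bullet> e = 0 \<Longrightarrow> norm (L v) = norm v"
proof -
  have "dim {v. e \<bullet> v = 0} = dim (UNIV :: (real ^ 'n) set)"
    using assms by (simp add: dim_hyperplane)
  then obtain L :: "real ^ 'm \<Rightarrow> real ^ 'n" where "linear L" "\<And>v. v \<in> {v. e \<bullet> v = 0} \<Longrightarrow> norm (L v) = norm v"
    using isometries_subspaces[OF subspace_hyperplane[of e] subspace_UNIV] by metis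
  then show ?thesis using that by (simp add: inner_commute)
qed

theorem theorem1p2:
  fixes R :: ereal and r0 rbar0 :: real
    and u u' u'' :: "real \<Rightarrow> real"
    and M :: "'p topology"
    and \<A> :: "('p set \<times> ('p \<Rightarrow> real ^ 'n::finite)) set"
    and f :: "'p \<Rightarrow> real ^ 'm::finite"
  defines "D \<equiv> {t::real. 0 \<le> t \<and> ereal t < R\<^sup>2}"
    and "g \<equiv> conformal_metric u :: real ^ 'm \<Rightarrow> real ^ 'm ^ 'm"
    and "rbar0 \<equiv> r0 * integral {0..1} (\<lambda>t. exp (u (t\<^sup>2 * r0\<^sup>2)))"
  assumes n: "CARD('n) \<ge> 3"
    and R: "0 < R"
    and u_smooth: "smooth_on D u"
    and u': "\<And>t. t \<in> D \<Longrightarrow> (u has_real_derivative u' t) (at t within D)"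
    and u'': "\<And>t. t \<in> D \<Longrightarrow> (u' has_real_derivative u'' t) (at t within D)"
    and i: "\<And>t. t \<in> D \<Longrightarrow> u'' t - (u' t)\<^sup>2 \<le> 0"
    and ii: "\<And>t. t \<in> D \<Longrightarrow> - u'' t * t - u' t \<le> 0"
    and r0: "0 < r0" "ereal r0 < R"
    and hypersurface: "immersed_hypersurface M \<A> f"
    and compact: "compact_space M"
    and connected: "connected_space M" "topspace M \<noteq> {}"
    and in_ball: "f ` topspace M \<subseteq> cball 0 r0"
    and free: "free_boundary g r0 \<A> f"
    and minimal: "minimal_immersion g \<A> f"
    and gap: "sff_norm_sq_le g \<A> f ((real CARD('n))\<^sup>2 / (4 * rbar0\<^sup>2))"
  shows "totally_geodesic_immersion g \<A> f \<and> diffeomorphic_to_closed_disk M \<A> \<and> 0 \<in> f ` topspace M"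
proof -
  note r0_lt = r0(2) and M = connected and minimal' = minimal and gap' = gap and i' = i
  interpret radial R u u' u'' D
    by unfold_locales (fact D_def[THEN meta_eq_to_obj_eq] R u' u'' ii)+
  have rbar: "s r0 = rbar0"
    using s_eq[OF r0(1) square_in_D[OF r0]] by (simp add: rbar0_def)
  interpret immersed_in_ball M \<A> f r0
  proof
    show "norm (f p) = r0" if "p \<in> manifold_boundary \<A>" for p
      using free that by (simp add: free_boundary_def)
    fix U \<phi> p \<nu>
    assume c: "(U, \<phi>) \<in> \<A>" "p \<in> U" "p \<in> manifold_boundary \<A>"
      and \<nu>: "\<And>v. \<nu> \<bullet> frechet_derivative (in_chart f U \<phi>) (at (\<phi> p) within \<phi> ` U) v = 0"
    have "\<nu> \<in> normal_space g (f p) (param_tangent_space (\<phi> ` U) (in_chart f U \<phi>) (\<phi> p))"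
      using \<nu> by (auto simp: normal_space_def param_tangent_space_def g_def metric_inner_conformal)
    \<comment> \<open>The position vector is normal to the sphere for \<open>g\<close> as well, a
      multiple of the Euclidean metric; testing the free boundary condition with it gives the
      Euclidean form.\<close>
    moreover have "f p \<in> normal_space g (f p) {v. f p \<bullet> v = 0}"
      by (simp add: normal_space_def g_def metric_inner_conformal)
    ultimately have "metric_inner g (f p) \<nu> (f p) = 0"
      using free c unfolding free_boundary_def by fast
    then show "\<nu> \<bullet> f p = 0" by (simp add: g_def metric_inner_conformal)
  qed (fact hypersurface compact in_ball r0(1))+
  interpret gap_hypersurface M \<A> f r0 R u u' u'' D
  proof
    show "sff_norm_sq_le (conformal_metric u) \<A> f ((real CARD('n))\<^sup>2 / (4 * (s r0)\<^sup>2))"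
      using gap' by (simp add: rbar g_def)
    show "minimal_immersion (conformal_metric u) \<A> f" using minimal' by (simp add: g_def)
  qed (fact i' r0_lt M)+
  interpret conical_hypersurface M \<A> f r0
    by unfold_locales (fact support_zero M)+
  obtain e where e: "norm e = 1" "\<And>p. p \<in> topspace M \<Longrightarrow> N p = e \<or> N p = - e"
    using normal_constant by blast
  have "e \<noteq> 0" using e(1) by auto
  then obtain L :: "real ^ 'm \<Rightarrow> real ^ 'n" where L: "linear L" "\<And>v. v \<bullet> e = 0 \<Longrightarrow> norm (L v) = norm v"
    using hyperplane_isometry[OF card] by metis
  interpret planar_hypersurface M \<A> f r0 e L
  proof (intro planar_hypersurface.intro planar_hypersurface_axioms.intro)
    show "immersed_in_ball M \<A> f r0" by unfold_locales
    show "f p \<bullet> e = 0" if "p \<in> topspace M" for p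
      using support_zero[OF that] e(2)[OF that] by auto
  qed (fact e(2) L M)+
  have "totally_geodesic_immersion g \<A> f"
    unfolding g_def by (rule totally_geodesic[where up = u']) (rule has_derivative_u_norm[OF inner_D])
  then show ?thesis using diffeomorphic zero_in_image by force
qed

end
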